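(* Let $d\ge1$, let $\mathcal{E}$ be an exact category and let $\mathcal{U}$ be a $d$-rigid subcategory of $\mathcal{E}$. The subcategory $$\mathcal{U}^d(\mathcal{E})=\{E\in\mathcal{E}\mid\exists\ 0\to E\to U^1\to\cdots\to U^d\to0\text{ exact in }\mathcal{E},\ U^i\in\mathcal{U},\ 1\le i\le d\}$$ is closed under extensions in $\mathcal{E}$ if and only if any exact sequence $$0\to U\to E\to U_{d-1}\to\cdots\to U_1\to U'\to0$$ in $\mathcal{E}$ with $U,U_1,\dots,U_{d-1},U'\in\mathcal{U}$ is Yoneda equivalent (in $\mathcal{E}$) to an exact sequence with all terms in $\mathcal{U}$.
   Context: Conventions: all categories are additive; subcategories are full, closed under isomorphisms and finite direct sums. Exact categories are in the sense of Quillen. A sequence (complex) $X_\bullet$ is exact if there are conflations $0\to Z_i\to X_i\to Z_{i-1}\to0$ such that $X_i\to X_{i-1}$ is the composite $X_i\to Z_{i-1}\to X_{i-1}$. $\operatorname{Ext}^n_{\mathcal{E}}(X,Y)$ denotes Yoneda Ext, whose elements are Yoneda-equivalence classes of exact sequences $0\to Y\to E_n\to\cdots\to E_1\to X\to0$. $\mathcal{U}$ is $d$-rigid if $\operatorname{Ext}^i_{\mathcal{E}}(U,U')=0$ for all $0<i<d$ and $U,U'\in\mathcal{U}$. A subcategory $\mathcal{E}'$ is closed under extensions if for every conflation $0\to E_3\to E_2\to E_1\to0$ with $E_1,E_3\in\mathcal{E}'$ one has $E_2\in\mathcal{E}'$. *)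

theory Defs
  imports "HOL-Algebra.Group"
begin

section \<open>Additive categories\<close>

text \<open>Composition is written in the usual order: \<open>g \<cdot>\<^bsub>C\<^esub> f\<close> is ``first \<open>f\<close>, then \<open>g\<close>''.
  The operations are only meaningful on \<open>Obj\<close>, \<open>Arr\<close> and composable or parallel arrows.\<close>

record ('o, 'm) precat =
  Obj :: "'o set"
  Arr :: "'m set"
  Dom :: "'m \<Rightarrow> 'o"
  Cod :: "'m \<Rightarrow> 'o"
  Ident :: "'o \<Rightarrow> 'm"
  Comp :: "'m \<Rightarrow> 'm \<Rightarrow> 'm"  (infixl "\<cdot>\<index>" 70)

record ('o, 'm) preadd_cat = "('o, 'm) precat" +
  Add :: "'m \<Rightarrow> 'm \<Rightarrow> 'm"  (infixl "\<boxplus>\<index>" 65)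
  ZeroArr :: "'o \<Rightarrow> 'o \<Rightarrow> 'm"

definition Hom :: "('o, 'm, 'x) precat_scheme \<Rightarrow> 'o \<Rightarrow> 'o \<Rightarrow> 'm set" where
  "Hom C X Y = {f \<in> Arr C. Dom C f = X \<and> Cod C f = Y}"

locale category =
  fixes C :: "('o, 'm, 'x) precat_scheme" (structure)
  assumes dom_obj: "f \<in> Arr C \<Longrightarrow> Dom C f \<in> Obj C"
    and cod_obj: "f \<in> Arr C \<Longrightarrow> Cod C f \<in> Obj C"
    and ident_in: "X \<in> Obj C \<Longrightarrow> Ident C X \<in> Hom C X X"
    and comp_in: "f \<in> Hom C X Y \<Longrightarrow> g \<in> Hom C Y Z \<Longrightarrow> g \<cdot> f \<in> Hom C X Z"
    and comp_ident: "f \<in> Hom C X Y \<Longrightarrow> f \<cdot> Ident C X = f"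
    and ident_comp: "f \<in> Hom C X Y \<Longrightarrow> Ident C Y \<cdot> f = f"
    and comp_assoc: "f \<in> Hom C W X \<Longrightarrow> g \<in> Hom C X Y \<Longrightarrow> h \<in> Hom C Y Z \<Longrightarrow>
      (h \<cdot> g) \<cdot> f = h \<cdot> (g \<cdot> f)"

definition is_iso :: "('o, 'm, 'x) precat_scheme \<Rightarrow> 'm \<Rightarrow> bool" where
  "is_iso C f \<longleftrightarrow> f \<in> Arr C \<and> (\<exists>g \<in> Hom C (Cod C f) (Dom C f).
     g \<cdot>\<^bsub>C\<^esub> f = Ident C (Dom C f) \<and> f \<cdot>\<^bsub>C\<^esub> g = Ident C (Cod C f))"

definition is_zero_obj :: "('o, 'm, 'x) precat_scheme \<Rightarrow> 'o \<Rightarrow> bool" where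
  "is_zero_obj C Z \<longleftrightarrow> Z \<in> Obj C \<and>
     (\<forall>X \<in> Obj C. (\<exists>!f. f \<in> Hom C X Z) \<and> (\<exists>!f. f \<in> Hom C Z X))"

definition hom_group :: "('o, 'm, 'x) preadd_cat_scheme \<Rightarrow> 'o \<Rightarrow> 'o \<Rightarrow> 'm monoid" where
  "hom_group C X Y = \<lparr>carrier = Hom C X Y, mult = Add C, one = ZeroArr C X Y\<rparr>"

definition is_direct_sum :: "('o, 'm, 'x) preadd_cat_scheme \<Rightarrow> 'o \<Rightarrow> 'o \<Rightarrow> 'o \<Rightarrow> bool" where
  "is_direct_sum C S X Y \<longleftrightarrow>
     (\<exists>i1 \<in> Hom C X S. \<exists>i2 \<in> Hom C Y S. \<exists>p1 \<in> Hom C S X. \<exists>p2 \<in> Hom C S Y.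
        p1 \<cdot>\<^bsub>C\<^esub> i1 = Ident C X \<and> p2 \<cdot>\<^bsub>C\<^esub> i2 = Ident C Y \<and>
        p2 \<cdot>\<^bsub>C\<^esub> i1 = ZeroArr C X Y \<and> p1 \<cdot>\<^bsub>C\<^esub> i2 = ZeroArr C Y X \<and>
        (i1 \<cdot>\<^bsub>C\<^esub> p1) \<boxplus>\<^bsub>C\<^esub> (i2 \<cdot>\<^bsub>C\<^esub> p2) = Ident C S)"

locale additive_category = category C for C :: "('o, 'm, 'x) preadd_cat_scheme" (structure) +
  assumes hom_comm_group: "X \<in> Obj C \<Longrightarrow> Y \<in> Obj C \<Longrightarrow> comm_group (hom_group C X Y)"
    and comp_add_left: "f \<in> Hom C X Y \<Longrightarrow> g \<in> Hom C Y Z \<Longrightarrow> h \<in> Hom C Y Z \<Longrightarrow>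
      (g \<boxplus> h) \<cdot> f = (g \<cdot> f) \<boxplus> (h \<cdot> f)"
    and comp_add_right: "f \<in> Hom C X Y \<Longrightarrow> g \<in> Hom C X Y \<Longrightarrow> h \<in> Hom C Y Z \<Longrightarrow>
      h \<cdot> (f \<boxplus> g) = (h \<cdot> f) \<boxplus> (h \<cdot> g)"
    and ex_zero_obj: "\<exists>Z. is_zero_obj C Z"
    and ex_direct_sum: "X \<in> Obj C \<Longrightarrow> Y \<in> Obj C \<Longrightarrow> \<exists>S. is_direct_sum C S X Y"

text \<open>A full subcategory is given by its set of objects. Finite direct sums include the empty
  one.\<close>

definition additive_subcategory :: "('o, 'm, 'x) preadd_cat_scheme \<Rightarrow> 'o set \<Rightarrow> bool" where
  "additive_subcategory C U \<longleftrightarrow> U \<subseteq> Obj C \<and>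
     (\<forall>f. is_iso C f \<and> Dom C f \<in> U \<longrightarrow> Cod C f \<in> U) \<and>
     (\<forall>Z. is_zero_obj C Z \<longrightarrow> Z \<in> U) \<and>
     (\<forall>X \<in> U. \<forall>Y \<in> U. \<forall>S. is_direct_sum C S X Y \<longrightarrow> S \<in> U)"

section \<open>Exact categories\<close>

definition is_kernel :: "('o, 'm, 'x) preadd_cat_scheme \<Rightarrow> 'm \<Rightarrow> 'm \<Rightarrow> bool" where
  "is_kernel C i p \<longleftrightarrow> i \<in> Arr C \<and> p \<in> Arr C \<and> Cod C i = Dom C p \<and>
     p \<cdot>\<^bsub>C\<^esub> i = ZeroArr C (Dom C i) (Cod C p) \<and>
     (\<forall>T. \<forall>t \<in> Hom C T (Dom C p). p \<cdot>\<^bsub>C\<^esub> t = ZeroArr C T (Cod C p) \<longrightarrow>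
        (\<exists>!s. s \<in> Hom C T (Dom C i) \<and> i \<cdot>\<^bsub>C\<^esub> s = t))"

definition is_cokernel :: "('o, 'm, 'x) preadd_cat_scheme \<Rightarrow> 'm \<Rightarrow> 'm \<Rightarrow> bool" where
  "is_cokernel C p i \<longleftrightarrow> i \<in> Arr C \<and> p \<in> Arr C \<and> Cod C i = Dom C p \<and>
     p \<cdot>\<^bsub>C\<^esub> i = ZeroArr C (Dom C i) (Cod C p) \<and>
     (\<forall>T. \<forall>t \<in> Hom C (Cod C i) T. t \<cdot>\<^bsub>C\<^esub> i = ZeroArr C (Dom C i) T \<longrightarrow>
        (\<exists>!s. s \<in> Hom C (Cod C p) T \<and> s \<cdot>\<^bsub>C\<^esub> p = t))"

text \<open>In \<open>is_pushout C i f f' i'\<close> the span is \<open>(i, f)\<close>, and \<open>i'\<close> is the arrow parallel to \<open>i\<close>: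
  \<open>f' \<cdot> i = i' \<cdot> f\<close>. In \<open>is_pullback C p f f' p'\<close> the cospan is \<open>(p, f)\<close>, and \<open>p'\<close> is the arrow
  parallel to \<open>p\<close>: \<open>p \<cdot> f' = f \<cdot> p'\<close>.\<close>

definition is_pushout :: "('o, 'm, 'x) precat_scheme \<Rightarrow> 'm \<Rightarrow> 'm \<Rightarrow> 'm \<Rightarrow> 'm \<Rightarrow> bool" where
  "is_pushout C i f f' i' \<longleftrightarrow>
     {i, f, f', i'} \<subseteq> Arr C \<and> Dom C i = Dom C f \<and> Dom C f' = Cod C i \<and> Dom C i' = Cod C f \<and>
     Cod C f' = Cod C i' \<and> f' \<cdot>\<^bsub>C\<^esub> i = i' \<cdot>\<^bsub>C\<^esub> f \<and>
     (\<forall>T. \<forall>u \<in> Hom C (Cod C i) T. \<forall>v \<in> Hom C (Cod C f) T. u \<cdot>\<^bsub>C\<^esub> i = v \<cdot>\<^bsub>C\<^esub> f \<longrightarrow>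
        (\<exists>!w. w \<in> Hom C (Cod C i') T \<and> w \<cdot>\<^bsub>C\<^esub> f' = u \<and> w \<cdot>\<^bsub>C\<^esub> i' = v))"

definition is_pullback :: "('o, 'm, 'x) precat_scheme \<Rightarrow> 'm \<Rightarrow> 'm \<Rightarrow> 'm \<Rightarrow> 'm \<Rightarrow> bool" where
  "is_pullback C p f f' p' \<longleftrightarrow>
     {p, f, f', p'} \<subseteq> Arr C \<and> Cod C p = Cod C f \<and> Cod C f' = Dom C p \<and> Cod C p' = Dom C f \<and>
     Dom C f' = Dom C p' \<and> p \<cdot>\<^bsub>C\<^esub> f' = f \<cdot>\<^bsub>C\<^esub> p' \<and>
     (\<forall>T. \<forall>u \<in> Hom C T (Dom C p). \<forall>v \<in> Hom C T (Dom C f). p \<cdot>\<^bsub>C\<^esub> u = f \<cdot>\<^bsub>C\<^esub> v \<longrightarrow>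
        (\<exists>!w. w \<in> Hom C T (Dom C p') \<and> f' \<cdot>\<^bsub>C\<^esub> w = u \<and> p' \<cdot>\<^bsub>C\<^esub> w = v))"

record ('o, 'm) preexact_cat = "('o, 'm) preadd_cat" +
  Confl :: "('m \<times> 'm) set"

definition inflation :: "('o, 'm, 'x) preexact_cat_scheme \<Rightarrow> 'm \<Rightarrow> bool" where
  "inflation C i \<longleftrightarrow> (\<exists>p. (i, p) \<in> Confl C)"

definition deflation :: "('o, 'm, 'x) preexact_cat_scheme \<Rightarrow> 'm \<Rightarrow> bool" where
  "deflation C p \<longleftrightarrow> (\<exists>i. (i, p) \<in> Confl C)"

text \<open>Quillen's exact categories, in the axiomatisation of Keller and Buehler (which omits
  Quillen's redundant ``obscure axiom'').\<close>

locale exact_category = additive_category C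
  for C :: "('o, 'm, 'x) preexact_cat_scheme" (structure) +
  assumes confl_kernel: "(i, p) \<in> Confl C \<Longrightarrow> is_kernel C i p"
    and confl_cokernel: "(i, p) \<in> Confl C \<Longrightarrow> is_cokernel C p i"
    and confl_iso_closed:
      "\<lbrakk>(i, p) \<in> Confl C; i' \<in> Arr C; p' \<in> Arr C; Cod C i' = Dom C p';
        is_iso C a; a \<in> Hom C (Dom C i) (Dom C i');
        is_iso C b; b \<in> Hom C (Cod C i) (Cod C i');
        is_iso C c; c \<in> Hom C (Cod C p) (Cod C p');
        b \<cdot> i = i' \<cdot> a; c \<cdot> p = p' \<cdot> b\<rbrakk> \<Longrightarrow> (i', p') \<in> Confl C"
    and ident_inflation: "X \<in> Obj C \<Longrightarrow> inflation C (Ident C X)"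
    and ident_deflation: "X \<in> Obj C \<Longrightarrow> deflation C (Ident C X)"
    and inflation_comp: "\<lbrakk>inflation C i; inflation C j; Cod C i = Dom C j\<rbrakk> \<Longrightarrow> inflation C (j \<cdot> i)"
    and deflation_comp: "\<lbrakk>deflation C p; deflation C q; Cod C p = Dom C q\<rbrakk> \<Longrightarrow> deflation C (q \<cdot> p)"
    and inflation_pushout: "\<lbrakk>inflation C i; f \<in> Arr C; Dom C f = Dom C i\<rbrakk> \<Longrightarrow>
      \<exists>f' i'. is_pushout C i f f' i' \<and> inflation C i'"
    and deflation_pullback: "\<lbrakk>deflation C p; f \<in> Arr C; Cod C f = Cod C p\<rbrakk> \<Longrightarrow>
      \<exists>f' p'. is_pullback C p f f' p' \<and> deflation C p'"

definition extension_closed :: "('o, 'm, 'x) preexact_cat_scheme \<Rightarrow> 'o set \<Rightarrow> bool" where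
  "extension_closed C S \<longleftrightarrow>
     (\<forall>(i, p) \<in> Confl C. Dom C i \<in> S \<and> Cod C p \<in> S \<longrightarrow> Cod C i \<in> S)"

section \<open>Exact sequences and Yoneda Ext\<close>

text \<open>A sequence \<open>0 \<rightarrow> A\<^sub>0 \<rightarrow> A\<^sub>1 \<rightarrow> \<dots> \<rightarrow> A\<^sub>m \<rightarrow> 0\<close> with \<open>m \<ge> 1\<close> is the nonempty list of its \<open>m\<close> arrows
  \<open>A\<^sub>k \<rightarrow> A\<^sub>k\<^sub>+\<^sub>1\<close>, the zeros at both ends being left implicit; \<open>terms\<close> lists \<open>A\<^sub>0, \<dots>, A\<^sub>m\<close>.\<close>

definition terms :: "('o, 'm, 'x) precat_scheme \<Rightarrow> 'm list \<Rightarrow> 'o list" where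
  "terms C fs = Dom C (hd fs) # map (Cod C) fs"

text \<open>Exactness provides a conflation \<open>Z\<^sub>k \<rightarrow> A\<^sub>k \<rightarrow> Z\<^sub>k\<^sub>+\<^sub>1\<close> at each term, through which the arrows
  factor. At the implicit zero terms on both sides the conflations have the form \<open>0 \<rightarrow> 0 \<rightarrow> 0\<close>, which
  amounts to \<open>Z\<^sub>0\<close> and \<open>Z\<^sub>m\<^sub>+\<^sub>1\<close> being zero objects.\<close>

definition exact_seq :: "('o, 'm, 'x) preexact_cat_scheme \<Rightarrow> 'm list \<Rightarrow> bool" where
  "exact_seq C fs \<longleftrightarrow> fs \<noteq> [] \<and>
     (\<exists>i p. (\<forall>k \<le> length fs. (i k, p k) \<in> Confl C \<and> Cod C (i k) = terms C fs ! k) \<and>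
        (\<forall>k < length fs. Cod C (p k) = Dom C (i (Suc k)) \<and> fs ! k = i (Suc k) \<cdot>\<^bsub>C\<^esub> p k) \<and>
        is_zero_obj C (Dom C (i 0)) \<and> is_zero_obj C (Cod C (p (length fs))))"

text \<open>The exact sequences \<open>0 \<rightarrow> Y \<rightarrow> E\<^sub>n \<rightarrow> \<dots> \<rightarrow> E\<^sub>1 \<rightarrow> X \<rightarrow> 0\<close>; so \<open>terms C fs ! 0 = Y\<close>,
  \<open>terms C fs ! k = E\<^sub>n\<^sub>+\<^sub>1\<^sub>-\<^sub>k\<close> for \<open>1 \<le> k \<le> n\<close>, and \<open>terms C fs ! (n + 1) = X\<close>.\<close>

definition extensions ::
  "('o, 'm, 'x) preexact_cat_scheme \<Rightarrow> nat \<Rightarrow> 'o \<Rightarrow> 'o \<Rightarrow> 'm list set" where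
  "extensions C n X Y =
     {fs. length fs = n + 1 \<and> exact_seq C fs \<and> hd (terms C fs) = Y \<and> last (terms C fs) = X}"

text \<open>Morphisms of exact sequences that are the identity at both ends.\<close>

definition yoneda_step ::
  "('o, 'm, 'x) preexact_cat_scheme \<Rightarrow> nat \<Rightarrow> 'o \<Rightarrow> 'o \<Rightarrow> 'm list \<Rightarrow> 'm list \<Rightarrow> bool" where
  "yoneda_step C n X Y fs gs \<longleftrightarrow> fs \<in> extensions C n X Y \<and> gs \<in> extensions C n X Y \<and>
     (\<exists>h. h 0 = Ident C Y \<and> h (n + 1) = Ident C X \<and>
        (\<forall>k \<le> n + 1. h k \<in> Hom C (terms C fs ! k) (terms C gs ! k)) \<and>
        (\<forall>k \<le> n. gs ! k \<cdot>\<^bsub>C\<^esub> h k = h (Suc k) \<cdot>\<^bsub>C\<^esub> fs ! k))"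

definition yoneda_equiv ::
  "('o, 'm, 'x) preexact_cat_scheme \<Rightarrow> nat \<Rightarrow> 'o \<Rightarrow> 'o \<Rightarrow> ('m list \<times> 'm list) set" where
  "yoneda_equiv C n X Y =
     {(fs, gs). fs \<in> extensions C n X Y \<and> gs \<in> extensions C n X Y \<and>
        equivclp (yoneda_step C n X Y) fs gs}"

text \<open>The underlying set of the group \<open>Ext\<^sup>n(X, Y)\<close>, for \<open>n \<ge> 1\<close>.\<close>

definition Ext ::
  "('o, 'm, 'x) preexact_cat_scheme \<Rightarrow> nat \<Rightarrow> 'o \<Rightarrow> 'o \<Rightarrow> 'm list set set" where
  "Ext C n X Y = extensions C n X Y // yoneda_equiv C n X Y"

text \<open>\<open>Ext\<^sup>n(X, Y) = 0\<close> says that this group is trivial, i.e. has exactly one element, so the Baer sum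
  is not needed.\<close>

definition rigid :: "('o, 'm, 'x) preexact_cat_scheme \<Rightarrow> nat \<Rightarrow> 'o set \<Rightarrow> bool" where
  "rigid C d U \<longleftrightarrow> (\<forall>n X Y. 0 < n \<and> n < d \<and> X \<in> U \<and> Y \<in> U \<longrightarrow> is_singleton (Ext C n X Y))"

text \<open>The objects \<open>E\<close> having an exact sequence \<open>0 \<rightarrow> E \<rightarrow> U\<^sup>1 \<rightarrow> \<dots> \<rightarrow> U\<^sup>d \<rightarrow> 0\<close> with all \<open>U\<^sup>i\<close> in \<open>U\<close>.\<close>

definition coresolved :: "('o, 'm, 'x) preexact_cat_scheme \<Rightarrow> nat \<Rightarrow> 'o set \<Rightarrow> 'o set" where
  "coresolved C d U =
     {E \<in> Obj C. \<exists>fs. length fs = d \<and> exact_seq C fs \<and> terms C fs ! 0 = E \<and>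
        (\<forall>k. 1 \<le> k \<and> k \<le> d \<longrightarrow> terms C fs ! k \<in> U)}"

end

theory Submission
  imports Defs
begin

text \<open>
  Write \<open>\<U>\<^sup>0\<close> for the zero objects and \<open>\<U>\<^sup>j\<^sup>+\<^sup>1\<close> for the objects \<open>E\<close> with a conflation
  \<open>E \<rightarrow> V \<rightarrow> E'\<close> where \<open>V \<in> \<U>\<close> and \<open>E' \<in> \<U>\<^sup>j\<close>. Dimension shifting along these conflations gives
  \<open>Ext\<^sup>1(\<U>\<^sup>j, \<U>) = 0\<close> for \<open>j < d\<close>, so that \<open>\<U>\<^sup>j\<close> is closed under extensions for \<open>j < d\<close>.

  If \<open>\<U>\<^sup>d\<close> is closed under extensions, the second term \<open>E\<close> of the given sequence is an extension of
  objects of \<open>\<U>\<^sup>d\<close>; embedding \<open>E\<close> into an object of \<open>\<U>\<close> with cokernel in \<open>\<U>\<^sup>d\<^sup>-\<^sup>1\<close> and pushing out moves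
  the defect one step to the right, and after \<open>d\<close> steps it has disappeared. Conversely, let
  \<open>E' \<rightarrow> M \<rightarrow> E''\<close> be a conflation with ends in \<open>\<U>\<^sup>d\<close>. Pushing out along \<open>E' \<rightarrow> V \<in> \<U>\<close> reduces to an
  extension \<open>M'\<close> of \<open>E''\<close> by \<open>V\<close>, and splicing it with the coresolution of \<open>E''\<close> gives a sequence
  \<open>\<xi>\<close> which by assumption is equivalent to some \<open>\<tau>\<close> with all terms in \<open>\<U>\<close>. Rigidity turns this
  equivalence into an actual morphism \<open>\<xi> \<rightarrow> \<tau>\<close> fixing both ends, whose mapping cone is a coresolution
  of \<open>M'\<close>.

  The long exact sequences are replaced by an Ore condition: a span of morphisms of extensions fixing
  the ends can be completed to a square. Hence equivalent extensions have a common target, and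
  an extension is trivial iff it maps to one whose last deflation splits.
\<close>

section \<open>The opposite exact category\<close>

text \<open>Dimension shifting embeds \<open>Ext^1(U^j, U)\<close> into \<open>Ext^j(U, U)\<close>.
  For \<open>j < d\<close> rigidity kills this group, and the arguments reduce to splitting
  conflations. For \<open>j = d\<close> it becomes \<open>Ext^d(U, U)\<close>, which rigidity leaves
  free; the condition on sequences controls just enough of this group. So closure under extensions
  is automatic below level \<open>d\<close>, and only the last level is at stake. An equivalence is
  a zigzag and gives no arrow between middle terms, while the cone needs one whose two ends cancel.
  Lifting along coresolutions fixes the left end but leaves some endomorphism of \<open>X\<close> on
  the right. Its correction asks for a section of a last deflation, whereas the shifting argument
  produces retractions of first inflations. The two are mirror images, which is why the opposite
  category comes at the very start. Pullbacks and pushouts of conflations are kept as morphisms that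
  are literally the identity on one end, so that splicing along the ends needs no chosen
  isomorphisms.\<close>

definition opc :: "('o, 'm, 'x) preexact_cat_scheme \<Rightarrow> ('o, 'm) preexact_cat" where
  "opc C = \<lparr>Obj = Obj C, Arr = Arr C, Dom = Cod C, Cod = Dom C, Ident = Ident C,
     Comp = (\<lambda>g f. f \<cdot>\<^bsub>C\<^esub> g), Add = Add C, ZeroArr = (\<lambda>X Y. ZeroArr C Y X),
     Confl = {(p, i). (i, p) \<in> Confl C}\<rparr>"

lemma opc_simps [simp]:
  "Obj (opc C) = Obj C" "Arr (opc C) = Arr C" "Dom (opc C) = Cod C" "Cod (opc C) = Dom C"
  "Ident (opc C) = Ident C" "g \<cdot>\<^bsub>opc C\<^esub> f = f \<cdot>\<^bsub>C\<^esub> g" "Add (opc C) = Add C"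
  "ZeroArr (opc C) X Y = ZeroArr C Y X" "(p, i) \<in> Confl (opc C) \<longleftrightarrow> (i, p) \<in> Confl C"
  by (simp_all add: opc_def)

lemma Hom_opc [simp]: "Hom (opc C) X Y = Hom C Y X"
  by (auto simp: Hom_def)

lemma hom_group_opc [simp]: "hom_group (opc C) X Y = hom_group C Y X"
  by (simp add: hom_group_def)

lemma is_iso_opc [simp]: "is_iso (opc C) f \<longleftrightarrow> is_iso C f"
  by (auto simp: is_iso_def)

lemma is_zero_obj_opc [simp]: "is_zero_obj (opc C) Z \<longleftrightarrow> is_zero_obj C Z"
  by (auto simp: is_zero_obj_def)

lemma is_direct_sum_opc [simp]: "is_direct_sum (opc C) S X Y \<longleftrightarrow> is_direct_sum C S X Y"
  unfolding is_direct_sum_def by auto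

lemma is_kernel_opc: "is_kernel (opc C) p i \<longleftrightarrow> is_cokernel C p i"
  by (auto simp: is_kernel_def is_cokernel_def)

lemma is_cokernel_opc: "is_cokernel (opc C) i p \<longleftrightarrow> is_kernel C i p"
  by (auto simp: is_kernel_def is_cokernel_def)

lemma is_pushout_opc: "is_pushout (opc C) p f f' p' \<longleftrightarrow> is_pullback C p f f' p'"
  by (simp add: is_pullback_def is_pushout_def)

lemma is_pullback_opc: "is_pullback (opc C) i f f' i' \<longleftrightarrow> is_pushout C i f f' i'"
  by (simp add: is_pullback_def is_pushout_def)

lemma inflation_opc [simp]: "inflation (opc C) p \<longleftrightarrow> deflation C p"
  by (simp add: inflation_def deflation_def)

lemma deflation_opc [simp]: "deflation (opc C) i \<longleftrightarrow> inflation C i"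
  by (simp add: inflation_def deflation_def)

lemma is_iso_inverse:
  assumes "is_iso C f"
  obtains g where "is_iso C g" "g \<in> Hom C (Cod C f) (Dom C f)"
    "g \<cdot>\<^bsub>C\<^esub> f = Ident C (Dom C f)" "f \<cdot>\<^bsub>C\<^esub> g = Ident C (Cod C f)"
proof -
  obtain g where g: "g \<in> Hom C (Cod C f) (Dom C f)"
    "g \<cdot>\<^bsub>C\<^esub> f = Ident C (Dom C f)" "f \<cdot>\<^bsub>C\<^esub> g = Ident C (Cod C f)"
    using assms unfolding is_iso_def by auto
  then have "is_iso C g"
    using assms unfolding is_iso_def by (auto simp: Hom_def)
  with g that show ?thesis by blast
qed

section \<open>Calculus of arrows in an additive category\<close>

context additive_category
begin

lemma arr_comp [simp]: "f \<in> Arr C \<Longrightarrow> g \<in> Arr C \<Longrightarrow> Cod C f = Dom C g \<Longrightarrow> g \<cdot> f \<in> Arr C"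
  and dom_comp [simp]: "f \<in> Arr C \<Longrightarrow> g \<in> Arr C \<Longrightarrow> Cod C f = Dom C g \<Longrightarrow> Dom C (g \<cdot> f) = Dom C f"
  and cod_comp [simp]: "f \<in> Arr C \<Longrightarrow> g \<in> Arr C \<Longrightarrow> Cod C f = Dom C g \<Longrightarrow> Cod C (g \<cdot> f) = Cod C g"
  using comp_in[of f "Dom C f" "Cod C f" g "Cod C g"] by (auto simp: Hom_def)

lemma assoc [simp]:
  "f \<in> Arr C \<Longrightarrow> g \<in> Arr C \<Longrightarrow> h \<in> Arr C \<Longrightarrow> Cod C f = Dom C g \<Longrightarrow> Cod C g = Dom C h \<Longrightarrow>
    (h \<cdot> g) \<cdot> f = h \<cdot> (g \<cdot> f)"
  using comp_assoc[of f "Dom C f" "Cod C f" g "Cod C g" h "Cod C h"] by (auto simp: Hom_def)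

lemma arr_ident [simp]: "X \<in> Obj C \<Longrightarrow> Ident C X \<in> Arr C"
  and dom_ident [simp]: "X \<in> Obj C \<Longrightarrow> Dom C (Ident C X) = X"
  and cod_ident [simp]: "X \<in> Obj C \<Longrightarrow> Cod C (Ident C X) = X"
  using ident_in[of X] by (auto simp: Hom_def)

lemma ident_right [simp]: "f \<in> Arr C \<Longrightarrow> Dom C f = X \<Longrightarrow> f \<cdot> Ident C X = f"
  and ident_left [simp]: "f \<in> Arr C \<Longrightarrow> Cod C f = X \<Longrightarrow> Ident C X \<cdot> f = f"
  using comp_ident[of f X] ident_comp[of f _ X] by (auto simp: Hom_def)

declare dom_obj [simp] cod_obj [simp]

lemma HomE:
  assumes "f \<in> Hom C X Y"
  shows "f \<in> Arr C" "Dom C f = X" "Cod C f = Y" "X \<in> Obj C" "Y \<in> Obj C"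
  using assms dom_obj cod_obj by (auto simp: Hom_def)

lemma HomI: "f \<in> Arr C \<Longrightarrow> Dom C f = X \<Longrightarrow> Cod C f = Y \<Longrightarrow> f \<in> Hom C X Y"
  by (simp add: Hom_def)

lemma HomD_obj: "f \<in> Hom C X Y \<Longrightarrow> X \<in> Obj C \<and> Y \<in> Obj C"
  using HomE by blast

lemma zero_Hom: "X \<in> Obj C \<Longrightarrow> Y \<in> Obj C \<Longrightarrow> ZeroArr C X Y \<in> Hom C X Y"
  using monoid.one_closed[OF comm_monoid.axioms(1)[OF comm_group.axioms(1)[OF hom_comm_group[of X Y]]]]
  by (simp add: hom_group_def)

lemma arr_zero [simp]: "X \<in> Obj C \<Longrightarrow> Y \<in> Obj C \<Longrightarrow> ZeroArr C X Y \<in> Arr C"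
  and dom_zero [simp]: "X \<in> Obj C \<Longrightarrow> Y \<in> Obj C \<Longrightarrow> Dom C (ZeroArr C X Y) = X"
  and cod_zero [simp]: "X \<in> Obj C \<Longrightarrow> Y \<in> Obj C \<Longrightarrow> Cod C (ZeroArr C X Y) = Y"
  using zero_Hom[of X Y] by (auto simp: Hom_def)

lemma add_Hom:
  assumes "f \<in> Hom C X Y" "g \<in> Hom C X Y" shows "f \<boxplus> g \<in> Hom C X Y"
proof -
  interpret G: comm_group "hom_group C X Y"
    using hom_comm_group HomD_obj[OF assms(1)] by blast
  show ?thesis using G.m_closed[of f g] assms by (simp add: hom_group_def)
qed

lemma arr_add [simp]: "f \<in> Arr C \<Longrightarrow> g \<in> Arr C \<Longrightarrow> Dom C f = Dom C g \<Longrightarrow> Cod C f = Cod C g \<Longrightarrow> f \<boxplus> g \<in> Arr C"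
  and dom_add [simp]: "f \<in> Arr C \<Longrightarrow> g \<in> Arr C \<Longrightarrow> Dom C f = Dom C g \<Longrightarrow> Cod C f = Cod C g \<Longrightarrow> Dom C (f \<boxplus> g) = Dom C g"
  and cod_add [simp]: "f \<in> Arr C \<Longrightarrow> g \<in> Arr C \<Longrightarrow> Dom C f = Dom C g \<Longrightarrow> Cod C f = Cod C g \<Longrightarrow> Cod C (f \<boxplus> g) = Cod C g"
  using add_Hom[of f "Dom C f" "Cod C f" g] by (auto simp: Hom_def)

lemma add_comm:
  assumes "f \<in> Hom C X Y" "g \<in> Hom C X Y"
  shows "f \<boxplus> g = g \<boxplus> f"
proof -
  interpret G: comm_group "hom_group C X Y"
    using hom_comm_group HomD_obj[OF assms(1)] by blast
  show ?thesis using G.m_comm[of f g] assms by (simp add: hom_group_def)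
qed

lemma add_zero:
  assumes "f \<in> Hom C X Y"
  shows "f \<boxplus> ZeroArr C X Y = f" "ZeroArr C X Y \<boxplus> f = f"
proof -
  interpret G: comm_group "hom_group C X Y"
    using hom_comm_group HomD_obj[OF assms(1)] by blast
  show "f \<boxplus> ZeroArr C X Y = f" "ZeroArr C X Y \<boxplus> f = f"
    using G.r_one[of f] G.l_one[of f] assms by (simp_all add: hom_group_def)
qed

lemma add_zero_simps [simp]:
  "f \<in> Arr C \<Longrightarrow> Dom C f = X \<Longrightarrow> Cod C f = Y \<Longrightarrow> f \<boxplus> ZeroArr C X Y = f"
  "f \<in> Arr C \<Longrightarrow> Dom C f = X \<Longrightarrow> Cod C f = Y \<Longrightarrow> ZeroArr C X Y \<boxplus> f = f"
  using add_zero by (auto simp: Hom_def)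

lemma add_cancel:
  assumes "f \<in> Hom C X Y" "g \<in> Hom C X Y" "h \<in> Hom C X Y" "f \<boxplus> g = f \<boxplus> h"
  shows "g = h"
proof -
  interpret G: comm_group "hom_group C X Y"
    using hom_comm_group HomD_obj[OF assms(1)] by blast
  have "g \<boxplus> f = h \<boxplus> f"
    using assms G.m_comm[of f g] G.m_comm[of f h] by (simp add: hom_group_def)
  then show ?thesis using G.right_cancel[of f g h] assms by (simp add: hom_group_def)
qed

text \<open>Negatives come only from the group structure on Hom sets; asking for an existing
  difference keeps group inverses out of the terms.\<close>

lemma obtain_diff:
  assumes "f \<in> Hom C X Y" "g \<in> Hom C X Y"
  obtains d where "d \<in> Hom C X Y" "f = g \<boxplus> d"
proof -
  interpret G: comm_group "hom_group C X Y"
    using hom_comm_group HomD_obj[OF assms(1)] by blast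
  have c: "carrier (hom_group C X Y) = Hom C X Y" "mult (hom_group C X Y) = Add C"
    by (simp_all add: hom_group_def)
  let ?i = "inv\<^bsub>hom_group C X Y\<^esub> g"
  have i: "?i \<in> Hom C X Y" using G.inv_closed[of g] assms c by simp
  have "g \<boxplus> (?i \<boxplus> f) = f"
    using G.m_assoc[of g ?i f] G.r_inv[of g] G.l_one[of f] assms c i by simp
  with that[of "?i \<boxplus> f"] add_Hom[OF i assms(1)] show ?thesis by simp
qed

lemma distr_left [simp]:
  "f \<in> Arr C \<Longrightarrow> g \<in> Arr C \<Longrightarrow> h \<in> Arr C \<Longrightarrow> Dom C g = Cod C f \<Longrightarrow> Dom C h = Cod C f \<Longrightarrow> Cod C g = Cod C h \<Longrightarrow>
    (g \<boxplus> h) \<cdot> f = (g \<cdot> f) \<boxplus> (h \<cdot> f)"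
  using comp_add_left[of f "Dom C f" "Cod C f" g "Cod C g" h] by (auto simp: Hom_def)

lemma distr_right [simp]:
  "f \<in> Arr C \<Longrightarrow> g \<in> Arr C \<Longrightarrow> h \<in> Arr C \<Longrightarrow> Dom C f = Dom C g \<Longrightarrow> Cod C f = Dom C h \<Longrightarrow> Cod C g = Dom C h \<Longrightarrow>
    h \<cdot> (f \<boxplus> g) = (h \<cdot> f) \<boxplus> (h \<cdot> g)"
  using comp_add_right[of f "Dom C f" "Cod C f" g h "Cod C h"] by (auto simp: Hom_def)

lemma comp_zero [simp]:
  assumes "f \<in> Arr C" "Dom C f = Y" "X \<in> Obj C"
  shows "f \<cdot> ZeroArr C X Y = ZeroArr C X (Cod C f)"
proof -
  have Y: "Y \<in> Obj C" using assms by auto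
  let ?z = "ZeroArr C X Y"
  have "f \<cdot> ?z = f \<cdot> (?z \<boxplus> ?z)" using assms Y by simp
  also have "\<dots> = (f \<cdot> ?z) \<boxplus> (f \<cdot> ?z)" using assms Y by (subst distr_right) auto
  finally have "(f \<cdot> ?z) \<boxplus> (f \<cdot> ?z) = (f \<cdot> ?z) \<boxplus> ZeroArr C X (Cod C f)"
    using assms Y by simp
  then show ?thesis
    by (rule add_cancel[rotated 3]) (use assms Y in \<open>auto intro!: HomI\<close>)
qed

lemma zero_comp [simp]:
  assumes "f \<in> Arr C" "Cod C f = Y" "Z \<in> Obj C"
  shows "ZeroArr C Y Z \<cdot> f = ZeroArr C (Dom C f) Z"
proof -
  have Y: "Y \<in> Obj C" using assms by auto
  let ?z = "ZeroArr C Y Z"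
  have "?z \<cdot> f = (?z \<boxplus> ?z) \<cdot> f" using assms Y by simp
  also have "\<dots> = (?z \<cdot> f) \<boxplus> (?z \<cdot> f)" using assms Y by (subst distr_left) auto
  finally have "(?z \<cdot> f) \<boxplus> (?z \<cdot> f) = (?z \<cdot> f) \<boxplus> ZeroArr C (Dom C f) Z"
    using assms Y by simp
  then show ?thesis
    by (rule add_cancel[rotated 3]) (use assms Y in \<open>auto intro!: HomI\<close>)
qed

lemma zero_obj_Hom:
  assumes "is_zero_obj C Z" "X \<in> Obj C"
  shows "f \<in> Hom C X Z \<Longrightarrow> f = ZeroArr C X Z" "g \<in> Hom C Z X \<Longrightarrow> g = ZeroArr C Z X"
proof -
  have Z: "Z \<in> Obj C" using assms(1) by (simp add: is_zero_obj_def)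
  show "f \<in> Hom C X Z \<Longrightarrow> f = ZeroArr C X Z" "g \<in> Hom C Z X \<Longrightarrow> g = ZeroArr C Z X"
    using assms zero_Hom[OF assms(2) Z] zero_Hom[OF Z assms(2)] unfolding is_zero_obj_def by blast+
qed

lemma zero_objI:
  assumes "Z \<in> Obj C" "Ident C Z = ZeroArr C Z Z"
  shows "is_zero_obj C Z"
  unfolding is_zero_obj_def
proof (intro conjI ballI assms(1) ex1I)
  fix X assume X: "X \<in> Obj C"
  show "ZeroArr C X Z \<in> Hom C X Z" "ZeroArr C Z X \<in> Hom C Z X"
    using X assms(1) zero_Hom by blast+
  show "f = ZeroArr C X Z" if "f \<in> Hom C X Z" for f
    using HomE[OF that] ident_left[of f Z] assms by simp
  show "f = ZeroArr C Z X" if "f \<in> Hom C Z X" for f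
    using HomE[OF that] ident_right[of f Z] assms by simp
qed

end

text \<open>The axioms come in dual pairs, so most goals are an axiom of \<open>C\<close> read
  backwards. Closure under isomorphism is the exception: it is directed from the old pair to the new
  one, so its dual requires the inverses of the three isomorphisms.\<close>

lemma (in exact_category) exact_category_opc: "exact_category (opc C)"
proof (intro exact_category.intro additive_category.intro category.intro
    additive_category_axioms.intro exact_category_axioms.intro)
  fix f X Y Z W g h
  show "f \<in> Arr (opc C) \<Longrightarrow> Dom (opc C) f \<in> Obj (opc C)"
    and "f \<in> Arr (opc C) \<Longrightarrow> Cod (opc C) f \<in> Obj (opc C)" by simp_all
  show "X \<in> Obj (opc C) \<Longrightarrow> Ident (opc C) X \<in> Hom (opc C) X X" by (simp add: ident_in)
  show "f \<in> Hom (opc C) X Y \<Longrightarrow> g \<in> Hom (opc C) Y Z \<Longrightarrow> g \<cdot>\<^bsub>opc C\<^esub> f \<in> Hom (opc C) X Z"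
    by (simp add: comp_in)
  show "f \<in> Hom (opc C) X Y \<Longrightarrow> f \<cdot>\<^bsub>opc C\<^esub> Ident (opc C) X = f"
    "f \<in> Hom (opc C) X Y \<Longrightarrow> Ident (opc C) Y \<cdot>\<^bsub>opc C\<^esub> f = f"
    by (simp_all add: comp_ident ident_comp Hom_def)
  show "f \<in> Hom (opc C) W X \<Longrightarrow> g \<in> Hom (opc C) X Y \<Longrightarrow> h \<in> Hom (opc C) Y Z \<Longrightarrow>
      (h \<cdot>\<^bsub>opc C\<^esub> g) \<cdot>\<^bsub>opc C\<^esub> f = h \<cdot>\<^bsub>opc C\<^esub> (g \<cdot>\<^bsub>opc C\<^esub> f)"
    by (simp add: Hom_def)
  show "X \<in> Obj (opc C) \<Longrightarrow> Y \<in> Obj (opc C) \<Longrightarrow> comm_group (hom_group (opc C) X Y)"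
    by (simp add: hom_comm_group)
  show "f \<in> Hom (opc C) X Y \<Longrightarrow> g \<in> Hom (opc C) Y Z \<Longrightarrow> h \<in> Hom (opc C) Y Z \<Longrightarrow>
      (g \<boxplus>\<^bsub>opc C\<^esub> h) \<cdot>\<^bsub>opc C\<^esub> f = (g \<cdot>\<^bsub>opc C\<^esub> f) \<boxplus>\<^bsub>opc C\<^esub> (h \<cdot>\<^bsub>opc C\<^esub> f)"
    "f \<in> Hom (opc C) X Y \<Longrightarrow> g \<in> Hom (opc C) X Y \<Longrightarrow> h \<in> Hom (opc C) Y Z \<Longrightarrow>
      h \<cdot>\<^bsub>opc C\<^esub> (f \<boxplus>\<^bsub>opc C\<^esub> g) = (h \<cdot>\<^bsub>opc C\<^esub> f) \<boxplus>\<^bsub>opc C\<^esub> (h \<cdot>\<^bsub>opc C\<^esub> g)"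
    by (simp_all add: comp_add_left comp_add_right)
  show "\<exists>Z. is_zero_obj (opc C) Z" by (simp add: ex_zero_obj)
  show "X \<in> Obj (opc C) \<Longrightarrow> Y \<in> Obj (opc C) \<Longrightarrow> \<exists>S. is_direct_sum (opc C) S X Y"
    by (simp add: ex_direct_sum)
next
  fix i p
  show "(i, p) \<in> Confl (opc C) \<Longrightarrow> is_kernel (opc C) i p"
    by (simp add: confl_cokernel is_kernel_opc)
  show "(i, p) \<in> Confl (opc C) \<Longrightarrow> is_cokernel (opc C) p i"
    by (simp add: confl_kernel is_cokernel_opc)
next
  fix i p i' p' a b c
  assume A: "(i, p) \<in> Confl (opc C)" "i' \<in> Arr (opc C)" "p' \<in> Arr (opc C)" "Cod (opc C) i' = Dom (opc C) p'"
    "is_iso (opc C) a" "a \<in> Hom (opc C) (Dom (opc C) i) (Dom (opc C) i')"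
    "is_iso (opc C) b" "b \<in> Hom (opc C) (Cod (opc C) i) (Cod (opc C) i')"
    "is_iso (opc C) c" "c \<in> Hom (opc C) (Cod (opc C) p) (Cod (opc C) p')"
    "b \<cdot>\<^bsub>opc C\<^esub> i = i' \<cdot>\<^bsub>opc C\<^esub> a" "c \<cdot>\<^bsub>opc C\<^esub> p = p' \<cdot>\<^bsub>opc C\<^esub> b"
  have k: "is_kernel C p i" using A(1) by (simp add: confl_kernel)
  have [simp]: "i \<in> Arr C" "p \<in> Arr C" "Cod C p = Dom C i" using k by (auto simp: is_kernel_def)
  have [simp]: "i' \<in> Arr C" "p' \<in> Arr C" "Cod C p' = Dom C i'" using A by simp_all
  obtain a' where a': "is_iso C a'" "a' \<in> Hom C (Cod C a) (Dom C a)"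
    "a' \<cdot> a = Ident C (Dom C a)" "a \<cdot> a' = Ident C (Cod C a)"
    using A(5) is_iso_inverse by (metis is_iso_opc)
  obtain b' where b': "is_iso C b'" "b' \<in> Hom C (Cod C b) (Dom C b)"
    "b' \<cdot> b = Ident C (Dom C b)" "b \<cdot> b' = Ident C (Cod C b)"
    using A(7) is_iso_inverse by (metis is_iso_opc)
  obtain c' where c': "is_iso C c'" "c' \<in> Hom C (Cod C c) (Dom C c)"
    "c' \<cdot> c = Ident C (Dom C c)" "c \<cdot> c' = Ident C (Cod C c)"
    using A(9) is_iso_inverse by (metis is_iso_opc)
  have a: "a \<in> Arr C" "Dom C a = Cod C i'" "Cod C a = Cod C i"
    and b: "b \<in> Arr C" "Dom C b = Dom C i'" "Cod C b = Dom C i"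
    and c: "c \<in> Arr C" "Dom C c = Dom C p'" "Cod C c = Dom C p"
    using A(6,8,10) by (auto simp: Hom_def)
  have a2: "a' \<in> Arr C" "Dom C a' = Cod C i" "Cod C a' = Cod C i'"
    and b2: "b' \<in> Arr C" "Dom C b' = Dom C i" "Cod C b' = Dom C i'"
    and c2: "c' \<in> Arr C" "Dom C c' = Dom C p" "Cod C c' = Dom C p'"
    using a' b' c' a b c by (auto simp: Hom_def)
  have e1: "i \<cdot> b = a \<cdot> i'" and e2: "p \<cdot> c = b \<cdot> p'" using A by simp_all
  have "a' \<cdot> i = a' \<cdot> ((i \<cdot> b) \<cdot> b')" using a b a2 b2 b' by simp
  also have "\<dots> = (a' \<cdot> a) \<cdot> (i' \<cdot> b')" unfolding e1 using a b a2 b2 by simp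
  also have "\<dots> = i' \<cdot> b'" using a a2 b2 a' by (simp del: assoc)
  finally have f1: "a' \<cdot> i = i' \<cdot> b'" .
  have "b' \<cdot> p = b' \<cdot> ((p \<cdot> c) \<cdot> c')" using b c b2 c2 c' by simp
  also have "\<dots> = (b' \<cdot> b) \<cdot> (p' \<cdot> c')" unfolding e2 using c b c2 b2 by simp
  also have "\<dots> = p' \<cdot> c'" using b b2 c2 b' by (simp del: assoc)
  finally have f2: "b' \<cdot> p = p' \<cdot> c'" .
  have "(p', i') \<in> Confl C"
    by (rule confl_iso_closed[of p i p' i' c' b' a'])
      (use A(1) a' b' c' a2 b2 c2 f1 f2 in \<open>auto intro!: HomI\<close>)
  then show "(i', p') \<in> Confl (opc C)" by simp
next
  fix X i j p q f
  show "X \<in> Obj (opc C) \<Longrightarrow> inflation (opc C) (Ident (opc C) X)"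
    "X \<in> Obj (opc C) \<Longrightarrow> deflation (opc C) (Ident (opc C) X)"
    by (simp_all add: ident_inflation ident_deflation)
  show "inflation (opc C) i \<Longrightarrow> inflation (opc C) j \<Longrightarrow> Cod (opc C) i = Dom (opc C) j \<Longrightarrow>
      inflation (opc C) (j \<cdot>\<^bsub>opc C\<^esub> i)"
    by (simp add: deflation_comp)
  show "deflation (opc C) p \<Longrightarrow> deflation (opc C) q \<Longrightarrow> Cod (opc C) p = Dom (opc C) q \<Longrightarrow>
      deflation (opc C) (q \<cdot>\<^bsub>opc C\<^esub> p)"
    by (simp add: inflation_comp)
  show "inflation (opc C) i \<Longrightarrow> f \<in> Arr (opc C) \<Longrightarrow> Dom (opc C) f = Dom (opc C) i \<Longrightarrow>
      \<exists>f' i'. is_pushout (opc C) i f f' i' \<and> inflation (opc C) i'"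
    by (simp add: is_pushout_opc deflation_pullback)
  show "deflation (opc C) p \<Longrightarrow> f \<in> Arr (opc C) \<Longrightarrow> Cod (opc C) f = Cod (opc C) p \<Longrightarrow>
      \<exists>f' p'. is_pullback (opc C) p f f' p' \<and> deflation (opc C) p'"
    by (simp add: is_pullback_opc inflation_pushout)
qed

section \<open>Conflations\<close>

text \<open>Between conflations, an identity for \<open>a\<close> makes the right square a pullback,
  and an identity for \<open>z\<close> makes the left square a pushout. Pullbacks and pushouts of
  conflations are expressed in this form.\<close>

definition cmor :: "('o, 'm, 'x) preexact_cat_scheme \<Rightarrow> 'm \<times> 'm \<Rightarrow> 'm \<times> 'm \<Rightarrow> 'm \<Rightarrow> 'm \<Rightarrow> 'm \<Rightarrow> bool" where
  "cmor C c c' a h z \<longleftrightarrow>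
     a \<in> Hom C (Dom C (fst c)) (Dom C (fst c')) \<and> h \<in> Hom C (Cod C (fst c)) (Cod C (fst c')) \<and>
     z \<in> Hom C (Cod C (snd c)) (Cod C (snd c')) \<and>
     h \<cdot>\<^bsub>C\<^esub> fst c = fst c' \<cdot>\<^bsub>C\<^esub> a \<and> z \<cdot>\<^bsub>C\<^esub> snd c = snd c' \<cdot>\<^bsub>C\<^esub> h"

definition dsum :: "('o, 'm, 'x) preadd_cat_scheme \<Rightarrow> 'o \<Rightarrow> 'o \<Rightarrow> 'o \<Rightarrow> 'm \<Rightarrow> 'm \<Rightarrow> 'm \<Rightarrow> 'm \<Rightarrow> bool" where
  "dsum C S X Y i1 i2 p1 p2 \<longleftrightarrow>
     i1 \<in> Hom C X S \<and> i2 \<in> Hom C Y S \<and> p1 \<in> Hom C S X \<and> p2 \<in> Hom C S Y \<and>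
     p1 \<cdot>\<^bsub>C\<^esub> i1 = Ident C X \<and> p2 \<cdot>\<^bsub>C\<^esub> i2 = Ident C Y \<and>
     p2 \<cdot>\<^bsub>C\<^esub> i1 = ZeroArr C X Y \<and> p1 \<cdot>\<^bsub>C\<^esub> i2 = ZeroArr C Y X \<and>
     (i1 \<cdot>\<^bsub>C\<^esub> p1) \<boxplus>\<^bsub>C\<^esub> (i2 \<cdot>\<^bsub>C\<^esub> p2) = Ident C S"

lemma is_direct_sum_iff: "is_direct_sum C S X Y \<longleftrightarrow> (\<exists>i1 i2 p1 p2. dsum C S X Y i1 i2 p1 p2)"
  unfolding is_direct_sum_def dsum_def by blast

lemma dsum_opc: "dsum (opc C) S X Y i1 i2 p1 p2 \<longleftrightarrow> dsum C S X Y p1 p2 i1 i2"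
  unfolding dsum_def by auto

context additive_category
begin

text \<open>Simplification nests composites to the right, and then an equation between
  \<open>g \<cdot> f\<close> and \<open>g' \<cdot> f'\<close> no longer matches inside
  \<open>g \<cdot> (f \<cdot> x)\<close>. This lemma and \<open>comp_eq1\<close> provide the form
  that still applies.\<close>

lemma comp_eq:
  assumes "g \<cdot> f = g' \<cdot> f'" "f \<in> Arr C" "g \<in> Arr C" "f' \<in> Arr C" "g' \<in> Arr C"
    "Cod C f = Dom C g" "Cod C f' = Dom C g'"
  shows "x \<in> Arr C \<Longrightarrow> Cod C x = Dom C f \<Longrightarrow> g \<cdot> (f \<cdot> x) = g' \<cdot> (f' \<cdot> x)"
proof -
  have d: "Dom C f = Dom C f'" using assms dom_comp[of f g] dom_comp[of f' g'] by simp
  show "x \<in> Arr C \<Longrightarrow> Cod C x = Dom C f \<Longrightarrow> g \<cdot> (f \<cdot> x) = g' \<cdot> (f' \<cdot> x)"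
    using assms d assoc[of x f g] assoc[of x f' g'] by simp
qed

lemma comp_eq1:
  assumes "g \<cdot> f = k" "f \<in> Arr C" "g \<in> Arr C" "Cod C f = Dom C g"
  shows "x \<in> Arr C \<Longrightarrow> Cod C x = Dom C f \<Longrightarrow> g \<cdot> (f \<cdot> x) = k \<cdot> x"
  using assms assoc[of x f g] by simp

lemma dsum_commute: "dsum C S X Y i1 i2 p1 p2 \<Longrightarrow> dsum C S Y X i2 i1 p2 p1"
  unfolding dsum_def using add_comm[of "i1 \<cdot> p1" S S "i2 \<cdot> p2"] comp_in by metis

lemma dsumD:
  assumes "dsum C S X Y i1 i2 p1 p2"
  shows "i1 \<in> Arr C" "Dom C i1 = X" "Cod C i1 = S" "i2 \<in> Arr C" "Dom C i2 = Y" "Cod C i2 = S"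
    "p1 \<in> Arr C" "Dom C p1 = S" "Cod C p1 = X" "p2 \<in> Arr C" "Dom C p2 = S" "Cod C p2 = Y"
    "X \<in> Obj C" "Y \<in> Obj C" "S \<in> Obj C"
    "p1 \<cdot> i1 = Ident C X" "p2 \<cdot> i2 = Ident C Y"
    "p2 \<cdot> i1 = ZeroArr C X Y" "p1 \<cdot> i2 = ZeroArr C Y X"
    "(i1 \<cdot> p1) \<boxplus> (i2 \<cdot> p2) = Ident C S"
  using assms HomE unfolding dsum_def by blast+

end

context exact_category
begin

abbreviation sub :: "'m \<times> 'm \<Rightarrow> 'o" where "sub c \<equiv> Dom C (fst c)"
abbreviation mid :: "'m \<times> 'm \<Rightarrow> 'o" where "mid c \<equiv> Cod C (fst c)"
abbreviation quo :: "'m \<times> 'm \<Rightarrow> 'o" where "quo c \<equiv> Cod C (snd c)"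

section \<open>Factorisation through kernels and cokernels\<close>

lemma confl_simps [simp]:
  assumes "c \<in> Confl C"
  shows "fst c \<in> Arr C" "snd c \<in> Arr C" "Dom C (snd c) = mid c"
    "snd c \<cdot> fst c = ZeroArr C (sub c) (quo c)"
  using confl_kernel[of "fst c" "snd c"] assms by (auto simp: is_kernel_def)

lemma confl_zero [simp]:
  assumes "c \<in> Confl C" "x \<in> Arr C" "Cod C x = sub c"
  shows "snd c \<cdot> (fst c \<cdot> x) = ZeroArr C (Dom C x) (quo c)"
  using comp_eq1[OF confl_simps(4)[OF assms(1)], of x] assms by simp

lemma kernelD:
  assumes "is_kernel C i p"
  shows "i \<in> Arr C" "p \<in> Arr C" "Cod C i = Dom C p" "p \<cdot> i = ZeroArr C (Dom C i) (Cod C p)"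
    "t \<in> Arr C \<Longrightarrow> Cod C t = Dom C p \<Longrightarrow> p \<cdot> t = ZeroArr C (Dom C t) (Cod C p) \<Longrightarrow>
      \<exists>s. s \<in> Arr C \<and> Dom C s = Dom C t \<and> Cod C s = Dom C i \<and> i \<cdot> s = t"
    "s \<in> Arr C \<Longrightarrow> s' \<in> Arr C \<Longrightarrow> Dom C s = Dom C s' \<Longrightarrow> Cod C s = Dom C i \<Longrightarrow> Cod C s' = Dom C i \<Longrightarrow>
      i \<cdot> s = i \<cdot> s' \<Longrightarrow> s = s'"
proof -
  show k: "i \<in> Arr C" "p \<in> Arr C" "Cod C i = Dom C p" "p \<cdot> i = ZeroArr C (Dom C i) (Cod C p)"
    using assms by (auto simp: is_kernel_def)
  have u: "\<exists>!s. s \<in> Hom C (Dom C t) (Dom C i) \<and> i \<cdot> s = t"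
    if "t \<in> Arr C" "Cod C t = Dom C p" "p \<cdot> t = ZeroArr C (Dom C t) (Cod C p)" for t
  proof -
    have "t \<in> Hom C (Dom C t) (Dom C p)" using that by (simp add: Hom_def)
    then show ?thesis using assms that(3) unfolding is_kernel_def by blast
  qed
  show "t \<in> Arr C \<Longrightarrow> Cod C t = Dom C p \<Longrightarrow> p \<cdot> t = ZeroArr C (Dom C t) (Cod C p) \<Longrightarrow>
      \<exists>s. s \<in> Arr C \<and> Dom C s = Dom C t \<and> Cod C s = Dom C i \<and> i \<cdot> s = t"
    using u[of t] by (auto simp: Hom_def)
  show "s = s'" if h: "s \<in> Arr C" "s' \<in> Arr C" "Dom C s = Dom C s'" "Cod C s = Dom C i" "Cod C s' = Dom C i"
      "i \<cdot> s = i \<cdot> s'"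
  proof -
    have "p \<cdot> (i \<cdot> s) = ZeroArr C (Dom C s) (Cod C p)"
      using comp_eq1[OF k(4) k(1) k(2) k(3), of s] h k by simp
    then have "\<exists>!r. r \<in> Hom C (Dom C (i \<cdot> s)) (Dom C i) \<and> i \<cdot> r = i \<cdot> s"
      using u[of "i \<cdot> s"] h k by simp
    moreover have "s \<in> Hom C (Dom C (i \<cdot> s)) (Dom C i)" "s' \<in> Hom C (Dom C (i \<cdot> s)) (Dom C i)"
      using h k by (auto simp: Hom_def)
    ultimately show ?thesis using h(6) by metis
  qed
qed

lemma confl_factor:
  assumes "c \<in> Confl C" "t \<in> Arr C" "Cod C t = mid c"
    "snd c \<cdot> t = ZeroArr C (Dom C t) (quo c)"
  obtains s where "s \<in> Arr C" "Dom C s = Dom C t" "Cod C s = sub c" "fst c \<cdot> s = t"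
  using kernelD(5)[OF confl_kernel[of "fst c" "snd c"], of t] assms by auto

lemma confl_mono:
  assumes "c \<in> Confl C" "s \<in> Arr C" "s' \<in> Arr C" "Dom C s = Dom C s'"
    "Cod C s = sub c" "Cod C s' = sub c" "fst c \<cdot> s = fst c \<cdot> s'"
  shows "s = s'"
  using kernelD(6)[OF confl_kernel[of "fst c" "snd c"], of s s'] assms by auto

lemma swap_in_opc [simp]: "prod.swap c \<in> Confl (opc C) \<longleftrightarrow> c \<in> Confl C"
  by (cases c) simp

lemma confl_cofactor:
  assumes "c \<in> Confl C" "t \<in> Arr C" "Dom C t = mid c"
    "t \<cdot> fst c = ZeroArr C (sub c) (Cod C t)"
  obtains s where "s \<in> Arr C" "Dom C s = quo c" "Cod C s = Cod C t" "s \<cdot> snd c = t"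
proof -
  interpret D: exact_category "opc C" by (rule exact_category_opc)
  show ?thesis using D.confl_factor[of "prod.swap c" t] assms that by auto
qed

lemma confl_epi:
  assumes "c \<in> Confl C" "s \<in> Arr C" "s' \<in> Arr C" "Cod C s = Cod C s'"
    "Dom C s = quo c" "Dom C s' = quo c" "s \<cdot> snd c = s' \<cdot> snd c"
  shows "s = s'"
proof -
  interpret D: exact_category "opc C" by (rule exact_category_opc)
  show ?thesis using D.confl_mono[of "prod.swap c" s s'] assms by auto
qed

text \<open>Two kernels of \<open>p\<close> are isomorphic over its domain. The axioms only give
  some kernel for a deflation; this allows a concretely constructed one to take its place.\<close>

lemma kernel_confl:
  assumes "(i, p) \<in> Confl C" "is_kernel C i' p"
  shows "(i', p) \<in> Confl C"
proof -
  note k = kernelD[OF confl_kernel[OF assms(1)]]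
  note k' = kernelD[OF assms(2)]
  obtain s where s: "s \<in> Arr C" "Dom C s = Dom C i'" "Cod C s = Dom C i" "i \<cdot> s = i'"
    using k(5)[of i'] k'(1-4) by auto
  obtain s' where s': "s' \<in> Arr C" "Dom C s' = Dom C i" "Cod C s' = Dom C i'" "i' \<cdot> s' = i"
    using k'(5)[of i] k(1-4) by auto
  have "s \<cdot> s' = Ident C (Dom C i)"
    by (rule k(6)) (use s s' k(1-3) k'(1-3) comp_eq1[OF s(4)] in auto)
  moreover have "s' \<cdot> s = Ident C (Dom C i')"
    by (rule k'(6)) (use s s' k(1-3) k'(1-3) comp_eq1[OF s'(4)] in auto)
  ultimately have "is_iso C s'"
    unfolding is_iso_def using s s' by (intro conjI bexI[of _ s] HomI) auto
  moreover have "is_iso C (Ident C X)" if "X \<in> Obj C" for X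
    unfolding is_iso_def using that by (intro conjI bexI[of _ "Ident C X"] HomI) auto
  ultimately show ?thesis
    by (intro confl_iso_closed[of i p i' p s' "Ident C (Dom C p)" "Ident C (Cod C p)"])
      (use assms(1) s s' k(1-3) k'(1-3) in \<open>auto intro!: HomI\<close>)
qed

lemma cokernel_confl:
  assumes "(i, p) \<in> Confl C" "is_cokernel C p' i"
  shows "(i, p') \<in> Confl C"
proof -
  interpret D: exact_category "opc C" by (rule exact_category_opc)
  show ?thesis using D.kernel_confl[of p i p'] assms by (simp add: is_kernel_opc)
qed

section \<open>Morphisms of conflations, pullbacks and pushouts\<close>

lemma cmor_opc:
  assumes "c \<in> Confl C" "c' \<in> Confl C"
  shows "cmor (opc C) (prod.swap c') (prod.swap c) z h a \<longleftrightarrow> cmor C c c' a h z"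
  unfolding cmor_def using assms by auto

lemma cmorD:
  assumes "cmor C c c' a h z" "c \<in> Confl C" "c' \<in> Confl C"
  shows "a \<in> Arr C" "Dom C a = sub c" "Cod C a = sub c'"
    "h \<in> Arr C" "Dom C h = mid c" "Cod C h = mid c'"
    "z \<in> Arr C" "Dom C z = quo c" "Cod C z = quo c'"
    "h \<cdot> fst c = fst c' \<cdot> a" "z \<cdot> snd c = snd c' \<cdot> h"
    "\<And>x. x \<in> Arr C \<Longrightarrow> Cod C x = sub c \<Longrightarrow> h \<cdot> (fst c \<cdot> x) = fst c' \<cdot> (a \<cdot> x)"
    "\<And>x. x \<in> Arr C \<Longrightarrow> Cod C x = mid c \<Longrightarrow> z \<cdot> (snd c \<cdot> x) = snd c' \<cdot> (h \<cdot> x)"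
proof -
  show A: "a \<in> Arr C" "Dom C a = sub c" "Cod C a = sub c'"
    "h \<in> Arr C" "Dom C h = mid c" "Cod C h = mid c'"
    "z \<in> Arr C" "Dom C z = quo c" "Cod C z = quo c'"
    "h \<cdot> fst c = fst c' \<cdot> a" "z \<cdot> snd c = snd c' \<cdot> h"
    using assms unfolding cmor_def Hom_def by auto
  show "\<And>x. x \<in> Arr C \<Longrightarrow> Cod C x = sub c \<Longrightarrow> h \<cdot> (fst c \<cdot> x) = fst c' \<cdot> (a \<cdot> x)"
    using comp_eq[OF A(10)] A assms by simp
  show "\<And>x. x \<in> Arr C \<Longrightarrow> Cod C x = mid c \<Longrightarrow> z \<cdot> (snd c \<cdot> x) = snd c' \<cdot> (h \<cdot> x)"
    using comp_eq[OF A(11)] A assms by simp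
qed

lemma cmor_id: "c \<in> Confl C \<Longrightarrow>
    cmor C c c (Ident C (sub c)) (Ident C (mid c)) (Ident C (quo c))"
  unfolding cmor_def by (auto intro!: HomI)

lemma cmor_comp:
  assumes "cmor C c c' a h z" "cmor C c' c'' a' h' z'" "c \<in> Confl C" "c' \<in> Confl C" "c'' \<in> Confl C"
  shows "cmor C c c'' (a' \<cdot> a) (h' \<cdot> h) (z' \<cdot> z)"
  using cmorD[OF assms(1,3,4)] cmorD[OF assms(2,4,5)] assms(3-5)
  unfolding cmor_def by (auto intro!: HomI)

lemma cmor_extend_right:
  assumes "c \<in> Confl C" "c' \<in> Confl C" "a \<in> Hom C (sub c) (sub c')"
    "h \<in> Hom C (mid c) (mid c')" "h \<cdot> fst c = fst c' \<cdot> a"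
  obtains z where "cmor C c c' a h z"
proof -
  note [simp] = HomE[OF assms(3)] HomE[OF assms(4)] assms(1,2)
  have "(snd c' \<cdot> h) \<cdot> fst c = ZeroArr C (sub c) (Cod C (snd c' \<cdot> h))"
    using assms(5) by simp
  then obtain z where "z \<in> Arr C" "Dom C z = quo c" "Cod C z = quo c'" "z \<cdot> snd c = snd c' \<cdot> h"
    using confl_cofactor[of c "snd c' \<cdot> h"] by auto
  then have "cmor C c c' a h z" using assms unfolding cmor_def by (auto intro!: HomI)
  then show ?thesis by (rule that)
qed

text \<open>The difference of \<open>w\<close> and \<open>w'\<close> dies under
  \<open>snd c'\<close>, so it comes from \<open>sub c'\<close>. There \<open>f\<close> restricts to
  the monomorphism \<open>fst c\<close>, so the difference vanishes.\<close>

lemma pullback_joint: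
  assumes c: "c \<in> Confl C" "c' \<in> Confl C"
    and m: "cmor C c' c (Ident C (sub c)) f z"
    and w: "w \<in> Hom C R (mid c')" "w' \<in> Hom C R (mid c')"
    and e: "f \<cdot> w = f \<cdot> w'" "snd c' \<cdot> w = snd c' \<cdot> w'"
  shows "w = w'"
proof -
  note M = cmorD[OF m c(2,1)]
  note [simp] = c HomE[OF w(1)] HomE[OF w(2)]
  have L: "sub c' = sub c" using M(2) by simp
  note [simp] = M(4-9) L
  have fi: "f \<cdot> fst c' = fst c" using M by simp
  obtain d where d: "d \<in> Hom C R (mid c')" "w = w' \<boxplus> d"
    using obtain_diff w by blast
  note [simp] = HomE[OF d(1)]
  have "(snd c' \<cdot> w') \<boxplus> (snd c' \<cdot> d) = (snd c' \<cdot> w') \<boxplus> ZeroArr C R (quo c')"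
    using e(2) unfolding d(2) by simp
  then have "snd c' \<cdot> d = ZeroArr C R (quo c')"
    by (rule add_cancel[rotated 3]) (auto intro!: HomI)
  then obtain s where s: "s \<in> Arr C" "Dom C s = R" "Cod C s = sub c'" "fst c' \<cdot> s = d"
    using confl_factor[of c' d] by auto
  have "(f \<cdot> w') \<boxplus> (f \<cdot> d) = (f \<cdot> w') \<boxplus> ZeroArr C R (mid c)"
    using e(1) unfolding d(2) by simp
  then have "f \<cdot> d = ZeroArr C R (mid c)"
    by (rule add_cancel[rotated 3]) (auto intro!: HomI)
  then have "fst c \<cdot> s = fst c \<cdot> ZeroArr C R (sub c)"
    using comp_eq1[OF fi, of s] s by simp
  then have "s = ZeroArr C R (sub c)"
    by (rule confl_mono[OF c(1), rotated 5]) (use s in auto)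
  then show ?thesis using d s by auto
qed

text \<open>The difference of two liftings over a common deflation is corrected on a deflation
  covering \<open>T\<close>, which avoids invoking the five lemma.\<close>

lemma pullback_univ:
  assumes c: "c \<in> Confl C" "c' \<in> Confl C"
    and m: "cmor C c' c (Ident C (sub c)) f z"
    and u: "u \<in> Hom C T (mid c)" and v: "v \<in> Hom C T (quo c')"
    and e: "snd c \<cdot> u = z \<cdot> v"
  obtains w where "w \<in> Hom C T (mid c')" "f \<cdot> w = u" "snd c' \<cdot> w = v"
proof -
  note M = cmorD[OF m c(2,1)]
  note [simp] = c HomE[OF u] HomE[OF v]
  have L: "sub c' = sub c" using M(2) by simp
  note [simp] = M(4-9) L
  have fi: "f \<cdot> fst c' = fst c" using M by simp
  have zpx: "z \<cdot> (snd c' \<cdot> x) = snd c \<cdot> (f \<cdot> x)" if "x \<in> Arr C" "Cod C x = mid c'" for x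
    using M(13) that by simp
  have "deflation C (snd c')" using c(2) unfolding deflation_def by (metis prod.collapse)
  from deflation_pullback[OF this, of v] obtain r \<pi> where P: "is_pullback C (snd c') v r \<pi>" "deflation C \<pi>"
    by auto
  then obtain k where k: "(k, \<pi>) \<in> Confl C" unfolding deflation_def by auto
  have [simp]: "r \<in> Arr C" "\<pi> \<in> Arr C" "Cod C r = mid c'" "Cod C \<pi> = T" "Dom C r = Dom C \<pi>"
    using P unfolding is_pullback_def by auto
  have pr: "snd c' \<cdot> r = v \<cdot> \<pi>" using P unfolding is_pullback_def by auto
  note K = confl_simps[OF k, simplified]
  note [simp] = K
  let ?D = "Dom C \<pi>"
  obtain d where d: "d \<in> Hom C ?D (mid c)" "f \<cdot> r = (u \<cdot> \<pi>) \<boxplus> d"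
    by (rule obtain_diff[of "f \<cdot> r" ?D "mid c" "u \<cdot> \<pi>"]) (auto intro!: HomI)
  note [simp] = HomE[OF d(1)]
  have "snd c \<cdot> (f \<cdot> r) = snd c \<cdot> (u \<cdot> \<pi>)"
    using zpx[of r] pr comp_eq[OF e, of \<pi>] by simp
  then have "(snd c \<cdot> (u \<cdot> \<pi>)) \<boxplus> (snd c \<cdot> d) = (snd c \<cdot> (u \<cdot> \<pi>)) \<boxplus> ZeroArr C ?D (quo c)"
    unfolding d(2) by simp
  then have "snd c \<cdot> d = ZeroArr C ?D (quo c)"
    by (rule add_cancel[rotated 3]) (auto intro!: HomI)
  then obtain s where s: "s \<in> Arr C" "Dom C s = ?D" "Cod C s = sub c" "fst c \<cdot> s = d"
    using confl_factor[of c d] by auto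
  note [simp] = s(1-3)
  obtain g where g: "g \<in> Hom C ?D (mid c')" "r = (fst c' \<cdot> s) \<boxplus> g"
    by (rule obtain_diff[of r ?D "mid c'" "fst c' \<cdot> s"]) (auto intro!: HomI)
  note [simp] = HomE[OF g(1)]
  have "d \<boxplus> (f \<cdot> g) = f \<cdot> r"
    unfolding g(2) using comp_eq1[OF fi, of s] s(4) by simp
  also have "\<dots> = d \<boxplus> (u \<cdot> \<pi>)" unfolding d(2) by (rule add_comm) (auto intro!: HomI)
  finally have fg: "f \<cdot> g = u \<cdot> \<pi>" by (rule add_cancel[rotated 3]) (auto intro!: HomI)
  have pg: "snd c' \<cdot> g = v \<cdot> \<pi>" using pr unfolding g(2) by simp
  \<comment> \<open>\<open>k\<close> is the kernel of the cover, so this is what lets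
    \<open>g\<close> descend to \<open>T\<close>. Under \<open>f\<close> and \<open>snd c'\<close>
    the composite becomes \<open>u\<close> and \<open>v\<close> applied to
    \<open>\<pi> \<cdot> k\<close>, which is zero.\<close>
  have "g \<cdot> k = ZeroArr C (Dom C k) (mid c')"
    by (rule pullback_joint[OF c m, where R = "Dom C k"])
      (use comp_eq[OF fg, of k] comp_eq[OF pg, of k] in \<open>auto intro!: HomI\<close>)
  then obtain w where w: "w \<in> Arr C" "Dom C w = T" "Cod C w = mid c'" "w \<cdot> \<pi> = g"
    using confl_cofactor[OF k, of g] by auto
  note [simp] = w(1-3)
  have 1: "f \<cdot> w = u" by (rule confl_epi[OF k]) (use fg w in auto)
  have 2: "snd c' \<cdot> w = v" by (rule confl_epi[OF k]) (use pg w in auto)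
  show ?thesis
    by (rule that[of w]) (use 1 2 in \<open>auto intro!: HomI\<close>)
qed

lemma pushout_joint:
  assumes c: "c \<in> Confl C" "c' \<in> Confl C"
    and m: "cmor C c c' a h (Ident C (quo c))"
    and w: "w \<in> Hom C (mid c') R" "w' \<in> Hom C (mid c') R"
    and e: "w \<cdot> h = w' \<cdot> h" "w \<cdot> fst c' = w' \<cdot> fst c'"
  shows "w = w'"
proof -
  interpret D: exact_category "opc C" by (rule exact_category_opc)
  have m': "cmor (opc C) (prod.swap c') (prod.swap c) (Ident C (quo c)) h a"
    using m c by (simp add: cmor_opc)
  show ?thesis
    using D.pullback_joint[of "prod.swap c" "prod.swap c'" h a w R w'] c m' w e by simp
qed

lemma pushout_univ:
  assumes c: "c \<in> Confl C" "c' \<in> Confl C"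
    and m: "cmor C c c' a h (Ident C (quo c))"
    and u: "u \<in> Hom C (mid c) T" and v: "v \<in> Hom C (sub c') T"
    and e: "u \<cdot> fst c = v \<cdot> a"
  obtains w where "w \<in> Hom C (mid c') T" "w \<cdot> h = u" "w \<cdot> fst c' = v"
proof -
  interpret D: exact_category "opc C" by (rule exact_category_opc)
  have m': "cmor (opc C) (prod.swap c') (prod.swap c) (Ident C (quo c)) h a"
    using m c by (simp add: cmor_opc)
  show ?thesis
    using D.pullback_univ[of "prod.swap c" "prod.swap c'" h a u T v thesis] c u v e m' that by simp
qed

text \<open>The pushout axiom gives an inflation with an arbitrary cokernel \<open>q\<close>. It is
  exchanged for the arrow \<open>p\<close> induced by \<open>snd c\<close> and zero, because
  \<open>p\<close> ends in \<open>quo c\<close> itself and the right-hand component can then be an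
  identity.\<close>

lemma push_confl:
  assumes c: "c \<in> Confl C" and a: "a \<in> Hom C (sub c) Y"
  obtains c' h where "c' \<in> Confl C" "sub c' = Y" "quo c' = quo c"
    "cmor C c c' a h (Ident C (quo c))"
proof -
  note [simp] = c HomE[OF a]
  have "inflation C (fst c)" using c unfolding inflation_def by (metis prod.collapse)
  from inflation_pushout[OF this, of a] obtain h i' where
    P: "is_pushout C (fst c) a h i'" "inflation C i'" by auto
  then obtain q where q: "(i', q) \<in> Confl C" unfolding inflation_def by auto
  have [simp]: "h \<in> Arr C" "i' \<in> Arr C" "Dom C h = mid c" "Dom C i' = Y" "Cod C h = Cod C i'"
    and hi: "h \<cdot> fst c = i' \<cdot> a"
    using P unfolding is_pushout_def by auto
  have uni: "\<exists>!w. w \<in> Hom C (Cod C i') T \<and> w \<cdot> h = u \<and> w \<cdot> i' = v"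
    if "u \<in> Hom C (mid c) T" "v \<in> Hom C Y T" "u \<cdot> fst c = v \<cdot> a" for u v T
    using P that unfolding is_pushout_def by simp
  let ?Z = "quo c"
  have "\<exists>!w. w \<in> Hom C (Cod C i') ?Z \<and> w \<cdot> h = snd c \<and> w \<cdot> i' = ZeroArr C Y ?Z"
    by (rule uni) (auto intro!: HomI)
  then obtain p where p: "p \<in> Hom C (Cod C i') ?Z" "p \<cdot> h = snd c" "p \<cdot> i' = ZeroArr C Y ?Z" by blast
  note [simp] = HomE[OF p(1)]
  have "is_cokernel C p i'"
    unfolding is_cokernel_def
  proof (intro conjI allI ballI impI)
    fix T t assume t: "t \<in> Hom C (Cod C i') T" "t \<cdot> i' = ZeroArr C (Dom C i') T"
    note [simp] = HomE[OF t(1)]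
    have "(t \<cdot> h) \<cdot> fst c = ZeroArr C (sub c) (Cod C (t \<cdot> h))"
      using comp_eq1[OF t(2), of a] hi by simp
    then obtain s where s: "s \<in> Arr C" "Dom C s = ?Z" "Cod C s = T" "s \<cdot> snd c = t \<cdot> h"
      using confl_cofactor[OF c, of "t \<cdot> h"] by auto
    note [simp] = s(1-3)
    have "\<exists>!w. w \<in> Hom C (Cod C i') T \<and> w \<cdot> h = t \<cdot> h \<and> w \<cdot> i' = ZeroArr C Y T"
      by (rule uni) (use comp_eq1[OF t(2), of a] hi in \<open>auto intro!: HomI\<close>)
    then have "s \<cdot> p = t"
      using p s t comp_eq1[OF p(3)] by (metis HomI assoc cod_comp comp_zero dom_comp arr_comp \<open>Cod C h = Cod C i'\<close> \<open>Cod C p = quo c\<close> \<open>Dom C i' = Y\<close> \<open>Dom C p = Cod C i'\<close> \<open>Y \<in> Obj C\<close> \<open>h \<in> Arr C\<close> \<open>i' \<in> Arr C\<close> \<open>p \<in> Arr C\<close>)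
    moreover have "s' = s" if "s' \<in> Hom C ?Z T" "s' \<cdot> p = t" for s'
    proof -
      note [simp] = HomE[OF that(1)]
      show ?thesis
        by (rule confl_epi[OF c]) (use s p comp_eq1[OF that(2), of h] in auto)
    qed
    ultimately show "\<exists>!s. s \<in> Hom C (Cod C p) T \<and> s \<cdot> p = t"
      by (intro ex1I[of _ s]) (auto intro!: HomI)
  qed (use p in auto)
  then have "(i', p) \<in> Confl C" by (rule cokernel_confl[OF q])
  moreover have "cmor C c (i', p) a h (Ident C ?Z)"
    unfolding cmor_def using hi p by (auto intro!: HomI)
  ultimately show ?thesis by (intro that[of "(i', p)" h]) auto
qed

lemma pull_confl:
  assumes c: "c \<in> Confl C" and z: "z \<in> Hom C Z (quo c)"
  obtains c' h where "c' \<in> Confl C" "quo c' = Z" "sub c' = sub c"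
    "cmor C c' c (Ident C (sub c)) h z"
proof -
  interpret D: exact_category "opc C" by (rule exact_category_opc)
  obtain c' h where c': "c' \<in> Confl (opc C)" "mid c' = Z" "Dom C (snd c') = sub c"
    "cmor (opc C) (prod.swap c) c' z h (Ident C (sub c))"
    using D.push_confl[of "prod.swap c" z Z] c z by auto
  have "prod.swap c' \<in> Confl C" using c'(1) by (cases c') simp
  moreover have "cmor C (prod.swap c') c (Ident C (sub c)) h z"
    using cmor_opc[OF calculation c, of z h] c'(4) by simp
  ultimately show ?thesis using that[of "prod.swap c'" h] c' by simp
qed

text \<open>In the language of fibrations, \<open>c'\<close> is a cartesian lift of
  \<open>z\<close>. The universal property supplies the middle map, and its left square is checked
  against the jointly monic pair \<open>f\<close>, \<open>snd c'\<close>.\<close>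

lemma cart:
  assumes c: "c \<in> Confl C" "c' \<in> Confl C" "c'' \<in> Confl C"
    and m: "cmor C c' c (Ident C (sub c)) f z"
    and n: "cmor C c'' c a g (z \<cdot> y)" and y: "y \<in> Hom C (quo c'') (quo c')"
  obtains g' where "cmor C c'' c' a g' y" "f \<cdot> g' = g"
proof -
  note M = cmorD[OF m c(2,1)]
  note N = cmorD[OF n c(3,1)]
  have L: "sub c' = sub c" using M(2) c by simp
  note [simp] = c M(4-9) N(1-6) HomE[OF y] L
  have e: "snd c \<cdot> g = z \<cdot> (y \<cdot> snd c'')" using N(11) by simp
  obtain g' where g': "g' \<in> Hom C (mid c'') (mid c')" "f \<cdot> g' = g" "snd c' \<cdot> g' = y \<cdot> snd c''"
    using pullback_univ[OF c(1,2) m, of g "mid c''" "y \<cdot> snd c''"] e by (auto simp: Hom_def)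
  note [simp] = HomE[OF g'(1)]
  have fi: "f \<cdot> fst c' = fst c" using M by simp
  have "g' \<cdot> fst c'' = fst c' \<cdot> a"
    by (rule pullback_joint[OF c(1,2) m, where R = "sub c''"])
      (use comp_eq1[OF g'(2), of "fst c''"] comp_eq[OF g'(3), of "fst c''"] N(10) comp_eq1[OF fi, of a]
        in \<open>auto intro!: HomI\<close>)
  then have "cmor C c'' c' a g' y"
    unfolding cmor_def using g' y by (auto intro!: HomI)
  with g' that show ?thesis by blast
qed

lemma cocart:
  assumes c: "c \<in> Confl C" "c' \<in> Confl C" "c'' \<in> Confl C"
    and m: "cmor C c c' a h (Ident C (quo c))"
    and n: "cmor C c c'' (b \<cdot> a) g z" and b: "b \<in> Hom C (sub c') (sub c'')"
  obtains g' where "cmor C c' c'' b g' z" "g' \<cdot> h = g"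
proof -
  interpret D: exact_category "opc C" by (rule exact_category_opc)
  show ?thesis
    using D.cart[of "prod.swap c" "prod.swap c'" "prod.swap c''" h a z g b thesis] c m n b that
    by (simp add: cmor_opc)
qed

text \<open>The five lemma for equal ends, obtained from cartesian lifting: lifting the identity of
  \<open>c'\<close> through \<open>h\<close> gives a right inverse, and joint monicity makes it a
  left inverse too.\<close>

lemma cmor_id_invert:
  assumes c: "c \<in> Confl C" "c' \<in> Confl C"
    and m: "cmor C c c' (Ident C (sub c)) h (Ident C (quo c))"
  obtains h' where "cmor C c' c (Ident C (sub c)) h' (Ident C (quo c))"
    "h' \<cdot> h = Ident C (mid c)" "h \<cdot> h' = Ident C (mid c')"
proof -
  note M = cmorD[OF m c]
  have L: "sub c' = sub c" "quo c' = quo c" using M(3,9) c by simp_all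
  note [simp] = c M(4-6) L
  obtain h' where h': "cmor C c' c (Ident C (sub c)) h' (Ident C (quo c))"
    "h \<cdot> h' = Ident C (mid c')"
  proof (rule cart[OF c(2,1,2)])
    show "cmor C c c' (Ident C (sub c')) h (Ident C (quo c))" using m by simp
    show "cmor C c' c' (Ident C (sub c)) (Ident C (mid c')) (Ident C (quo c) \<cdot> Ident C (quo c))"
      using cmor_id[of c'] by simp
    show "Ident C (quo c) \<in> Hom C (quo c') (quo c)" by (auto intro!: HomI)
  qed (rule that)
  note M' = cmorD[OF h'(1) c(2,1)]
  note [simp] = M'(4-6)
  have hhh: "h \<cdot> (h' \<cdot> h) = h" using comp_eq1[OF h'(2), of h] by simp
  have ph: "snd c' \<cdot> h = snd c" using M(11)[symmetric] by simp
  have ph': "snd c \<cdot> h' = snd c'" using M'(11)[symmetric] by simp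
  have phh: "snd c \<cdot> (h' \<cdot> h) = snd c" using comp_eq1[OF ph', of h] ph by simp
  have "h' \<cdot> h = Ident C (mid c)"
    by (rule pullback_joint[of c' c h "Ident C (quo c)", where R = "mid c"])
      (use m hhh phh in \<open>auto intro!: HomI\<close>)
  then show ?thesis using that h' by blast
qed

section \<open>Squares of inflations and deflations; Noether isomorphism\<close>

lemma pullback_inflation:
  assumes c: "c \<in> Confl C" "c' \<in> Confl C"
    and m: "cmor C c' c (Ident C (sub c)) f z" and z: "(z, e) \<in> Confl C"
  shows "(f, e \<cdot> snd c) \<in> Confl C"
proof -
  note M = cmorD[OF m c(2,1)]
  note Z = confl_simps[OF z, simplified]
  have L: "sub c' = sub c" using M(2) c by simp
  note [simp] = c M(4-9) L Z
  have "deflation C (e \<cdot> snd c)"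
    using deflation_comp[of "snd c" e] c(1) z unfolding deflation_def by (metis prod.collapse Z(3) M(9))
  then obtain k where k: "(k, e \<cdot> snd c) \<in> Confl C" unfolding deflation_def by blast
  have ezx: "e \<cdot> (snd c \<cdot> f) = ZeroArr C (mid c') (Cod C e)"
    using M(11) comp_eq1[OF Z(4), of "snd c'"] by simp
  \<comment> \<open>In abelian terms \<open>f\<close> is the preimage of the subobject
    \<open>z\<close>. A test arrow killed by \<open>e \<cdot> snd c\<close> factors through
    \<open>z\<close> after \<open>snd c\<close>, and the pullback assembles the two pieces.\<close>
  have "is_kernel C f (e \<cdot> snd c)"
    unfolding is_kernel_def
  proof (intro conjI allI ballI impI)
    fix T t assume t: "t \<in> Hom C T (Dom C (e \<cdot> snd c))"
      "(e \<cdot> snd c) \<cdot> t = ZeroArr C T (Cod C (e \<cdot> snd c))"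
    have t': "t \<in> Hom C T (mid c)" using t(1) by simp
    note [simp] = HomE[OF t']
    have "e \<cdot> (snd c \<cdot> t) = ZeroArr C T (Cod C e)" using t(2) by simp
    then obtain v where v: "v \<in> Arr C" "Dom C v = T" "Cod C v = quo c'" "z \<cdot> v = snd c \<cdot> t"
      using confl_factor[OF z, of "snd c \<cdot> t"] by auto
    note [simp] = v(1-3)
    obtain w where w: "w \<in> Hom C T (mid c')" "f \<cdot> w = t" "snd c' \<cdot> w = v"
      using pullback_univ[OF c m t', of v] v by (auto simp: Hom_def)
    show "\<exists>!s. s \<in> Hom C T (Dom C f) \<and> f \<cdot> s = t"
    proof (intro ex1I[of _ w] conjI)
      fix s assume s: "s \<in> Hom C T (Dom C f) \<and> f \<cdot> s = t"
      then have s1: "s \<in> Hom C T (mid c')" by simp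
      note [simp] = HomE[OF s1] HomE[OF w(1)]
      have "snd c' \<cdot> s = snd c' \<cdot> w"
        by (rule confl_mono[OF z]) (use M(13)[of s] M(13)[of w] s w in auto)
      then show "s = w" using pullback_joint[OF c m s1 w(1)] s w by simp
    qed (use w in auto)
  qed (use ezx in auto)
  then show ?thesis by (rule kernel_confl[OF k])
qed

lemma pushout_deflation:
  assumes c: "c \<in> Confl C" "c' \<in> Confl C"
    and m: "cmor C c c' a h (Ident C (quo c))" and a: "(k, a) \<in> Confl C"
  shows "(fst c \<cdot> k, h) \<in> Confl C"
proof -
  interpret D: exact_category "opc C" by (rule exact_category_opc)
  have m': "cmor (opc C) (prod.swap c') (prod.swap c) (Ident C (quo c)) h a"
    using m c by (simp add: cmor_opc)
  show ?thesis
    using D.pullback_inflation[of "prod.swap c" "prod.swap c'" h a k] c m' a by simp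
qed

text \<open>The third isomorphism theorem: the cokernel of a composite of inflations is an extension
  of the two cokernels. Pushing \<open>c\<close> out along \<open>e\<close> realises it together
  with a morphism from \<open>c\<close>.\<close>

lemma noether:
  assumes c: "(i, e) \<in> Confl C" "c \<in> Confl C" "sub c = Cod C i"
  obtains c' h where "c' \<in> Confl C" "sub c' = Cod C e" "quo c' = quo c"
    "(fst c \<cdot> i, h) \<in> Confl C" "Cod C h = mid c'" "cmor C c c' e h (Ident C (quo c))"
proof -
  note I = confl_simps[OF c(1), simplified]
  have "e \<in> Hom C (sub c) (Cod C e)" using I c(3) by (simp add: Hom_def)
  then obtain c' h where c': "c' \<in> Confl C" "sub c' = Cod C e" "quo c' = quo c"
    "cmor C c c' e h (Ident C (quo c))"
    using push_confl[OF c(2)] by blast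
  then show ?thesis
    using that[of c' h] pushout_deflation[OF c(2) c'(1,4) c(1)] cmorD(6)[OF c'(4) c(2) c'(1)] by simp
qed

lemma ident_iso: "X \<in> Obj C \<Longrightarrow> is_iso C (Ident C X)"
  unfolding is_iso_def by (auto intro!: HomI bexI[of _ "Ident C X"])

lemma isoI:
  assumes "f \<in> Hom C X Y" "g \<in> Hom C Y X" "g \<cdot> f = Ident C X" "f \<cdot> g = Ident C Y"
  shows "is_iso C f"
  using assms HomE[OF assms(1)] HomE[OF assms(2)] unfolding is_iso_def
  by (auto intro!: HomI bexI[of _ g])

text \<open>The square is also the pushout of \<open>a\<close> along \<open>fst c\<close>. Built
  from that side, its corner \<open>mid q\<close> carries the cokernel of \<open>a\<close>, and the
  two corners are isomorphic.\<close>

lemma pushout_inflation: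
  assumes c: "c \<in> Confl C" "c' \<in> Confl C" "(a, e) \<in> Confl C"
    and m: "cmor C c c' a h (Ident C (quo c))"
  obtains e' where "(h, e') \<in> Confl C" "Cod C e' = Cod C e"
proof -
  note M = cmorD[OF m c(1,2)]
  note A = confl_simps[OF c(3), simplified]
  have R: "quo c' = quo c" using M(9) c by simp
  note [simp] = c M(1-6) A R
  obtain q g where q: "q \<in> Confl C" "sub q = mid c" "quo q = Cod C e"
    "cmor C (a, e) q (fst c) g (Ident C (Cod C e))"
    using push_confl[OF c(3), of "fst c" "mid c"] by (auto simp: Hom_def)
  note Q = cmorD[OF q(4) c(3) q(1), simplified]
  note [simp] = q(1-3) Q(4-6)
  have Qe: "g \<cdot> a = fst q \<cdot> fst c" using Q(10) .
  have m2: "cmor C (a, e) q (fst c) g (Ident C (Cod C (snd (a, e))))" using q(4) by simp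
  have "h \<in> Hom C (sub q) (mid c')" "fst c' \<in> Hom C (Cod C (fst (a, e))) (mid c')"
    "fst c' \<cdot> fst (a, e) = h \<cdot> fst c"
    using M(10) by (auto intro!: HomI)
  then obtain b where b: "b \<in> Hom C (mid q) (mid c')" "b \<cdot> g = fst c'" "b \<cdot> fst q = h"
    using pushout_univ[OF c(3) q(1) m2] by blast
  have "fst q \<in> Hom C (mid c) (mid q)" "g \<in> Hom C (sub c') (mid q)"
    using M(3) by (auto intro!: HomI)
  then obtain b' where b': "b' \<in> Hom C (mid c') (mid q)" "b' \<cdot> h = fst q" "b' \<cdot> fst c' = g"
    using pushout_univ[OF c(1,2) m, of "fst q" "mid q" g] Qe by auto
  note [simp] = HomE[OF b(1)] HomE[OF b'(1)]
  have D: "sub c' = Cod C a" using M(3) by simp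
  have "b \<cdot> b' = Ident C (mid c')"
    by (rule pushout_joint[OF c(1,2) m, where R = "mid c'"])
      (use b b' D in \<open>auto intro!: HomI\<close>)
  moreover have "b' \<cdot> b = Ident C (mid q)"
    by (rule pushout_joint[OF c(3) q(1) m2, where R = "mid q"])
      (use b b' D in \<open>auto intro!: HomI\<close>)
  ultimately have "is_iso C b" using b b' isoI by blast
  then have "(h, snd q \<cdot> b') \<in> Confl C"
    using \<open>b' \<cdot> b = _\<close> b
    by (intro confl_iso_closed[of "fst q" "snd q" h "snd q \<cdot> b'" "Ident C (mid c)" b "Ident C (Cod C e)"])
      (auto intro!: HomI ident_iso)
  then show ?thesis using that by simp
qed

section \<open>Zero objects, direct sums and split conflations\<close>

lemma zero_confl:
  assumes "X \<in> Obj C"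
  obtains i where "(i, Ident C X) \<in> Confl C" "is_zero_obj C (Dom C i)"
proof -
  obtain i where i: "(i, Ident C X) \<in> Confl C"
    using ident_deflation[OF assms] unfolding deflation_def by blast
  note I = confl_simps[OF i, simplified]
  have "i = ZeroArr C (Dom C i) X" using I assms by simp
  then have "i \<cdot> Ident C (Dom C i) = i \<cdot> ZeroArr C (Dom C i) (Dom C i)"
    using I assms by simp
  then have "Ident C (Dom C i) = ZeroArr C (Dom C i) (Dom C i)"
    by (rule confl_mono[OF i, rotated 5, simplified]) (use I in auto)
  then show ?thesis using that i zero_objI I by auto
qed

lemma zero_objE:
  assumes "is_zero_obj C Z"
  shows "Z \<in> Obj C" "Ident C Z = ZeroArr C Z Z"
  using assms zero_obj_Hom[OF assms, of Z "Ident C Z"] ident_in by (auto simp: is_zero_obj_def)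

lemma zero_confl_from:
  assumes "X \<in> Obj C" "is_zero_obj C Z"
  shows "(ZeroArr C Z X, Ident C X) \<in> Confl C"
proof -
  obtain i where i: "(i, Ident C X) \<in> Confl C" "is_zero_obj C (Dom C i)"
    using zero_confl assms by blast
  note I = confl_simps[OF i(1), simplified]
  note z = zero_objE[OF assms(2)] zero_objE[OF i(2)]
  have i0: "i = ZeroArr C (Dom C i) X" using I assms by simp
  have "is_kernel C (ZeroArr C Z X) (Ident C X)"
    unfolding is_kernel_def
  proof (intro conjI allI ballI impI)
    fix T t assume t: "t \<in> Hom C T (Dom C (Ident C X))" "Ident C X \<cdot> t = ZeroArr C T (Cod C (Ident C X))"
    then have t0: "t = ZeroArr C T X" "T \<in> Obj C" using assms HomE[OF t(1)] by auto
    show "\<exists>!s. s \<in> Hom C T (Dom C (ZeroArr C Z X)) \<and> ZeroArr C Z X \<cdot> s = t"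
      using t0 assms z zero_Hom zero_obj_Hom(1)[OF assms(2)] by (intro ex1I[of _ "ZeroArr C T Z"]) auto
  qed (use assms z in auto)
  then show ?thesis by (rule kernel_confl[OF i(1)])
qed

lemma zero_confl_to:
  assumes "X \<in> Obj C" "is_zero_obj C Z"
  shows "(Ident C X, ZeroArr C X Z) \<in> Confl C"
proof -
  interpret D: exact_category "opc C" by (rule exact_category_opc)
  show ?thesis using D.zero_confl_from[of X Z] assms by simp
qed

text \<open>Pushing \<open>0 \<rightarrow> Y \<rightarrow> Y\<close> out along
  \<open>0 \<rightarrow> X\<close> gives a conflation from \<open>X\<close> to \<open>Y\<close>; its
  middle object has the universal property of the sum, hence is isomorphic to
  \<open>S\<close>.\<close>

lemma dsum_confl:
  assumes d: "dsum C S X Y i1 i2 p1 p2"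
  shows "(i1, p2) \<in> Confl C"
proof -
  note D = dsumD[OF d]
  note [simp] = D(1-15)
  obtain k where k: "(k, Ident C Y) \<in> Confl C" "is_zero_obj C (Dom C k)"
    using zero_confl[of Y] D by blast
  note K = confl_simps[OF k(1), simplified]
  note z = zero_objE[OF k(2)]
  note [simp] = K(1) z(1)
  have k0: "k = ZeroArr C (Dom C k) Y" "Cod C k = Y" using K by simp_all
  obtain q h where q: "q \<in> Confl C" "sub q = X" "quo q = Y"
    "cmor C (k, Ident C Y) q (ZeroArr C (Dom C k) X) h (Ident C Y)"
    using push_confl[OF k(1), of "ZeroArr C (Dom C k) X" X] zero_Hom by auto
  note Q = cmorD[OF q(4) k(1) q(1), simplified]
  note [simp] = q(1-3) Q(4-6) k0(2)
  have m: "cmor C (k, Ident C Y) q (ZeroArr C (Dom C k) X) h (Ident C (Cod C (snd (k, Ident C Y))))"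
    using q(4) by simp
  have qh: "snd q \<cdot> h = Ident C Y" using Q(11)[symmetric] by simp
  have "i2 \<cdot> k = ZeroArr C (Dom C k) S" by (subst k0(1)) simp
  moreover have "i2 \<in> Hom C (Cod C (fst (k, Ident C Y))) S" "i1 \<in> Hom C (sub q) S"
    by (auto intro!: HomI)
  ultimately obtain b where b: "b \<in> Hom C (mid q) S" "b \<cdot> h = i2" "b \<cdot> fst q = i1"
    using pushout_univ[OF k(1) q(1) m, of i2 S i1] by auto
  note [simp] = HomE[OF b(1)]
  let ?b = "(fst q \<cdot> p1) \<boxplus> (h \<cdot> p2)"
  have "b \<cdot> ?b = Ident C S"
    using b D(20) comp_eq1[OF b(2), of p2] comp_eq1[OF b(3), of p1] by simp
  moreover have "?b \<cdot> b = Ident C (mid q)"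
    by (rule pushout_joint[OF k(1) q(1) m, where R = "mid q"])
      (use b D(16-19) in \<open>auto intro!: HomI\<close>)
  moreover have "?b \<in> Hom C S (mid q)" by (auto intro!: HomI)
  ultimately have "is_iso C b" using b isoI by blast
  moreover have "p2 \<cdot> b = snd q"
    by (rule pushout_joint[OF k(1) q(1) m, where R = Y])
      (use b D(16-19) qh in \<open>auto intro!: HomI\<close>)
  ultimately show ?thesis
    using b by (intro confl_iso_closed[of "fst q" "snd q" i1 p2 "Ident C X" b "Ident C Y"])
      (auto intro!: HomI ident_iso)
qed

lemma split_dsum:
  assumes c: "c \<in> Confl C" and s: "s \<in> Hom C (quo c) (mid c)" "snd c \<cdot> s = Ident C (quo c)"
  obtains r where "dsum C (mid c) (sub c) (quo c) (fst c) s r (snd c)"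
proof -
  note [simp] = c HomE[OF s(1)]
  let ?E = "mid c" and ?Y = "sub c" and ?Z = "quo c"
  \<comment> \<open>\<open>d\<close> is the complementary idempotent
    \<open>1 - s \<cdot> snd c\<close>; its factorisation through the kernel is the
    retraction.\<close>
  obtain d where d: "d \<in> Hom C ?E ?E" "Ident C ?E = (s \<cdot> snd c) \<boxplus> d"
    by (rule obtain_diff[of "Ident C ?E" ?E ?E "s \<cdot> snd c"]) (auto intro!: HomI)
  note [simp] = HomE[OF d(1)]
  have "snd c \<boxplus> (snd c \<cdot> d) = snd c \<cdot> ((s \<cdot> snd c) \<boxplus> d)"
    using comp_eq1[OF s(2), of "snd c"] by simp
  also have "\<dots> = snd c \<boxplus> ZeroArr C ?E ?Z" unfolding d(2)[symmetric] by simp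
  finally have "snd c \<cdot> d = ZeroArr C ?E ?Z"
    by (rule add_cancel[rotated 3]) (auto intro!: HomI)
  then obtain r where r: "r \<in> Arr C" "Dom C r = ?E" "Cod C r = ?Y" "fst c \<cdot> r = d"
    using confl_factor[of c d] by auto
  note [simp] = r(1-3)
  have "d \<cdot> fst c = ((s \<cdot> snd c) \<boxplus> d) \<cdot> fst c" by simp
  also have "\<dots> = fst c" unfolding d(2)[symmetric] by simp
  finally have di: "d \<cdot> fst c = fst c" .
  have ri: "r \<cdot> fst c = Ident C ?Y"
    by (rule confl_mono[OF c]) (use comp_eq1[OF r(4), of "fst c"] di in auto)
  have "s \<boxplus> (d \<cdot> s) = ((s \<cdot> snd c) \<boxplus> d) \<cdot> s"
    using s(2) by simp
  also have "\<dots> = s \<boxplus> ZeroArr C ?Z ?E" unfolding d(2)[symmetric] by simp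
  finally have ds: "d \<cdot> s = ZeroArr C ?Z ?E"
    by (rule add_cancel[rotated 3]) (auto intro!: HomI)
  have rs: "r \<cdot> s = ZeroArr C ?Z ?Y"
    by (rule confl_mono[OF c]) (use comp_eq1[OF r(4), of s] ds in auto)
  have "(fst c \<cdot> r) \<boxplus> (s \<cdot> snd c) = Ident C ?E"
    unfolding r(4) d(2) by (rule add_comm) (auto intro!: HomI)
  then have "dsum C ?E ?Y ?Z (fst c) s r (snd c)"
    using ri rs s unfolding dsum_def by (auto intro!: HomI)
  then show ?thesis by (rule that)
qed

lemma split_dsum_retract:
  assumes c: "c \<in> Confl C" and r: "r \<in> Hom C (mid c) (sub c)" "r \<cdot> fst c = Ident C (sub c)"
  obtains s where "dsum C (mid c) (sub c) (quo c) (fst c) s r (snd c)"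
proof -
  interpret D: exact_category "opc C" by (rule exact_category_opc)
  obtain s where "dsum (opc C) (mid c) (quo c) (sub c) (snd c) r s (fst c)"
    using D.split_dsum[of "prod.swap c" r] c r by auto
  then have "dsum C (mid c) (quo c) (sub c) s (fst c) (snd c) r"
    by (simp add: dsum_opc)
  then show ?thesis using that dsum_commute by blast
qed

text \<open>The map is the composite of a split inflation with a pullback of the given one along a
  projection.\<close>

lemma dsum_inflation:
  assumes d: "dsum C S W B i1 i2 p1 p2" and c: "c \<in> Confl C" "mid c = B"
    and g: "g \<in> Hom C (sub c) W"
  obtains e where "((i1 \<cdot> g) \<boxplus> (i2 \<cdot> fst c), e) \<in> Confl C"
proof -
  note D = dsumD[OF d]
  note [simp] = D(1-15) c HomE[OF g]
  have d': "(i1, p2) \<in> Confl C" by (rule dsum_confl[OF d])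
  let ?\<psi> = "(i1 \<cdot> g) \<boxplus> (i2 \<cdot> fst c)"
  obtain P f where P: "P \<in> Confl C" "quo P = sub c" "sub P = W"
    "cmor C P (i1, p2) (Ident C (Dom C (fst (i1, p2)))) f (fst c)"
    using pull_confl[OF d', of "fst c" "sub c"] by (auto simp: Hom_def)
  note M = cmorD[OF P(4,1) d', simplified]
  note [simp] = P(1-3) M(4-6)
  have "(f, snd c \<cdot> p2) \<in> Confl C"
    using pullback_inflation[OF d' P(1,4), of "snd c"] c by simp
  then have 1: "inflation C f" unfolding inflation_def by blast
  have "?\<psi> \<in> Hom C (sub c) (Cod C (fst (i1, p2)))" by (auto intro!: HomI)
  moreover have "Ident C (sub c) \<in> Hom C (sub c) (quo P)" by (auto intro!: HomI)
  moreover have "snd (i1, p2) \<cdot> ?\<psi> = fst c \<cdot> Ident C (sub c)"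
    using comp_eq1[OF D(17), of "fst c"] comp_eq1[OF D(18), of g] by simp
  ultimately obtain t where t: "t \<in> Hom C (sub c) (mid P)" "f \<cdot> t = ?\<psi>"
    "snd P \<cdot> t = Ident C (sub c)"
    using pullback_univ[OF d' P(1,4)] by blast
  obtain r where r: "dsum C (mid P) W (sub c) (fst P) t r (snd P)"
    using split_dsum[OF P(1), of t] t by auto
  have "(t, r) \<in> Confl C" by (rule dsum_confl[OF dsum_commute[OF r]])
  then have "inflation C t" unfolding inflation_def by blast
  then have "inflation C (f \<cdot> t)" using 1 inflation_comp HomE[OF t(1)] by auto
  then show ?thesis using that t(2) unfolding inflation_def by auto
qed

text \<open>Pulling back along a projection adds the complementary summand to the middle term, so a
  quotient can be enlarged while the middle term stays in a class closed under sums.\<close>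

lemma pull_dsum:
  assumes d: "dsum C S W B i1 i2 p1 p2" and c: "c \<in> Confl C" "quo c = W"
  obtains P a where "P \<in> Confl C" "sub P = sub c" "quo P = S"
    "cmor C P c (Ident C (sub c)) a p1" "is_direct_sum C (mid P) (mid c) B"
proof -
  note D = dsumD[OF d]
  note [simp] = D(1-15) c
  obtain P a where P: "P \<in> Confl C" "quo P = S" "sub P = sub c"
    "cmor C P c (Ident C (sub c)) a p1"
    using pull_confl[OF c(1), of p1 S] by (auto simp: Hom_def)
  note M = cmorD[OF P(4,1) c(1)]
  note [simp] = P(1-3) M(4-6)
  let ?F = "mid c"
  have pa: "p1 \<cdot> snd P = snd c \<cdot> a" using M(11) .
  have "Ident C ?F \<in> Hom C ?F (mid c)" "i1 \<cdot> snd c \<in> Hom C ?F (quo P)"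
    "snd c \<cdot> Ident C ?F = p1 \<cdot> (i1 \<cdot> snd c)"
    using comp_eq1[OF D(16), of "snd c"] by (auto intro!: HomI)
  then obtain j1 where j1: "j1 \<in> Hom C ?F (mid P)" "a \<cdot> j1 = Ident C ?F" "snd P \<cdot> j1 = i1 \<cdot> snd c"
    using pullback_univ[OF c(1) P(1,4)] by blast
  have "ZeroArr C B ?F \<in> Hom C B (mid c)" "i2 \<in> Hom C B (quo P)"
    "snd c \<cdot> ZeroArr C B ?F = p1 \<cdot> i2"
    using D(19) by (auto intro!: HomI)
  then obtain j2 where j2: "j2 \<in> Hom C B (mid P)" "a \<cdot> j2 = ZeroArr C B ?F" "snd P \<cdot> j2 = i2"
    using pullback_univ[OF c(1) P(1,4)] by blast
  note [simp] = HomE[OF j1(1)] HomE[OF j2(1)]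
  have q1: "(i1 \<cdot> (p1 \<cdot> snd P)) \<boxplus> (i2 \<cdot> (p2 \<cdot> snd P)) = snd P"
  proof -
    have "((i1 \<cdot> p1) \<boxplus> (i2 \<cdot> p2)) \<cdot> snd P = snd P" unfolding D(20) by simp
    then show ?thesis by simp
  qed
  have "(j1 \<cdot> a) \<boxplus> (j2 \<cdot> (p2 \<cdot> snd P)) = Ident C (mid P)"
  proof (rule pullback_joint[OF c(1) P(1,4), where R = "mid P"])
    show "snd P \<cdot> (j1 \<cdot> a \<boxplus> j2 \<cdot> (p2 \<cdot> snd P)) = snd P \<cdot> Ident C (mid P)"
      using comp_eq[OF j1(3), of a] comp_eq1[OF j2(3), of "p2 \<cdot> snd P"] q1 pa by simp
    show "a \<cdot> (j1 \<cdot> a \<boxplus> j2 \<cdot> (p2 \<cdot> snd P)) = a \<cdot> Ident C (mid P)"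
      using comp_eq1[OF j1(2), of a] comp_eq1[OF j2(2), of "p2 \<cdot> snd P"] by simp
  qed (auto intro!: HomI)
  then have "dsum C (mid P) ?F B j1 j2 a (p2 \<cdot> snd P)"
    unfolding dsum_def using j1 j2 D(17,18) comp_eq1[OF D(18), of "snd c"] by (auto intro!: HomI)
  then show ?thesis using that[OF P(1,3,2,4)] unfolding is_direct_sum_iff by blast
qed

text \<open>\<open>cG\<close> is the pushout of \<open>cE\<close> and \<open>cF\<close> under
  \<open>c'\<close>, formed separately on middle terms and on quotients. Both pushouts exist because
  \<open>v\<close> is an inflation, and \<open>g\<close>, its pullback, is then one as well.\<close>

lemma amalgamate:
  assumes c: "cE \<in> Confl C" "c' \<in> Confl C" "cF \<in> Confl C"
    and f: "cmor C c' cE (Ident C Y) f u"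
    and g: "cmor C c' cF (Ident C Y) g v" and v: "(v, e) \<in> Confl C" and Y: "sub cE = Y"
  obtains cG x x' y y' where "cG \<in> Confl C" "cmor C cE cG (Ident C Y) x y" "cmor C cF cG (Ident C Y) x' y'"
    "y \<cdot> u = y' \<cdot> v"
proof -
  note F = cmorD[OF f c(2,1)]
  note G = cmorD[OF g c(2,3)]
  note V = confl_simps[OF v, simplified]
  have Yobj: "Y \<in> Obj C" using c(1) Y by auto
  note [simp] = c F(4-9) G(4-9) V(1-3) Yobj
  have L: "sub c' = Y" using F(2) by simp
  have LF: "sub cF = Y" using G(3) by simp
  note [simp] = L Y LF
  have fi: "f \<cdot> fst c' = fst cE" using F(10) by simp
  have gi: "g \<cdot> fst c' = fst cF" using G(10) by simp
  have up: "u \<cdot> snd c' = snd cE \<cdot> f" using F(11) .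
  have vp: "v \<cdot> snd c' = snd cF \<cdot> g" using G(11) .
  have g': "cmor C c' cF (Ident C (sub cF)) g v" using g by simp
  have gc: "(g, e \<cdot> snd cF) \<in> Confl C"
    by (rule pullback_inflation[OF c(3,2) g' v])
  have "f \<in> Hom C (Dom C (fst (g, e \<cdot> snd cF))) (mid cE)" by (auto intro!: HomI)
  then obtain cg h where cg: "cg \<in> Confl C" "sub cg = mid cE"
    "cmor C (g, e \<cdot> snd cF) cg f h (Ident C (Cod C (snd (g, e \<cdot> snd cF))))"
    using push_confl[OF gc] by blast
  have "u \<in> Hom C (Dom C (fst (v, e))) (quo cE)" by (auto intro!: HomI)
  then obtain cd k where cd: "cd \<in> Confl C" "sub cd = quo cE"
    "cmor C (v, e) cd u k (Ident C (Cod C (snd (v, e))))"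
    using push_confl[OF v] by blast
  note Hm = cmorD[OF cg(3) gc cg(1), simplified]
  note Km = cmorD[OF cd(3) v cd(1), simplified]
  note [simp] = cg(1,2) cd(1,2) Hm(4-6) Km(4-6)
  let ?D = "mid cd" and ?G = "mid cg"
  have hg: "h \<cdot> g = fst cg \<cdot> f" using Hm(10) .
  have kv: "k \<cdot> v = fst cd \<cdot> u" using Km(10) .
  have "k \<cdot> snd cF \<in> Hom C (Cod C (fst (g, e \<cdot> snd cF))) ?D" "fst cd \<cdot> snd cE \<in> Hom C (sub cg) ?D"
    by (auto intro!: HomI)
  moreover have "(k \<cdot> snd cF) \<cdot> fst (g, e \<cdot> snd cF) = (fst cd \<cdot> snd cE) \<cdot> f"
    using comp_eq[OF kv, of "snd c'"] vp up by simp
  ultimately obtain w where w: "w \<in> Hom C ?G ?D" "w \<cdot> h = k \<cdot> snd cF" "w \<cdot> fst cg = fst cd \<cdot> snd cE"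
    using pushout_univ[OF gc cg(1,3)] by blast
  note [simp] = HomE[OF w(1)]
  have infl: "inflation C (fst d)" if "d \<in> Confl C" for d
    using that unfolding inflation_def by (metis prod.collapse)
  \<comment> \<open>As a composite of inflations this has some cokernel \<open>q\<close>; what
    remains is that the comparison map \<open>w\<close> between the two pushouts is a cokernel
    too.\<close>
  let ?\<gamma> = "fst cg \<cdot> fst cE"
  have "inflation C ?\<gamma>" using inflation_comp[of "fst cE" "fst cg"] infl by simp
  then obtain q where q: "(?\<gamma>, q) \<in> Confl C" unfolding inflation_def by auto
  have hiF: "h \<cdot> fst cF = ?\<gamma>"
    using comp_eq[OF hg, of "fst c'"] fi gi by simp
  have w\<gamma>: "w \<cdot> ?\<gamma> = ZeroArr C Y ?D" using comp_eq[OF w(3), of "fst cE"] by simp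
  have "is_cokernel C w ?\<gamma>"
    unfolding is_cokernel_def
  proof (intro conjI allI ballI impI)
    fix T t assume t: "t \<in> Hom C (Cod C ?\<gamma>) T" "t \<cdot> ?\<gamma> = ZeroArr C (Dom C ?\<gamma>) T"
    have t': "t \<in> Hom C ?G T" using t(1) by simp
    note [simp] = HomE[OF t']
    have t0: "t \<cdot> (fst cg \<cdot> fst cE) = ZeroArr C Y T" using t(2) by simp
    obtain s1 where s1: "s1 \<in> Arr C" "Dom C s1 = quo cE" "Cod C s1 = T" "s1 \<cdot> snd cE = t \<cdot> fst cg"
      using confl_cofactor[of cE "t \<cdot> fst cg"] t0 by auto
    obtain s2 where s2: "s2 \<in> Arr C" "Dom C s2 = quo cF" "Cod C s2 = T" "s2 \<cdot> snd cF = t \<cdot> h"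
      using confl_cofactor[of cF "t \<cdot> h"] t0 hiF by auto
    note [simp] = s1(1-3) s2(1-3)
    have "(s2 \<cdot> v) \<cdot> snd c' = (s1 \<cdot> u) \<cdot> snd c'"
      using vp up comp_eq[OF s1(4), of f] comp_eq[OF s2(4), of g] hg by simp
    then have "s2 \<cdot> v = s1 \<cdot> u" by (rule confl_epi[OF c(2), rotated 5]) auto
    then obtain s where s: "s \<in> Hom C ?D T" "s \<cdot> k = s2" "s \<cdot> fst cd = s1"
      using pushout_univ[OF v cd(1,3), of s2 T s1] by (auto simp: Hom_def)
    note [simp] = HomE[OF s(1)]
    have sw: "s \<cdot> w = t"
      by (rule pushout_joint[OF gc cg(1,3), where R = T])
        (use w s s1 s2 comp_eq1[OF s(2), of "snd cF"] comp_eq1[OF s(3), of "snd cE"] in \<open>auto intro!: HomI\<close>)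
    have un: "s' = s" if s': "s' \<in> Hom C ?D T" "s' \<cdot> w = t" for s'
    proof (rule pushout_joint[OF v cd(1,3), where R = T])
      note [simp] = HomE[OF s'(1)]
      show "s' \<cdot> k = s \<cdot> k"
        by (rule confl_epi[OF c(3)])
          (use comp_eq1[OF s'(2), of h] comp_eq1[OF sw, of h] w in auto)
      show "s' \<cdot> fst cd = s \<cdot> fst cd"
        by (rule confl_epi[OF c(1)])
          (use comp_eq1[OF s'(2), of "fst cg"] comp_eq1[OF sw, of "fst cg"] w in auto)
    qed (use s s' in auto)
    show "\<exists>!s. s \<in> Hom C (Cod C w) T \<and> s \<cdot> w = t"
    proof (rule ex1I[of _ s])
      show "s \<in> Hom C (Cod C w) T \<and> s \<cdot> w = t" using s sw by simp
      show "s' = s" if "s' \<in> Hom C (Cod C w) T \<and> s' \<cdot> w = t" for s'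
        by (rule un) (use that in simp_all)
    qed
  qed (use w\<gamma> in auto)
  then have G: "(?\<gamma>, w) \<in> Confl C" by (rule cokernel_confl[OF q])
  have "cmor C cE (?\<gamma>, w) (Ident C Y) (fst cg) (fst cd)"
    unfolding cmor_def using w by (auto intro!: HomI)
  moreover have "cmor C cF (?\<gamma>, w) (Ident C Y) h k"
    unfolding cmor_def using w hiF by (auto intro!: HomI)
  ultimately show ?thesis using that[OF G] kv by metis
qed

end

section \<open>Yoneda extensions as lists of conflations\<close>

text \<open>An extension \<open>0 \<rightarrow> Y \<rightarrow> E\<^sub>n \<rightarrow> \<dots> \<rightarrow> E\<^sub>1 \<rightarrow> X \<rightarrow> 0\<close> is the list of the \<open>n\<close> conflations it is spliced from,
  with middle terms \<open>E\<^sub>n, \<dots>, E\<^sub>1\<close>; the empty list stands for degree \<open>0\<close> and forces \<open>Y = X\<close>.\<close>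

fun is_ext :: "('o, 'm, 'x) preexact_cat_scheme \<Rightarrow> ('m \<times> 'm) list \<Rightarrow> 'o \<Rightarrow> 'o \<Rightarrow> bool" where
  "is_ext C [] Y X \<longleftrightarrow> Y = X \<and> Y \<in> Obj C"
| "is_ext C (c # \<xi>) Y X \<longleftrightarrow> c \<in> Confl C \<and> Dom C (fst c) = Y \<and> is_ext C \<xi> (Cod C (snd c)) X"

text \<open>Only the two end maps are visible. The components in between stay existential, since
  later statements speak about the ends alone.\<close>

fun mor :: "('o, 'm, 'x) preexact_cat_scheme \<Rightarrow> ('m \<times> 'm) list \<Rightarrow> ('m \<times> 'm) list \<Rightarrow> 'm \<Rightarrow> 'm \<Rightarrow> bool" where
  "mor C [] [] a b \<longleftrightarrow> a \<in> Arr C \<and> a = b"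
| "mor C (c # \<xi>) (c' # \<xi>') a b \<longleftrightarrow> (\<exists>h z. cmor C c c' a h z \<and> mor C \<xi> \<xi>' z b)"
| "mor C _ _ _ _ \<longleftrightarrow> False"

definition mor1 :: "('o, 'm, 'x) preexact_cat_scheme \<Rightarrow> 'o \<Rightarrow> 'o \<Rightarrow> ('m \<times> 'm) list \<Rightarrow> ('m \<times> 'm) list \<Rightarrow> bool" where
  "mor1 C Y X \<xi> \<xi>' \<longleftrightarrow> is_ext C \<xi> Y X \<and> is_ext C \<xi>' Y X \<and> mor C \<xi> \<xi>' (Ident C Y) (Ident C X)"

definition yeq :: "('o, 'm, 'x) preexact_cat_scheme \<Rightarrow> 'o \<Rightarrow> 'o \<Rightarrow> ('m \<times> 'm) list \<Rightarrow> ('m \<times> 'm) list \<Rightarrow> bool" where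
  "yeq C Y X = equivclp (mor1 C Y X)"

definition splitlast :: "('o, 'm, 'x) preexact_cat_scheme \<Rightarrow> ('m \<times> 'm) list \<Rightarrow> bool" where
  "splitlast C \<xi> \<longleftrightarrow> \<xi> \<noteq> [] \<and> (\<exists>s \<in> Hom C (Cod C (snd (last \<xi>))) (Cod C (fst (last \<xi>))).
     snd (last \<xi>) \<cdot>\<^bsub>C\<^esub> s = Ident C (Cod C (snd (last \<xi>))))"

definition splitfirst :: "('o, 'm, 'x) preexact_cat_scheme \<Rightarrow> ('m \<times> 'm) list \<Rightarrow> bool" where
  "splitfirst C \<xi> \<longleftrightarrow> \<xi> \<noteq> [] \<and> (\<exists>r \<in> Hom C (Cod C (fst (hd \<xi>))) (Dom C (fst (hd \<xi>))).
     r \<cdot>\<^bsub>C\<^esub> fst (hd \<xi>) = Ident C (Dom C (fst (hd \<xi>))))"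

text \<open>This says that the class is zero. A single morphism into a visibly trivial extension,
  rather than an equivalence, is easy to combine with pullbacks and pushouts;
  \<open>effacedI\<close> shows that nothing is lost.\<close>

definition effaced :: "('o, 'm, 'x) preexact_cat_scheme \<Rightarrow> 'o \<Rightarrow> 'o \<Rightarrow> ('m \<times> 'm) list \<Rightarrow> bool" where
  "effaced C Y X \<xi> \<longleftrightarrow> (\<exists>\<omega>. splitlast C \<omega> \<and> mor1 C Y X \<xi> \<omega>)"

lemma mor_length: "mor C \<xi> \<xi>' a b \<Longrightarrow> length \<xi> = length \<xi>'"
  by (induction C \<xi> \<xi>' a b rule: mor.induct) auto

lemma mor_Cons:
  assumes "mor C (c # \<xi>) \<zeta> a b"
  obtains c' \<zeta>' h z where "\<zeta> = c' # \<zeta>'" "cmor C c c' a h z" "mor C \<xi> \<zeta>' z b"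
  using assms by (cases \<zeta>) auto

lemma mor_Nil [simp]: "mor C [] \<zeta> a b \<longleftrightarrow> \<zeta> = [] \<and> a \<in> Arr C \<and> a = b"
  by (cases \<zeta>) auto

context exact_category
begin

section \<open>Splicing, composing and subtracting morphisms of extensions\<close>

lemma is_ext_obj: "is_ext C \<xi> Y X \<Longrightarrow> Y \<in> Obj C \<and> X \<in> Obj C"
  by (induction \<xi> arbitrary: Y) auto

lemma is_ext_append: "is_ext C (\<xi> @ \<zeta>) Y X \<longleftrightarrow> (\<exists>Z. is_ext C \<xi> Y Z \<and> is_ext C \<zeta> Z X)"
  by (induction \<xi> arbitrary: Y) (auto dest: is_ext_obj)

lemma mor_arr: "mor C \<xi> \<xi>' a b \<Longrightarrow> a \<in> Arr C"
  by (cases \<xi>; cases \<xi>') (auto simp: cmor_def Hom_def)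

lemma mor_append:
  "length \<xi> = length \<xi>' \<Longrightarrow> mor C (\<xi> @ \<zeta>) (\<xi>' @ \<zeta>') a b \<longleftrightarrow> (\<exists>z. mor C \<xi> \<xi>' a z \<and> mor C \<zeta> \<zeta>' z b)"
  by (induction \<xi> \<xi>' arbitrary: a rule: list_induct2) (auto dest: mor_arr)

lemma mor_Hom:
  assumes "mor C \<xi> \<xi>' a b" "is_ext C \<xi> Y X" "is_ext C \<xi>' Y' X'" "a \<in> Hom C Y Y'"
  shows "b \<in> Hom C X X'"
  using assms by (induction C \<xi> \<xi>' a b arbitrary: Y Y' rule: mor.induct) (auto simp: cmor_def)

lemma mor_id: "is_ext C \<xi> Y X \<Longrightarrow> mor C \<xi> \<xi> (Ident C Y) (Ident C X)"
proof (induction \<xi> arbitrary: Y)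
  case (Cons c \<xi>)
  then show ?case using cmor_id[of c] by auto
qed auto

lemma mor_comp:
  assumes "mor C \<xi> \<zeta> a b" "mor C \<zeta> \<eta> a' b'"
    "is_ext C \<xi> Y X" "is_ext C \<zeta> Y' X'" "is_ext C \<eta> Y'' X''" "a \<in> Hom C Y Y'" "a' \<in> Hom C Y' Y''"
  shows "mor C \<xi> \<eta> (a' \<cdot> a) (b' \<cdot> b)"
  using assms
proof (induction \<xi> arbitrary: Y Y' Y'' a a' \<zeta> \<eta>)
  case Nil
  then show ?case using comp_in[of a Y Y' a' Y''] by (auto simp: Hom_def)
next
  case (Cons c \<xi>)
  obtain c1 \<zeta>1 h z where 1: "\<zeta> = c1 # \<zeta>1" "cmor C c c1 a h z" "mor C \<xi> \<zeta>1 z b"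
    using mor_Cons[OF Cons.prems(1)] .
  obtain c2 \<eta>1 h' z' where 2: "\<eta> = c2 # \<eta>1" "cmor C c1 c2 a' h' z'" "mor C \<zeta>1 \<eta>1 z' b'"
    using mor_Cons[OF Cons.prems(2)[unfolded 1(1)]] .
  have z: "z \<in> Hom C (quo c) (quo c1)" "z' \<in> Hom C (quo c1) (quo c2)"
    using 1 2 unfolding cmor_def by auto
  have "mor C \<xi> \<eta>1 (z' \<cdot> z) (b' \<cdot> b)"
    by (rule Cons.IH[OF 1(3) 2(3) _ _ _ z]) (use Cons.prems 1 2 in auto)
  moreover have "cmor C c c2 (a' \<cdot> a) (h' \<cdot> h) (z' \<cdot> z)"
    by (rule cmor_comp[OF 1(2) 2(2)]) (use Cons.prems 1 2 in auto)
  ultimately show ?case using 2(1) by auto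
qed

lemma mor1_refl: "is_ext C \<xi> Y X \<Longrightarrow> mor1 C Y X \<xi> \<xi>"
  by (simp add: mor1_def mor_id)

lemma mor_mor1:
  assumes "mor C \<xi> \<zeta> a b" "mor1 C Y' X' \<zeta> \<eta>" "is_ext C \<xi> Y X" "a \<in> Hom C Y Y'"
  shows "mor C \<xi> \<eta> a b"
proof -
  have z: "is_ext C \<zeta> Y' X'" "is_ext C \<eta> Y' X'" "mor C \<zeta> \<eta> (Ident C Y') (Ident C X')"
    using assms unfolding mor1_def by auto
  have b: "b \<in> Hom C X X'" by (rule mor_Hom[OF assms(1,3) z(1) assms(4)])
  show ?thesis
    using mor_comp[OF assms(1) z(3) assms(3) z(1,2) assms(4) ident_in] HomE[OF b] HomE[OF assms(4)] by simp
qed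

lemma mor1_mor:
  assumes "mor1 C Y X \<xi> \<zeta>" "mor C \<zeta> \<eta> a b" "is_ext C \<eta> Y' X'" "a \<in> Hom C Y Y'"
  shows "mor C \<xi> \<eta> a b"
proof -
  have z: "is_ext C \<xi> Y X" "is_ext C \<zeta> Y X" "mor C \<xi> \<zeta> (Ident C Y) (Ident C X)"
    using assms unfolding mor1_def by auto
  have b: "b \<in> Hom C X X'" by (rule mor_Hom[OF assms(2) z(2) assms(3,4)])
  show ?thesis
    using mor_comp[OF z(3) assms(2) z(1,2) assms(3) ident_in assms(4)] HomE[OF b] HomE[OF assms(4)] by simp
qed

lemma mor1_trans: "mor1 C Y X \<xi> \<zeta> \<Longrightarrow> mor1 C Y X \<zeta> \<eta> \<Longrightarrow> mor1 C Y X \<xi> \<eta>"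
  using mor1_mor[of Y X \<xi> \<zeta> \<eta> "Ident C Y" "Ident C X" Y X] is_ext_obj ident_in unfolding mor1_def by blast

lemma cmor_diff:
  assumes c: "c \<in> Confl C" "c' \<in> Confl C"
    and m: "cmor C c c' (a \<boxplus> x) h1 z1" "cmor C c c' a h z" and x: "x \<in> Hom C (sub c) (sub c')"
  obtains dh dz where "cmor C c c' x dh dz" "z1 = z \<boxplus> dz"
proof -
  note M1 = cmorD[OF m(1) c]
  note M = cmorD[OF m(2) c]
  note [simp] = c M(1-9) M1(4-9) HomE[OF x]
  obtain dh where dh: "dh \<in> Hom C (mid c) (mid c')" "h1 = h \<boxplus> dh"
    by (rule obtain_diff[of h1 "mid c" "mid c'" h]) (auto intro!: HomI)
  note [simp] = HomE[OF dh(1)]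
  have "(fst c' \<cdot> a) \<boxplus> (dh \<cdot> fst c) = (fst c' \<cdot> a) \<boxplus> (fst c' \<cdot> x)"
    using M1(10) M(10) unfolding dh(2) by simp
  then have "dh \<cdot> fst c = fst c' \<cdot> x" by (rule add_cancel[rotated 3]) (auto intro!: HomI)
  then obtain dz where dz: "cmor C c c' x dh dz"
    using cmor_extend_right[OF c x dh(1)] by blast
  note D = cmorD[OF dz c]
  note [simp] = D(7-9)
  have "z1 \<cdot> snd c = (z \<boxplus> dz) \<cdot> snd c"
    using M1(11) M(11) D(11) unfolding dh(2) by simp
  then have "z1 = z \<boxplus> dz" by (rule confl_epi[OF c(1), rotated 5]) auto
  with dz that show ?thesis by blast
qed

text \<open>The components are subtracted one conflation after the other; since each
  \<open>snd c\<close> is an epimorphism, the difference on middle terms forces the difference on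
  the next cycles.\<close>

lemma mor_diff:
  assumes "mor C \<xi> \<eta> (a \<boxplus> x) (b \<boxplus> y)" "mor C \<xi> \<eta> a b" "is_ext C \<xi> Y X" "is_ext C \<eta> Y' X'"
    "a \<in> Hom C Y Y'" "x \<in> Hom C Y Y'" "y \<in> Hom C X X'"
  shows "mor C \<xi> \<eta> x y"
  using assms
proof (induction \<xi> arbitrary: Y Y' a x \<eta>)
  case Nil
  then have e: "a \<boxplus> x = a \<boxplus> y" "Y = X" "Y' = X'" by auto
  have "x = y" by (rule add_cancel[OF Nil(5,6) _ e(1)]) (use Nil e in auto)
  then show ?case using Nil by (auto simp: Hom_def)
next
  case (Cons c \<xi>)
  obtain c1 \<eta>1 h1 z1 where 1: "\<eta> = c1 # \<eta>1" "cmor C c c1 (a \<boxplus> x) h1 z1" "mor C \<xi> \<eta>1 z1 (b \<boxplus> y)"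
    using mor_Cons[OF Cons.prems(1)] .
  obtain h z where 2: "cmor C c c1 a h z" "mor C \<xi> \<eta>1 z b"
    using Cons.prems(2) 1(1) by auto
  have c: "c \<in> Confl C" "c1 \<in> Confl C" using Cons.prems 1 by auto
  obtain dh dz where d: "cmor C c c1 x dh dz" "z1 = z \<boxplus> dz"
    by (rule cmor_diff[OF c 1(2) 2(1)]) (use Cons.prems 1 in auto)
  have "mor C \<xi> \<eta>1 dz y"
    by (rule Cons.IH[of \<eta>1 z dz "quo c" "quo c1"])
      (use 1 2 d Cons.prems in \<open>auto simp: cmor_def\<close>)
  then show ?case using 1(1) d(1) by auto
qed

text \<open>A homotopy in the first place: the term added on the left is absorbed by
  \<open>fst c' \<cdot> t\<close> in the middle, which dies under \<open>snd c'\<close>, so nothing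
  changes further to the right.\<close>

lemma mor_homotopy_left:
  assumes "mor C (c # \<xi>) (c' # \<xi>') a b" "c \<in> Confl C" "c' \<in> Confl C" "t \<in> Hom C (mid c) (sub c')"
  shows "mor C (c # \<xi>) (c' # \<xi>') (a \<boxplus> (t \<cdot> fst c)) b"
proof -
  obtain h z where m: "cmor C c c' a h z" "mor C \<xi> \<xi>' z b" using assms(1) by auto
  note M = cmorD[OF m(1) assms(2,3)]
  note [simp] = assms(2,3) HomE[OF assms(4)] M(1-9)
  have "snd c' \<cdot> (h \<boxplus> (fst c' \<cdot> t)) = z \<cdot> snd c" using M(11) by simp
  then have "cmor C c c' (a \<boxplus> (t \<cdot> fst c)) (h \<boxplus> (fst c' \<cdot> t)) z"
    unfolding cmor_def using M(10) by (auto intro!: HomI)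
  with m(2) show ?thesis by auto
qed

lemma mor_snocI:
  assumes "mor C \<xi> \<zeta> a z" "cmor C c c' z h b"
  shows "mor C (\<xi> @ [c]) (\<zeta> @ [c']) a b"
proof -
  have "b \<in> Arr C" using assms(2) unfolding cmor_def Hom_def by auto
  then have "mor C [c] [c'] z b" using assms(2) by auto
  then show ?thesis using assms(1) mor_append[OF mor_length[OF assms(1)]] by blast
qed

lemma mor_homotopy_right:
  assumes "mor C (\<xi> @ [c]) (\<xi>' @ [c']) a b" "c \<in> Confl C" "c' \<in> Confl C" "t \<in> Hom C (quo c) (mid c')"
  shows "mor C (\<xi> @ [c]) (\<xi>' @ [c']) a (b \<boxplus> (snd c' \<cdot> t))"
proof -
  have l: "length \<xi> = length \<xi>'" using mor_length[OF assms(1)] by simp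
  obtain h z where m: "mor C \<xi> \<xi>' a z" "cmor C c c' z h b" using assms(1) mor_append[OF l] by auto
  note M = cmorD[OF m(2) assms(2,3)]
  note [simp] = assms(2,3) HomE[OF assms(4)] M(1-9)
  have "(h \<boxplus> (t \<cdot> snd c)) \<cdot> fst c = fst c' \<cdot> z" using M(10) by simp
  then have "cmor C c c' z (h \<boxplus> (t \<cdot> snd c)) (b \<boxplus> (snd c' \<cdot> t))"
    unfolding cmor_def using M(11) by (auto intro!: HomI)
  then show ?thesis by (rule mor_snocI[OF m(1)])
qed

lemma mor_cocart:
  assumes "c \<in> Confl C" "c' \<in> Confl C" "cmor C c c' a h (Ident C (quo c))"
    "mor C (c # \<xi>) \<eta> (b \<cdot> a) y" "is_ext C \<eta> Y X" "b \<in> Hom C (sub c') Y"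
  shows "mor C (c' # \<xi>) \<eta> b y"
proof -
  obtain d \<eta>' g z where m: "\<eta> = d # \<eta>'" "cmor C c d (b \<cdot> a) g z" "mor C \<xi> \<eta>' z y"
    using mor_Cons[OF assms(4)] .
  obtain g' where "cmor C c' d b g' z"
    using cocart[OF assms(1,2) _ assms(3) m(2)] assms(5,6) m(1) by auto
  then show ?thesis using m by auto
qed

lemma mor_snoc:
  assumes "mor C (\<xi> @ [c]) \<zeta> a b"
  obtains c' \<zeta>' h z where "\<zeta> = \<zeta>' @ [c']" "mor C \<xi> \<zeta>' a z" "cmor C c c' z h b" "length \<xi> = length \<zeta>'"
proof -
  have "length \<zeta> = Suc (length \<xi>)" using mor_length[OF assms] by simp
  then obtain \<zeta>' c' where z: "\<zeta> = \<zeta>' @ [c']" "length \<xi> = length \<zeta>'" by (cases \<zeta> rule: rev_cases) auto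
  show ?thesis using assms that[OF z(1) _ _ z(2)] unfolding z(1) mor_append[OF z(2)] by auto
qed

lemma is_ext_snoc: "is_ext C (\<xi> @ [c]) Y X \<longleftrightarrow> is_ext C \<xi> Y (sub c) \<and> c \<in> Confl C \<and> quo c = X"
  by (auto simp: is_ext_append)

lemma mor_cart:
  assumes "is_ext C (\<xi> @ [c]) Y X" "c' \<in> Confl C" "cmor C c' c (Ident C (sub c)) f z"
    "mor C \<eta> (\<xi> @ [c]) a (z \<cdot> y)" "is_ext C \<eta> Y' X'" "y \<in> Hom C X' (quo c')"
  shows "mor C \<eta> (\<xi> @ [c']) a y"
proof -
  have "length \<eta> = Suc (length \<xi>)" using mor_length[OF assms(4)] by simp
  then obtain \<eta>' d where e: "\<eta> = \<eta>' @ [d]" by (cases \<eta> rule: rev_cases) auto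
  have l: "length \<eta>' = length \<xi>" using mor_length[OF assms(4)] e by simp
  obtain w g where w: "mor C \<eta>' \<xi> a w" "cmor C d c w g (z \<cdot> y)"
    using assms(4) unfolding e mor_append[OF l] by auto
  have "d \<in> Confl C" "c \<in> Confl C" "quo d = X'" using assms(1,5) e by (auto simp: is_ext_snoc)
  then obtain g' where "cmor C d c' w g' y"
    using cart[OF _ assms(2) _ assms(3) w(2)] assms(6) by auto
  then show ?thesis unfolding e using mor_snocI w(1) by blast
qed

text \<open>The cokernel \<open>W\<close> of the first map of \<open>\<eta>\<close> is enlarged by the second middle term \<open>B\<close> of \<open>\<xi>'\<close>, so
  that the corresponding cokernel of \<open>\<xi>'\<close> maps to \<open>W \<oplus> B\<close> by an inflation and the required pushouts
  exist.\<close>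

lemma ore:
  assumes "is_ext C \<xi>' Y X'" "is_ext C \<xi> Y X" "mor C \<xi>' \<xi> (Ident C Y) b" "mor1 C Y X' \<xi>' \<eta>"
  obtains \<omega> where "mor1 C Y X \<xi> \<omega>" "mor C \<eta> \<omega> (Ident C Y) b"
  using assms
proof (induction "length \<xi>'" arbitrary: Y \<xi>' \<xi> \<eta> thesis)
  case 0
  then have "Y = X" "X' = X" "\<xi> = []" "\<eta> = []" "b = Ident C Y" by (auto simp: mor1_def)
  then show ?case using 0 by (auto simp: mor1_def)
next
  case (Suc n)
  obtain c' \<rho>' where \<xi>': "\<xi>' = c' # \<rho>'" using Suc.hyps(2) by (cases \<xi>') auto
  obtain c1 \<rho> f u where 1: "\<xi> = c1 # \<rho>" "cmor C c' c1 (Ident C Y) f u" "mor C \<rho>' \<rho> u b"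
    using mor_Cons Suc.prems(4) unfolding \<xi>' by metis
  have \<eta>ext: "is_ext C \<eta> Y X'" using Suc.prems(5) by (simp add: mor1_def)
  obtain c2 \<sigma> g w where 2: "\<eta> = c2 # \<sigma>" "cmor C c' c2 (Ident C Y) g w" "mor C \<rho>' \<sigma> w (Ident C X')"
    using mor_Cons Suc.prems(5) unfolding \<xi>' mor1_def by metis
  have c: "c' \<in> Confl C" "c1 \<in> Confl C" "c2 \<in> Confl C" "sub c' = Y" "sub c1 = Y" "sub c2 = Y"
    and ext: "is_ext C \<rho>' (quo c') X'" "is_ext C \<rho> (quo c1) X" "is_ext C \<sigma> (quo c2) X'"
    using Suc.prems(2,3) \<eta>ext unfolding \<xi>' 1 2 by auto
  note [simp] = c
  have Y: "Y \<in> Obj C" using is_ext_obj[OF Suc.prems(2)] by simp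
  note M1 = cmorD[OF 1(2) c(1,2)] and M2 = cmorD[OF 2(2) c(1,3)]
  note [simp] = Y
  show ?case
  proof (cases \<rho>')
    case Nil
    then have e: "\<rho> = []" "\<sigma> = []" "u = b" "w = Ident C X'" "quo c' = X'" "quo c2 = X'"
      using 1 2 ext by auto
    \<comment> \<open>With one conflation the map to \<open>\<eta>\<close> has identities at both
      ends and is invertible, so \<open>\<xi>\<close> itself serves as
      \<open>\<omega>\<close>.\<close>
    have "cmor C c' c2 (Ident C (sub c')) g (Ident C (quo c'))"
      using 2(2) e c by simp
    then obtain g' where g': "cmor C c2 c' (Ident C (sub c')) g' (Ident C (quo c'))"
      using cmor_id_invert[OF c(1,3)] by blast
    have "cmor C c2 c1 (Ident C Y) (f \<cdot> g') b"
      using cmor_comp[OF g' 1(2)] e M1(7,8) by simp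
    moreover have "b \<in> Arr C" using M1(7) e by simp
    ultimately have "mor C \<eta> \<xi> (Ident C Y) b" using 1 2 e by auto
    then show ?thesis using Suc.prems(1) mor1_refl[OF Suc.prems(3)] by blast
  next
    case (Cons d' \<rho>'')
    obtain d1 \<rho>1 where d1: "\<rho> = d1 # \<rho>1" using mor_Cons 1(3) Cons by metis
    obtain d2 \<sigma>1 where d2: "\<sigma> = d2 # \<sigma>1" using mor_Cons 2(3) Cons by metis
    have d: "d' \<in> Confl C" "d1 \<in> Confl C" "d2 \<in> Confl C"
      and D: "sub d' = quo c'" "sub d1 = quo c1" "sub d2 = quo c2"
      and ext': "is_ext C \<rho>'' (quo d') X'" "is_ext C \<rho>1 (quo d1) X" "is_ext C \<sigma>1 (quo d2) X'"
      using ext unfolding Cons d1 d2 by auto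
    note [simp] = d M1(7-9) M2(7-9)
    let ?W = "quo c2" and ?B = "mid d'"
    obtain S i1 i2 p1 p2 where S: "dsum C S ?W ?B i1 i2 p1 p2"
      using ex_direct_sum[of ?W ?B] unfolding is_direct_sum_iff by auto
    note DS = dsumD[OF S]
    note [simp] = DS(1-15)
    let ?\<psi> = "(i1 \<cdot> w) \<boxplus> (i2 \<cdot> fst d')"
    obtain e where e: "(?\<psi>, e) \<in> Confl C"
      by (rule dsum_inflation[OF S d(1) refl, of w]) (use D in \<open>auto intro!: HomI\<close>)
    obtain P p where P: "P \<in> Confl C" "sub P = Y" "quo P = S" "cmor C P c2 (Ident C Y) p p1"
      using pull_dsum[OF S c(3) refl] c(6) by metis
    note [simp] = P(1-3)
    have P4: "cmor C P c2 (Ident C (sub c2)) p p1" using P(4) by simp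
    have q1: "cmor C c2 c2 (Ident C Y) (Ident C (mid c2)) (p1 \<cdot> i1)"
      using cmor_id[OF c(3)] DS(16) by simp
    have q2: "i1 \<in> Hom C (quo c2) (quo P)" by (auto intro!: HomI)
    obtain j where j: "cmor C c2 P (Ident C Y) j i1"
      using cart[OF c(3) P(1) c(3) P4 q1 q2] by blast
    have "p1 \<cdot> ?\<psi> = w"
      using comp_eq1[OF DS(16), of w] comp_eq1[OF DS(19), of "fst d'"] D by simp
    then have q3: "cmor C c' c2 (Ident C Y) g (p1 \<cdot> ?\<psi>)" using 2(2) by simp
    have q4: "?\<psi> \<in> Hom C (quo c') (quo P)" using D by (auto intro!: HomI)
    obtain g1 where g1: "cmor C c' P (Ident C Y) g1 ?\<psi>"
      using cart[OF c(3) P(1) c(1) P4 q3 q4] by blast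
    obtain cG x y x' y' where G: "cG \<in> Confl C" "cmor C c1 cG (Ident C Y) x y" "cmor C P cG (Ident C Y) x' y'"
      "y \<cdot> u = y' \<cdot> ?\<psi>"
      using amalgamate[OF c(2,1) P(1) 1(2) g1 e c(5)] .
    note MG = cmorD[OF G(2) c(2) G(1)] and MP = cmorD[OF G(3) P(1) G(1)]
    note [simp] = G(1) MG(7-9) MP(7-9)
    let ?D = "quo cG"
    have LG: "sub cG = Y" using MG(3) by simp
    \<comment> \<open>From here on only the tails matter. They are pushed out to begin at
      \<open>?D\<close>, the quotient of \<open>cG\<close>, where they again form a span that fixes
      the left end and is shorter by one.\<close>
    obtain d1D h1 where d1D: "d1D \<in> Confl C" "sub d1D = ?D" "quo d1D = quo d1"
      "cmor C d1 d1D y h1 (Ident C (quo d1))"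
      by (rule push_confl[OF d(2), of y ?D]) (use D in \<open>auto intro!: HomI\<close>)
    obtain d2S h2 where d2S: "d2S \<in> Confl C" "sub d2S = S" "quo d2S = quo d2"
      "cmor C d2 d2S i1 h2 (Ident C (quo d2))"
      by (rule push_confl[OF d(3), of i1 S]) (use D in \<open>auto intro!: HomI\<close>)
    obtain d2D h3 where d2D: "d2D \<in> Confl C" "sub d2D = ?D" "quo d2D = quo d2S"
      "cmor C d2S d2D y' h3 (Ident C (quo d2S))"
      by (rule push_confl[OF d2S(1), of y' ?D]) (use d2S in \<open>auto intro!: HomI\<close>)
    obtain dD h4 where dD: "dD \<in> Confl C" "sub dD = ?D" "quo dD = quo d'"
      "cmor C d' dD (y \<cdot> u) h4 (Ident C (quo d'))"
      by (rule push_confl[OF d(1), of "y \<cdot> u" ?D]) (use D in \<open>auto intro!: HomI\<close>)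
    have X: "X \<in> Obj C" "X' \<in> Obj C" using ext is_ext_obj by auto
    note [simp] = X
    have E1: "is_ext C (d1D # \<rho>1) ?D X" and E2: "is_ext C (d2S # \<sigma>1) S X'" and E3: "is_ext C (d2D # \<sigma>1) ?D X'"
      and E4: "is_ext C (dD # \<rho>'') ?D X'"
      using ext' d1D d2S d2D dD by auto
    have b: "b \<in> Hom C X' X"
      by (rule mor_Hom[OF 1(3) ext(1,2)]) (auto intro!: HomI)
    have m1: "mor C \<rho> (d1D # \<rho>1) y (Ident C X)"
      using d1D(4) mor_id[OF ext'(2)] unfolding d1 by auto
    have m2: "mor C \<sigma> (d2S # \<sigma>1) i1 (Ident C X')"
      using d2S(4) mor_id[OF ext'(3)] unfolding d2 by auto
    have m3: "mor C (d2S # \<sigma>1) (d2D # \<sigma>1) y' (Ident C X')"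
      using d2D(4) d2S(3) mor_id[OF ext'(3)] by auto
    have uH: "u \<in> Hom C (quo c') (quo c1)" and yH: "y \<in> Hom C (quo c1) ?D"
      and wH: "w \<in> Hom C (quo c') ?W" and i1H: "i1 \<in> Hom C ?W S" and y'H: "y' \<in> Hom C S ?D"
      and \<psi>H: "?\<psi> \<in> Hom C (quo c') S" and IH: "Ident C ?D \<in> Hom C ?D ?D"
      using D by (auto intro!: HomI)
    have n1: "mor C \<rho>' (d1D # \<rho>1) (Ident C ?D \<cdot> (y \<cdot> u)) b"
      using mor_comp[OF 1(3) m1 ext(1,2) E1 uH yH] HomE[OF b] by simp
    have "mor C \<rho>' (d2S # \<sigma>1) (i1 \<cdot> w) (Ident C X')"
      using mor_comp[OF 2(3) m2 ext(1,3) E2 wH i1H] by simp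
    \<comment> \<open>\<open>?\<psi>\<close> differs from \<open>i1 \<cdot> w\<close> by
      \<open>i2 \<cdot> fst d'\<close>, which extends over \<open>?B\<close>: a homotopy that the
      right end does not see.\<close>
    then have n2: "mor C \<rho>' (d2S # \<sigma>1) ?\<psi> (Ident C X')"
      unfolding Cons by (rule mor_homotopy_left) (use d2S in \<open>auto intro!: HomI\<close>)
    have n3: "mor C \<rho>' (d2D # \<sigma>1) (Ident C ?D \<cdot> (y \<cdot> u)) (Ident C X')"
      using mor_comp[OF n2 m3 ext(1) E2 E3 \<psi>H y'H, folded G(4)] by simp
    have k1: "mor C (dD # \<rho>'') (d1D # \<rho>1) (Ident C ?D) b"
      by (rule mor_cocart[OF d(1) dD(1,4) n1[unfolded Cons] E1]) (use dD IH in auto)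
    have k2: "mor C (dD # \<rho>'') (d2D # \<sigma>1) (Ident C ?D) (Ident C X')"
      by (rule mor_cocart[OF d(1) dD(1,4) n3[unfolded Cons] E3]) (use dD IH in auto)
    obtain \<omega> where \<omega>: "mor1 C ?D X (d1D # \<rho>1) \<omega>" "mor C (d2D # \<sigma>1) \<omega> (Ident C ?D) b"
    proof (rule Suc.hyps(1)[of "dD # \<rho>''" ?D "d1D # \<rho>1" "d2D # \<sigma>1"])
      show "n = length (dD # \<rho>'')" using Suc.hyps(2) \<xi>' Cons by simp
      show "mor1 C ?D X' (dD # \<rho>'') (d2D # \<sigma>1)" using k2 E3 E4 by (simp add: mor1_def)
    qed (use k1 E1 E4 in auto)
    have \<omega>e: "is_ext C \<omega> ?D X" using \<omega>(1) by (simp add: mor1_def)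
    have "mor C \<rho> \<omega> y (Ident C X)" by (rule mor_mor1[OF m1 \<omega>(1) ext(2) yH])
    then have "mor1 C Y X \<xi> (cG # \<omega>)"
      using 1(1) G(2) Suc.prems(3) \<omega>e LG by (auto simp: mor1_def)
    moreover have "mor C \<eta> (cG # \<omega>) (Ident C Y) b"
    proof -
      have "mor C \<sigma> (d2D # \<sigma>1) (y' \<cdot> i1) (Ident C X')"
        using mor_comp[OF m2 m3 ext(3) E2 E3 i1H y'H] by simp
      then have "mor C \<sigma> \<omega> (y' \<cdot> i1) b"
        using mor_comp[OF _ \<omega>(2) ext(3) E3 \<omega>e _ IH, of "y' \<cdot> i1" "Ident C X'"] comp_in[OF i1H y'H] HomE[OF b] by simp
      moreover have "cmor C c2 cG (Ident C Y) (x' \<cdot> j) (y' \<cdot> i1)"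
        using cmor_comp[OF j G(3)] by simp
      ultimately show ?thesis using 2(1) by auto
    qed
    ultimately show ?thesis by (rule Suc.prems(1))
  qed
qed

text \<open>The zigzag is straightened step by step: a forward step is absorbed by completing a
  span, a backward step by composition.\<close>

lemma yeq_common:
  assumes "yeq C Y X \<xi> \<eta>" "is_ext C \<xi> Y X"
  obtains \<omega> where "mor1 C Y X \<xi> \<omega>" "mor1 C Y X \<eta> \<omega>"
proof -
  have "\<exists>\<omega>. mor1 C Y X \<xi> \<omega> \<and> mor1 C Y X \<eta> \<omega>"
    using assms(1) unfolding yeq_def
  proof (induction rule: equivclp_induct)
    case base
    then show ?case using mor1_refl[OF assms(2)] by blast
  next
    case (step \<eta> \<zeta>)
    then obtain \<omega> where \<omega>: "mor1 C Y X \<xi> \<omega>" "mor1 C Y X \<eta> \<omega>" by blast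
    from step(2) show ?case
    proof
      assume s: "mor1 C Y X \<eta> \<zeta>"
      then obtain \<theta> where "mor1 C Y X \<zeta> \<theta>" "mor C \<omega> \<theta> (Ident C Y) (Ident C X)"
        using ore[of \<eta> Y X \<zeta> X "Ident C X" \<omega>] \<omega>(2) unfolding mor1_def by blast
      then have "mor1 C Y X \<zeta> \<theta>" "mor1 C Y X \<omega> \<theta>" using \<omega> by (auto simp: mor1_def)
      then show ?thesis using \<omega>(1) mor1_trans by blast
    next
      assume "mor1 C Y X \<zeta> \<eta>"
      then show ?thesis using \<omega> mor1_trans by blast
    qed
  qed
  then show ?thesis using that by blast
qed

lemma splitlast_mor1:
  assumes "mor1 C Y X \<xi> \<eta>" "splitlast C \<xi>"
  shows "splitlast C \<eta>"
proof -
  obtain \<xi>0 c where x: "\<xi> = \<xi>0 @ [c]" using assms(2) unfolding splitlast_def by (cases \<xi> rule: rev_cases) auto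
  have m: "mor C (\<xi>0 @ [c]) \<eta> (Ident C Y) (Ident C X)" using assms(1) x by (simp add: mor1_def)
  obtain c' \<eta>0 h z where y: "\<eta> = \<eta>0 @ [c']" "cmor C c c' z h (Ident C X)"
    using mor_snoc[OF m] by metis
  have c: "c \<in> Confl C" "c' \<in> Confl C" "quo c = X" "quo c' = X"
    using assms(1) unfolding mor1_def x y(1) by (auto simp: is_ext_snoc)
  note M = cmorD[OF y(2) c(1,2)]
  note [simp] = M(4-6) c
  obtain s where s: "s \<in> Hom C X (mid c)" "snd c \<cdot> s = Ident C X"
    using assms(2) unfolding splitlast_def x by auto
  note [simp] = HomE[OF s(1)]
  have "snd c' \<cdot> (h \<cdot> s) = Ident C X" using M(13)[of s] s(2) by simp
  then show ?thesis unfolding splitlast_def y(1) by (auto intro!: bexI[of _ "h \<cdot> s"] HomI)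
qed

lemma effacedI:
  assumes "yeq C Y X \<xi> \<zeta>" "is_ext C \<xi> Y X" "splitlast C \<zeta>"
  shows "effaced C Y X \<xi>"
  using yeq_common[OF assms(1,2)] splitlast_mor1 assms(3) unfolding effaced_def by metis

section \<open>Trivial extensions\<close>

lemma terminal_ext:
  assumes "\<rho> \<noteq> []" "is_ext C \<rho> Z X" "is_zero_obj C Q"
  obtains \<tau> where "is_ext C \<tau> Q X" "splitlast C \<tau>" "mor C \<rho> \<tau> (ZeroArr C Z Q) (Ident C X)" "length \<tau> = length \<rho>"
proof -
  note z = zero_objE[OF assms(3)]
  have "\<exists>\<tau>. is_ext C \<tau> Q X \<and> splitlast C \<tau> \<and> mor C \<rho> \<tau> (ZeroArr C Z Q) (Ident C X) \<and> length \<tau> = length \<rho>"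
    using assms(1,2)
  proof (induction \<rho> arbitrary: Z)
    case (Cons c \<rho>)
    note [simp] = z(1)
    have c [simp]: "c \<in> Confl C" "sub c = Z" using Cons.prems by auto
    have Z [simp]: "Z \<in> Obj C" using is_ext_obj[OF Cons.prems(2)] by simp
    show ?case
    proof (cases "\<rho> = []")
      case True
      have X: "quo c = X" "X \<in> Obj C" using Cons.prems True by auto
      let ?c = "(ZeroArr C Q X, Ident C X)"
      have q: "?c \<in> Confl C" by (rule zero_confl_from[OF X(2) assms(3)])
      have "cmor C c ?c (ZeroArr C Z Q) (snd c) (Ident C X)"
        unfolding cmor_def using X by (auto intro!: HomI)
      moreover have "splitlast C [?c]"
        unfolding splitlast_def using X by (auto intro!: bexI[of _ "Ident C X"] HomI)
      ultimately show ?thesis using True X q by (intro exI[of _ "[?c]"]) auto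
    next
      case False
      obtain \<tau> where t: "is_ext C \<tau> Q X" "splitlast C \<tau>" "mor C \<rho> \<tau> (ZeroArr C (quo c) Q) (Ident C X)"
        "length \<tau> = length \<rho>"
        using Cons.IH[OF False, of "quo c"] Cons.prems by auto
      let ?c = "(Ident C Q, ZeroArr C Q Q)"
      have q: "?c \<in> Confl C" by (rule zero_confl_to[OF z(1) assms(3)])
      have "cmor C c ?c (ZeroArr C Z Q) (ZeroArr C (mid c) Q) (ZeroArr C (quo c) Q)"
        unfolding cmor_def by (auto intro!: HomI)
      moreover have "splitlast C (?c # \<tau>)" using t(2) by (auto simp: splitlast_def)
      ultimately show ?thesis using t q by (intro exI[of _ "?c # \<tau>"]) auto
    qed
  qed simp
  then show ?thesis using that by blast
qed

text \<open>In degree at least two the zero class is represented by \<open>Y = Y\<close>, then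
  zeros, then \<open>X = X\<close>. The morphism on the tail is the part of a map into it that
  exists for every \<open>\<rho>\<close>.\<close>

lemma ident_zero_ext:
  assumes "\<rho> \<noteq> []" "is_ext C \<rho> Z X" "Y \<in> Obj C"
  obtains Q \<tau> where "is_zero_obj C Q" "is_ext C ((Ident C Y, ZeroArr C Y Q) # \<tau>) Y X"
    "splitlast C ((Ident C Y, ZeroArr C Y Q) # \<tau>)" "mor C \<rho> \<tau> (ZeroArr C Z Q) (Ident C X)"
proof -
  obtain Q where Q: "is_zero_obj C Q" using ex_zero_obj by blast
  obtain \<tau> where t: "is_ext C \<tau> Q X" "splitlast C \<tau>" "mor C \<rho> \<tau> (ZeroArr C Z Q) (Ident C X)"
    using terminal_ext[OF assms(1,2) Q] by blast
  have "is_ext C ((Ident C Y, ZeroArr C Y Q) # \<tau>) Y X"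
    using zero_confl_to[OF assms(3) Q] t(1) assms(3) zero_objE[OF Q] by simp
  moreover have "splitlast C ((Ident C Y, ZeroArr C Y Q) # \<tau>)" using t(2) by (auto simp: splitlast_def)
  ultimately show ?thesis using that Q t(3) by blast
qed

text \<open>Vanishing only says that all extensions are equivalent; this provides a trivial one to
  compare with.\<close>

lemma splitlast_template:
  assumes "is_ext C \<xi> Y X" "\<xi> \<noteq> []"
  obtains \<zeta> where "is_ext C \<zeta> Y X" "splitlast C \<zeta>" "length \<zeta> = length \<xi>"
proof -
  obtain c \<rho> where x: "\<xi> = c # \<rho>" using assms(2) by (cases \<xi>) auto
  have o: "Y \<in> Obj C" "X \<in> Obj C" using is_ext_obj[OF assms(1)] by auto
  show ?thesis
  proof (cases "\<rho> = []")
    case True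
    obtain S i1 i2 p1 p2 where S: "dsum C S Y X i1 i2 p1 p2"
      using ex_direct_sum[OF o] unfolding is_direct_sum_iff by auto
    note D = dsumD[OF S]
    have "splitlast C [(i1, p2)]" unfolding splitlast_def using D by (auto intro!: bexI[of _ i2] HomI)
    then show ?thesis using that[of "[(i1, p2)]"] dsum_confl[OF S] D x True by auto
  next
    case False
    have r: "is_ext C \<rho> (quo c) X" using assms x by auto
    obtain Q \<tau> where "is_ext C ((Ident C Y, ZeroArr C Y Q) # \<tau>) Y X"
      "splitlast C ((Ident C Y, ZeroArr C Y Q) # \<tau>)" "mor C \<rho> \<tau> (ZeroArr C (quo c) Q) (Ident C X)"
      using ident_zero_ext[OF False r o(1)] by blast
    then show ?thesis using that[of "(Ident C Y, ZeroArr C Y Q) # \<tau>"] mor_length x by force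
  qed
qed

text \<open>The retraction is itself the middle component of a morphism into the trivial extension;
  in degree one it yields a section instead.\<close>

lemma splitfirst_effaced:
  assumes "is_ext C \<xi> Y X" "splitfirst C \<xi>"
  shows "effaced C Y X \<xi>"
proof -
  obtain c \<rho> where x: "\<xi> = c # \<rho>" using assms(2) unfolding splitfirst_def by (cases \<xi>) auto
  have c [simp]: "c \<in> Confl C" "sub c = Y" and r: "is_ext C \<rho> (quo c) X"
    using assms x by auto
  have Y [simp]: "Y \<in> Obj C" using is_ext_obj[OF assms(1)] by auto
  obtain q where q: "q \<in> Hom C (mid c) Y" "q \<cdot> fst c = Ident C Y"
    using assms(2) unfolding splitfirst_def x by auto
  note [simp] = HomE[OF q(1)]
  show ?thesis
  proof (cases "\<rho> = []")
    case True
    obtain s where s: "dsum C (mid c) Y (quo c) (fst c) s q (snd c)"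
      using split_dsum_retract[of c q] q by auto
    note D = dsumD[OF s]
    have "splitlast C \<xi>" unfolding splitlast_def x True using D by (auto intro!: bexI[of _ s] HomI)
    then show ?thesis unfolding effaced_def using mor1_refl[OF assms(1)] by blast
  next
    case False
    obtain Q \<tau> where t: "is_zero_obj C Q" "is_ext C ((Ident C Y, ZeroArr C Y Q) # \<tau>) Y X"
      "splitlast C ((Ident C Y, ZeroArr C Y Q) # \<tau>)" "mor C \<rho> \<tau> (ZeroArr C (quo c) Q) (Ident C X)"
      using ident_zero_ext[OF False r Y] by blast
    note [simp] = zero_objE(1)[OF t(1)]
    have "cmor C c (Ident C Y, ZeroArr C Y Q) (Ident C Y) q (ZeroArr C (quo c) Q)"
      unfolding cmor_def using q by (auto intro!: HomI)
    then have "mor1 C Y X \<xi> ((Ident C Y, ZeroArr C Y Q) # \<tau>)"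
      unfolding mor1_def using t(2,4) assms(1) x by auto
    then show ?thesis unfolding effaced_def using t(3) by blast
  qed
qed

section \<open>Dimension shifting\<close>

definition ext_vanishes :: "nat \<Rightarrow> 'o \<Rightarrow> 'o \<Rightarrow> bool" where
  "ext_vanishes n X Y \<longleftrightarrow> (\<forall>\<xi> \<xi>'. is_ext C \<xi> Y X \<and> is_ext C \<xi>' Y X \<and> length \<xi> = n \<and> length \<xi>' = n \<longrightarrow> yeq C Y X \<xi> \<xi>')"

lemma ext_vanishes_effaced:
  assumes "ext_vanishes (length \<xi>) X Y" "is_ext C \<xi> Y X" "\<xi> \<noteq> []"
  shows "effaced C Y X \<xi>"
proof -
  obtain \<zeta> where "is_ext C \<zeta> Y X" "splitlast C \<zeta>" "length \<zeta> = length \<xi>"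
    using splitlast_template[OF assms(2,3)] .
  then show ?thesis using effacedI[of Y X \<xi> \<zeta>] assms unfolding ext_vanishes_def by auto
qed

text \<open>Exactness of \<open>Ext^n(mid c, Y) \<rightarrow> Ext^n(sub c, Y) \<rightarrow>
  Ext^(n+1)(X, Y)\<close> in the middle: if the splice with \<open>c\<close> is trivial, then
  \<open>\<xi>\<close> comes by pullback along \<open>fst c\<close> from an extension of
  \<open>mid c\<close>, and \<open>H\<close> trivialises that one.\<close>

lemma effaced_shift:
  assumes "is_ext C (\<xi> @ [c]) Y X" "\<xi> \<noteq> []" "effaced C Y X (\<xi> @ [c])"
    and H: "\<And>\<eta>. is_ext C \<eta> Y (mid c) \<Longrightarrow> length \<eta> = length \<xi> \<Longrightarrow> effaced C Y (mid c) \<eta>"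
  shows "effaced C Y (sub c) \<xi>"
proof -
  have x: "is_ext C \<xi> Y (sub c)" and c: "c \<in> Confl C" "quo c = X"
    using assms(1) by (auto simp: is_ext_snoc)
  have Y: "Y \<in> Obj C" using is_ext_obj[OF x] by auto
  obtain \<omega> where w: "splitlast C \<omega>" "mor1 C Y X (\<xi> @ [c]) \<omega>" using assms(3) unfolding effaced_def by blast
  have m: "mor C (\<xi> @ [c]) \<omega> (Ident C Y) (Ident C X)" using w(2) by (simp add: mor1_def)
  obtain k \<omega>1 h z where k: "\<omega> = \<omega>1 @ [k]" "mor C \<xi> \<omega>1 (Ident C Y) z" "cmor C c k z h (Ident C X)" "length \<xi> = length \<omega>1"
    using mor_snoc[OF m] .
  have w1: "is_ext C \<omega>1 Y (sub k)" and kc: "k \<in> Confl C" "quo k = X"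
    using w(2) unfolding mor1_def k(1) by (auto simp: is_ext_snoc)
  note M = cmorD[OF k(3) c(1) kc(1)]
  note [simp] = c kc M(1-6) Y
  obtain s where "s \<in> Hom C X (mid k)" "snd k \<cdot> s = Ident C X"
    using w(1) unfolding splitlast_def k(1) by auto
  then obtain r where r: "dsum C (mid k) (sub k) X (fst k) s r (snd k)"
    using split_dsum[of k s] by auto
  note R = dsumD[OF r]
  note [simp] = R(7-9)
  \<comment> \<open>Since \<open>k\<close> splits, the map \<open>z\<close> on cycles extends to
    \<open>?t\<close> on \<open>mid c\<close>. Pulling \<open>\<omega>1\<close> back along
    \<open>?t\<close> gives the extension of \<open>mid c\<close> from which \<open>\<xi>\<close>
    comes.\<close>
  let ?V = "mid c" and ?t = "r \<cdot> h"
  have t: "?t \<cdot> fst c = z" using M(10) comp_eq1[OF R(16), of z] by simp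
  obtain \<omega>2 l where l: "\<omega>1 = \<omega>2 @ [l]" using assms(2) k(4) by (cases \<omega>1 rule: rev_cases) auto
  have lc: "l \<in> Confl C" "quo l = sub k" and w2: "is_ext C \<omega>2 Y (sub l)"
    using w1 unfolding l by (auto simp: is_ext_snoc)
  obtain l' f where l': "l' \<in> Confl C" "quo l' = ?V" "sub l' = sub l"
    "cmor C l' l (Ident C (sub l)) f ?t"
    by (rule pull_confl[OF lc(1), of ?t ?V]) (use lc in \<open>auto intro!: HomI\<close>)
  have e1: "is_ext C (\<omega>2 @ [l']) Y ?V" using w2 l' by (simp add: is_ext_snoc)
  have "effaced C Y ?V (\<omega>2 @ [l'])" by (rule H[OF e1]) (use k(4) l in simp)
  then obtain \<theta> where th: "splitlast C \<theta>" "mor1 C Y ?V (\<omega>2 @ [l']) \<theta>" unfolding effaced_def by blast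
  obtain \<theta>1 q where q: "\<theta> = \<theta>1 @ [q]" using th(1) unfolding splitlast_def by (cases \<theta> rule: rev_cases) auto
  have te: "is_ext C \<theta> Y ?V" using th(2) by (simp add: mor1_def)
  have qc: "q \<in> Confl C" "quo q = ?V" and t1: "is_ext C \<theta>1 Y (sub q)"
    using te unfolding q by (auto simp: is_ext_snoc)
  obtain q' g where q': "q' \<in> Confl C" "quo q' = sub c" "sub q' = sub q"
    "cmor C q' q (Ident C (sub q)) g (fst c)"
    by (rule pull_confl[OF qc(1), of "fst c" "sub c"]) (use qc in \<open>auto intro!: HomI\<close>)
  note [simp] = lc l'(1-3) qc q'(1-3)
  have e2: "is_ext C (\<theta>1 @ [q']) Y (sub c)" using t1 by (simp add: is_ext_snoc)
  obtain s' where s': "s' \<in> Hom C ?V (mid q)" "snd q \<cdot> s' = Ident C ?V"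
    using th(1) unfolding splitlast_def q by auto
  note [simp] = HomE[OF s'(1)]
  \<comment> \<open>\<open>s' \<cdot> fst c\<close> and the identity agree over
    \<open>mid c\<close>, so together they define a section of the pulled-back deflation.\<close>
  obtain s'' where s'': "s'' \<in> Hom C (sub c) (mid q')" "snd q' \<cdot> s'' = Ident C (sub c)"
    by (rule pullback_univ[OF qc(1) q'(1,4), of "s' \<cdot> fst c" "sub c" "Ident C (sub c)"])
      (use comp_eq1[OF s'(2), of "fst c"] in \<open>auto intro!: HomI\<close>)
  have sl: "splitlast C (\<theta>1 @ [q'])" unfolding splitlast_def using s'' by auto
  have cH: "fst c \<in> Hom C (sub c) (quo l')" by (auto intro!: HomI)
  have "mor C \<xi> (\<omega>2 @ [l']) (Ident C Y) (fst c)"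
    by (rule mor_cart[OF w1[unfolded l] l'(1,4) _ x cH]) (use k(2) l t in simp)
  then have "mor C \<xi> \<theta> (Ident C Y) (fst c)" by (rule mor_mor1[OF _ th(2) x ident_in[OF Y]])
  then have "mor C \<xi> (\<theta>1 @ [q']) (Ident C Y) (Ident C (sub c))"
    by (intro mor_cart[OF te[unfolded q] q'(1,4) _ x]) (auto simp: q intro!: HomI)
  then have "mor1 C Y (sub c) \<xi> (\<theta>1 @ [q'])" using x e2 by (simp add: mor1_def)
  then show ?thesis using sl unfolding effaced_def by blast
qed

text \<open>Shifting removes the conflations of \<open>\<rho>\<close> from the right one at a time,
  until only \<open>c\<close> is left, and a trivial extension of length one splits. The extension
  of \<open>mid e\<close> met on the way is as long as the part to the left of \<open>e\<close>,
  including \<open>c\<close>; hence the bound on \<open>length \<eta>\<close>.\<close>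

lemma effaced_splitfirst:
  assumes "is_ext C (c # \<rho>) Y X" "effaced C Y X (c # \<rho>)"
    and "\<And>e \<eta>. e \<in> set \<rho> \<Longrightarrow> is_ext C \<eta> Y (mid e) \<Longrightarrow> \<eta> \<noteq> [] \<Longrightarrow> length \<eta> \<le> length \<rho> \<Longrightarrow>
      effaced C Y (mid e) \<eta>"
  obtains r where "r \<in> Hom C (mid c) Y" "r \<cdot> fst c = Ident C Y"
  using assms
proof (induction \<rho> arbitrary: X thesis rule: rev_induct)
  case Nil
  have c: "c \<in> Confl C" "sub c = Y" "quo c = X" using Nil by auto
  have Y: "Y \<in> Obj C" using c by auto
  obtain \<omega> where w: "splitlast C \<omega>" "mor1 C Y X [c] \<omega>" using Nil(3) unfolding effaced_def by blast
  have "length \<omega> = 1" using w(2) mor_length unfolding mor1_def by fastforce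
  then obtain k where k: "\<omega> = [k]" by (cases \<omega>) auto
  obtain h where h: "cmor C c k (Ident C Y) h (Ident C X)" using w(2) unfolding mor1_def k by auto
  have kc: "k \<in> Confl C" "sub k = Y" "quo k = X" using w(2) unfolding mor1_def k by auto
  note M = cmorD[OF h c(1) kc(1)]
  note [simp] = c kc M(4-6) Y
  obtain s where "s \<in> Hom C X (mid k)" "snd k \<cdot> s = Ident C X"
    using w(1) unfolding splitlast_def k(1) by auto
  then obtain r where r: "dsum C (mid k) Y X (fst k) s r (snd k)"
    using split_dsum[of k s] by auto
  note R = dsumD[OF r]
  note [simp] = R(7-9)
  have "(r \<cdot> h) \<cdot> fst c = Ident C Y" using M(10) R(16) by simp
  then show ?case by (intro Nil(1)[of "r \<cdot> h"]) (auto intro!: HomI)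
next
  case (snoc e \<rho>)
  have ef: "effaced C Y (sub e) (c # \<rho>)"
  proof (rule effaced_shift[of "c # \<rho>" e Y X])
    show "effaced C Y (mid e) \<eta>" if "is_ext C \<eta> Y (mid e)" "length \<eta> = length (c # \<rho>)" for \<eta>
      by (rule snoc.prems(4)[OF _ that(1)]) (use that in auto)
  qed (use snoc.prems in auto)
  have ex: "is_ext C (c # \<rho>) Y (sub e)"
    using snoc.prems(2) is_ext_snoc[of "c # \<rho>" e Y X] by auto
  show ?case
  proof (rule snoc.IH[OF snoc.prems(1) ex ef])
    show "effaced C Y (mid e') \<eta>"
      if "e' \<in> set \<rho>" "is_ext C \<eta> Y (mid e')" "\<eta> \<noteq> []" "length \<eta> \<le> length \<rho>" for e' \<eta>
      by (rule snoc.prems(4)[OF _ that(2,3)]) (use that in auto)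
  qed
qed

lemma yeq_splitlast_retraction:
  assumes "is_ext C (c # \<rho>) Y X" "yeq C Y X (c # \<rho>) \<zeta>" "splitlast C \<zeta>"
    and "\<And>e n. e \<in> set \<rho> \<Longrightarrow> 0 < n \<Longrightarrow> n \<le> length \<rho> \<Longrightarrow> ext_vanishes n (mid e) Y"
  obtains r where "r \<in> Hom C (mid c) Y" "r \<cdot> fst c = Ident C Y"
  by (rule effaced_splitfirst[OF assms(1) effacedI[OF assms(2,1,3)]])
    (use assms(4) ext_vanishes_effaced that in \<open>auto simp: Suc_le_eq\<close>)

end

section \<open>Duality for extensions\<close>

definition flip :: "('m \<times> 'm) list \<Rightarrow> ('m \<times> 'm) list" where
  "flip \<xi> = rev (map prod.swap \<xi>)"

lemma flip_simps [simp]: "flip [] = []" "flip (c # \<xi>) = flip \<xi> @ [prod.swap c]"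
  "flip (\<xi> @ [c]) = prod.swap c # flip \<xi>" "length (flip \<xi>) = length \<xi>" "set (flip \<xi>) = prod.swap ` set \<xi>"
  by (simp_all add: flip_def)

lemma flip_flip [simp]: "flip (flip \<xi>) = \<xi>"
  by (simp add: flip_def rev_map[symmetric] o_def)

context exact_category
begin

lemma is_ext_flip: "is_ext (opc C) (flip \<xi>) X Y \<longleftrightarrow> is_ext C \<xi> Y X"
proof -
  interpret D: exact_category "opc C" by (rule exact_category_opc)
  show ?thesis by (induction \<xi> arbitrary: Y) (auto simp: D.is_ext_snoc)
qed

lemma mor_flip:
  assumes "mor C \<xi> \<xi>' a b" "is_ext C \<xi> Y X" "is_ext C \<xi>' Y' X'"
  shows "mor (opc C) (flip \<xi>') (flip \<xi>) b a"
proof -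
  interpret D: exact_category "opc C" by (rule exact_category_opc)
  show ?thesis using assms
  proof (induction \<xi> arbitrary: Y Y' \<xi>' a)
    case (Cons c \<xi>)
    obtain c' \<zeta> h z where c': "\<xi>' = c' # \<zeta>" "cmor C c c' a h z" "mor C \<xi> \<zeta> z b"
      using mor_Cons[OF Cons.prems(1)] .
    have "mor (opc C) (flip \<zeta>) (flip \<xi>) b z"
      using Cons.IH[OF c'(3)] Cons.prems c'(1) by auto
    moreover have "cmor (opc C) (prod.swap c') (prod.swap c) z h a"
      using c' Cons.prems by (simp add: cmor_opc)
    ultimately show ?case unfolding c'(1) using D.mor_snocI by simp
  qed auto
qed

text \<open>Flipping reverses every morphism, which the symmetric closure does not notice.\<close>

lemma yeq_flip:
  assumes "yeq C Y X \<xi> \<xi>'"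
  shows "yeq (opc C) X Y (flip \<xi>) (flip \<xi>')"
proof -
  have m: "mor1 (opc C) X Y (flip \<zeta>') (flip \<zeta>)" if "mor1 C Y X \<zeta> \<zeta>'" for \<zeta> \<zeta>'
    using that mor_flip unfolding mor1_def by (auto simp: is_ext_flip)
  show ?thesis
    using assms unfolding yeq_def
  proof (induction rule: equivclp_induct)
    case (step \<eta> \<zeta>)
    from step(2) have "equivclp (mor1 (opc C) X Y) (flip \<eta>) (flip \<zeta>)"
      using m by (auto intro: r_into_equivclp converse_r_into_equivclp)
    with step(3) show ?case by (rule equivclp_trans)
  qed simp
qed

lemma splitlast_flip:
  assumes "splitfirst C \<xi>" "is_ext C \<xi> Y X"
  shows "splitlast (opc C) (flip \<xi>)"
  using assms by (cases \<xi>) (auto simp: splitfirst_def splitlast_def)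

lemma ext_vanishes_opc:
  assumes "ext_vanishes n X Y"
  shows "exact_category.ext_vanishes (opc C) n Y X"
proof -
  interpret D: exact_category "opc C" by (rule exact_category_opc)
  show ?thesis
    unfolding D.ext_vanishes_def
  proof (intro allI impI, elim conjE)
    fix \<xi> \<xi>' assume "is_ext (opc C) \<xi> X Y" "is_ext (opc C) \<xi>' X Y" "length \<xi> = n" "length \<xi>' = n"
    then have "yeq C Y X (flip \<xi>) (flip \<xi>')"
      using assms is_ext_flip[of "flip \<xi>" X Y] is_ext_flip[of "flip \<xi>'" X Y] unfolding ext_vanishes_def by simp
    from yeq_flip[OF this] show "yeq (opc C) X Y \<xi> \<xi>'" by simp
  qed
qed

text \<open>The mirror image of \<open>yeq_splitlast_retraction\<close>: the last deflation becomes
  the first inflation of the opposite category, and the vanishing now concerns Ext from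
  \<open>X\<close> into the middle terms.\<close>

lemma yeq_splitfirst_section:
  assumes "is_ext C (\<rho> @ [c]) Y X" "yeq C Y X (\<rho> @ [c]) \<zeta>" "splitfirst C \<zeta>" "is_ext C \<zeta> Y X"
    and "\<And>e n. e \<in> set \<rho> \<Longrightarrow> 0 < n \<Longrightarrow> n \<le> length \<rho> \<Longrightarrow> ext_vanishes n X (mid e)"
  obtains s where "s \<in> Hom C X (mid c)" "snd c \<cdot> s = Ident C X"
proof -
  interpret D: exact_category "opc C" by (rule exact_category_opc)
  have c: "c \<in> Confl C" and e: "\<And>e. e \<in> set \<rho> \<Longrightarrow> e \<in> Confl C"
  proof -
    show "c \<in> Confl C" using assms(1) by (simp add: is_ext_snoc)
    have "is_ext C \<rho> Y Z \<Longrightarrow> e \<in> set \<rho> \<Longrightarrow> e \<in> Confl C" for Z e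
      by (induction \<rho> arbitrary: Y) auto
    then show "\<And>e. e \<in> set \<rho> \<Longrightarrow> e \<in> Confl C" using assms(1) by (auto simp: is_ext_snoc)
  qed
  note result = that
  show ?thesis
  proof (rule D.yeq_splitlast_retraction[of "prod.swap c" "flip \<rho>" X Y "flip \<zeta>"])
    show "is_ext (opc C) (prod.swap c # flip \<rho>) X Y" using is_ext_flip[of "\<rho> @ [c]" X Y] assms(1) by simp
    show "yeq (opc C) X Y (prod.swap c # flip \<rho>) (flip \<zeta>)" using yeq_flip[OF assms(2)] by simp
    show "splitlast (opc C) (flip \<zeta>)" by (rule splitlast_flip[OF assms(3,4)])
    show "D.ext_vanishes n (Cod (opc C) (fst e')) X" if t: "e' \<in> set (flip \<rho>)" "0 < n" "n \<le> length (flip \<rho>)" for e' n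
    proof -
      obtain e0 where e0: "e' = prod.swap e0" "e0 \<in> set \<rho>"
        using t(1) unfolding flip_simps by blast
      have "D.ext_vanishes n (mid e0) X"
        by (rule ext_vanishes_opc[OF assms(5)]) (use t e0 in auto)
      then show ?thesis using e[OF e0(2)] e0(1) by simp
    qed
    show thesis if "r \<in> Hom (opc C) (Cod (opc C) (fst (prod.swap c))) X" "r \<cdot>\<^bsub>opc C\<^esub> fst (prod.swap c) = Ident (opc C) X" for r
      using that c by (intro result[of r]) auto
  qed
qed

lemma is_ext_confl: "is_ext C \<rho> Y X \<Longrightarrow> e \<in> set \<rho> \<Longrightarrow> e \<in> Confl C"
  by (induction \<rho> arbitrary: Y) auto

end

section \<open>Coresolutions by a rigid subcategory\<close>

text \<open>At level \<open>n + 1\<close> only \<open>n\<close> conflations carry information,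
  because the last inflation has zero cokernel and is invertible; this is the shift by one in
  \<open>ext_cores\<close> and \<open>cores_ext\<close>.\<close>

primrec cores :: "('o, 'm, 'x) preexact_cat_scheme \<Rightarrow> 'o set \<Rightarrow> nat \<Rightarrow> 'o set" where
  "cores C U 0 = {Z. is_zero_obj C Z}"
| "cores C U (Suc n) = {E. \<exists>c \<in> Confl C. Dom C (fst c) = E \<and> Cod C (fst c) \<in> U \<and> Cod C (snd c) \<in> cores C U n}"

abbreviation mids_in :: "('o, 'm, 'x) preexact_cat_scheme \<Rightarrow> 'o set \<Rightarrow> ('m \<times> 'm) list \<Rightarrow> bool" where
  "mids_in C U \<xi> \<equiv> \<forall>e \<in> set \<xi>. Cod C (fst e) \<in> U"

text \<open>Rigidity is assumed for lists of conflations, which keeps this part independent of how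
  exact sequences are encoded; \<open>rigid_ext_vanishes\<close> supplies the assumption.\<close>

locale rigid_subcategory = exact_category C for C :: "('o, 'm, 'x) preexact_cat_scheme" (structure) +
  fixes U :: "'o set" and d :: nat
  assumes additive_U: "additive_subcategory C U"
    and vanishes: "X \<in> U \<Longrightarrow> Y \<in> U \<Longrightarrow> 0 < n \<Longrightarrow> n < d \<Longrightarrow> ext_vanishes n X Y"
begin

section \<open>Coresolved objects and vanishing of Ext into the subcategory\<close>

lemma U_obj [simp]: "X \<in> U \<Longrightarrow> X \<in> Obj C"
  using additive_U by (auto simp: additive_subcategory_def)

lemma iso_U: "is_iso C f \<Longrightarrow> Dom C f \<in> U \<Longrightarrow> Cod C f \<in> U"
  using additive_U unfolding additive_subcategory_def by blast

lemma zero_U: "is_zero_obj C Z \<Longrightarrow> Z \<in> U"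
  using additive_U unfolding additive_subcategory_def by blast

lemma dsum_U: "is_direct_sum C S X Y \<Longrightarrow> X \<in> U \<Longrightarrow> Y \<in> U \<Longrightarrow> S \<in> U"
  using additive_U unfolding additive_subcategory_def by blast

lemma cores_SucI:
  "c \<in> Confl C \<Longrightarrow> sub c = E \<Longrightarrow> mid c \<in> U \<Longrightarrow> quo c \<in> cores C U n \<Longrightarrow> E \<in> cores C U (Suc n)"
  by auto

lemma zero_cores: "is_zero_obj C Z \<Longrightarrow> Z \<in> cores C U n"
proof (induction n)
  case (Suc n)
  note z = zero_objE[OF Suc.prems]
  show ?case
    by (rule cores_SucI[OF zero_confl_to[OF z(1) Suc.prems]]) (use z Suc zero_U in auto)
qed simp

lemma U_cores: "E \<in> U \<Longrightarrow> E \<in> cores C U (Suc n)"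
proof -
  assume E: "E \<in> U"
  obtain Z where Z: "is_zero_obj C Z" using ex_zero_obj by blast
  show ?thesis
    by (rule cores_SucI[OF zero_confl_to[of E Z]]) (use E Z zero_cores zero_objE in auto)
qed

lemma cores_one: "E \<in> cores C U (Suc 0) \<Longrightarrow> E \<in> U"
proof -
  assume "E \<in> cores C U (Suc 0)"
  then obtain c where c: "c \<in> Confl C" "sub c = E" "mid c \<in> U" "is_zero_obj C (quo c)"
    by auto
  let ?V = "mid c"
  have V: "?V \<in> Obj C" using c by simp
  have "snd c \<cdot> Ident C ?V = ZeroArr C (Dom C (Ident C ?V)) (quo c)"
    using zero_obj_Hom(1)[OF c(4) V, of "snd c"] c V by (auto simp: Hom_def)
  then obtain s where s: "s \<in> Arr C" "Dom C s = ?V" "Cod C s = E" "fst c \<cdot> s = Ident C ?V"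
    using confl_factor[OF c(1), of "Ident C ?V"] V c(2) by auto
  have E: "E \<in> Obj C" using s by auto
  have "s \<cdot> fst c = Ident C E"
    by (rule confl_mono[OF c(1)]) (use s c E comp_eq1[OF s(4), of "fst c"] in auto)
  then have "is_iso C s" by (intro isoI[of s ?V E "fst c"]) (use s c in \<open>auto intro!: HomI\<close>)
  then show "E \<in> U" using iso_U[of s] s c by simp
qed

lemma ext_cores: "is_ext C \<rho> A X \<Longrightarrow> mids_in C U \<rho> \<Longrightarrow> X \<in> U \<Longrightarrow> A \<in> cores C U (Suc (length \<rho>))"
proof (induction \<rho> arbitrary: A)
  case Nil
  then show ?case using U_cores[of A 0] by simp
next
  case (Cons c \<rho>)
  then show ?case by (intro cores_SucI[of c]) (auto simp del: cores.simps)
qed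

lemma cores_ext:
  "A \<in> cores C U (Suc n) \<Longrightarrow> \<exists>\<rho> X. is_ext C \<rho> A X \<and> mids_in C U \<rho> \<and> X \<in> U \<and> length \<rho> = n"
proof (induction n arbitrary: A)
  case 0
  then show ?case using cores_one[OF 0] by (intro exI[of _ "[]"] exI[of _ A]) auto
next
  case (Suc n)
  obtain c where c: "c \<in> Confl C" "sub c = A" "mid c \<in> U" "quo c \<in> cores C U (Suc n)"
    using Suc.prems by (auto simp del: cores.simps simp: cores.simps(2)[of C U "Suc n"])
  obtain \<rho> X where "is_ext C \<rho> (quo c) X" "mids_in C U \<rho>" "X \<in> U" "length \<rho> = n"
    using Suc.IH[OF c(4)] by blast
  with c show ?case by (intro exI[of _ "c # \<rho>"] exI[of _ X]) auto
qed

text \<open>Each conflation of the coresolution trades one level for one degree: the object moves to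
  \<open>quo c\<close> while \<open>\<xi>\<close> grows by \<open>c\<close>. The sum
  \<open>length \<xi> + n\<close> is invariant, which keeps the degrees in which
  \<open>vanishes\<close> is applied below \<open>d\<close>.\<close>

lemma cores_effaced:
  assumes "Y \<in> U" "X \<in> cores C U n" "is_ext C \<xi> Y X" "\<xi> \<noteq> []" "length \<xi> + n \<le> d"
  shows "effaced C Y X \<xi>"
  using assms
proof (induction n arbitrary: X \<xi>)
  case 0
  then have z: "is_zero_obj C X" by simp
  obtain \<xi>0 c where x: "\<xi> = \<xi>0 @ [c]" using 0 by (cases \<xi> rule: rev_cases) auto
  have c: "c \<in> Confl C" "quo c = X" using 0 unfolding x by (auto simp: is_ext_snoc)
  note zo = zero_objE[OF z]
  have "splitlast C \<xi>"
    unfolding splitlast_def x using c zo by (auto intro!: bexI[of _ "ZeroArr C X (mid c)"] HomI)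
  then show ?case unfolding effaced_def using mor1_refl[OF 0(3)] by blast
next
  case (Suc n)
  obtain c where c: "c \<in> Confl C" "sub c = X" "mid c \<in> U" "quo c \<in> cores C U n"
    using Suc.prems by auto
  have e: "is_ext C (\<xi> @ [c]) Y (quo c)" using Suc.prems c by (simp add: is_ext_snoc)
  have "effaced C Y (sub c) \<xi>"
  proof (rule effaced_shift[OF e Suc.prems(4)])
    show "effaced C Y (quo c) (\<xi> @ [c])"
      by (rule Suc.IH[OF Suc.prems(1) c(4) e]) (use Suc.prems in auto)
    show "effaced C Y (mid c) \<eta>" if "is_ext C \<eta> Y (mid c)" "length \<eta> = length \<xi>" for \<eta>
      by (rule ext_vanishes_effaced[OF vanishes that(1)]) (use that Suc.prems c in auto)
  qed
  then show ?case using c by simp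
qed

section \<open>Closure under extensions below level \<open>d\<close>\<close>

lemma cores_split:
  assumes "c \<in> Confl C" "sub c \<in> U" "quo c \<in> cores C U n" "n < d"
  obtains r where "r \<in> Hom C (mid c) (sub c)" "r \<cdot> fst c = Ident C (sub c)"
proof -
  have e: "is_ext C [c] (sub c) (quo c)" using assms by simp
  have "effaced C (sub c) (quo c) [c]"
    by (rule cores_effaced[OF assms(2,3) e]) (use assms(4) in auto)
  then show ?thesis using effaced_splitfirst[OF e] that by auto
qed

text \<open>\<open>h\<close> embeds \<open>mid c\<close> into \<open>mid c1\<close> with cokernel
  \<open>quo k\<close>. Followed by an embedding of \<open>mid c1\<close> into \<open>U\<close>, its
  cokernel becomes an extension of two objects one level down, where \<open>H\<close> applies. This
  reduces closure to conflations whose left end lies in \<open>U\<close>.\<close>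

lemma cores_extension_step:
  assumes c: "c \<in> Confl C" "k \<in> Confl C" "mid k \<in> U" "quo k \<in> cores C U n"
    and c1: "c1 \<in> Confl C" "cmor C c c1 (fst k) h (Ident C (quo c))" "mid c1 \<in> cores C U (Suc n)"
    and H: "\<And>c. c \<in> Confl C \<Longrightarrow> sub c \<in> cores C U n \<Longrightarrow> quo c \<in> cores C U n \<Longrightarrow> mid c \<in> cores C U n"
  shows "mid c \<in> cores C U (Suc n)"
proof -
  have k: "(fst k, snd k) \<in> Confl C" using c by simp
  obtain e where e: "(h, e) \<in> Confl C" "Cod C e = quo k"
    using pushout_inflation[OF c(1) c1(1) k c1(2)] .
  note M = cmorD[OF c1(2) c(1) c1(1)]
  obtain m where m: "m \<in> Confl C" "sub m = mid c1" "mid m \<in> U" "quo m \<in> cores C U n"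
    using c1(3) by auto
  have "sub m = Cod C h" using m(2) M(6) by simp
  then obtain q g where q: "q \<in> Confl C" "sub q = Cod C e" "quo q = quo m"
    "(fst m \<cdot> h, g) \<in> Confl C" "Cod C g = mid q"
    using noether[OF e(1) m(1)] by metis
  have "mid q \<in> cores C U n" by (rule H) (use q(1,2,3) e(2) m(4) c(4) in simp_all)
  then show ?thesis by (intro cores_SucI[OF q(4)]) (use M(4-6) m(1-3) q(5) \<open>mid q \<in> cores C U n\<close> in simp_all)
qed

text \<open>A horseshoe argument: once the left end is in \<open>U\<close>, the conflation splits
  because \<open>Ext^1\<close> vanishes, and the embedding of \<open>quo c\<close> into
  \<open>mid l\<close> can be completed by the summand \<open>mid k\<close>.\<close>

lemma cores_extension_closed:
  assumes "n < d" "c \<in> Confl C" "sub c \<in> cores C U n" "quo c \<in> cores C U n"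
  shows "mid c \<in> cores C U n"
  using assms
proof (induction n arbitrary: c)
  case 0
  let ?E = "mid c"
  have c: "c \<in> Confl C" "is_zero_obj C (sub c)" "is_zero_obj C (quo c)" using 0 by auto
  have E: "?E \<in> Obj C" using c by simp
  have "snd c \<cdot> Ident C ?E = ZeroArr C (Dom C (Ident C ?E)) (quo c)"
    using zero_obj_Hom(1)[OF c(3) E, of "snd c"] c E by (auto simp: Hom_def)
  then obtain s where s: "s \<in> Arr C" "Dom C s = ?E" "Cod C s = sub c" "fst c \<cdot> s = Ident C ?E"
    using confl_factor[OF c(1), of "Ident C ?E"] E by auto
  have "s = ZeroArr C ?E (sub c)"
    using zero_obj_Hom(1)[OF c(2) E, of s] s by (auto simp: Hom_def)
  then have "Ident C ?E = ZeroArr C ?E ?E" using s(4) c(1) E by simp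
  then show ?case using zero_objI[OF E] by simp
next
  case (Suc n)
  have d1: "Suc 0 < d" "n < d" using Suc.prems by auto
  note c = Suc.prems(2)
  obtain k where k: "k \<in> Confl C" "sub k = sub c" "mid k \<in> U" "quo k \<in> cores C U n"
    using Suc.prems(3) by auto
  obtain l where l: "l \<in> Confl C" "sub l = quo c" "mid l \<in> U" "quo l \<in> cores C U n"
    using Suc.prems(4) by auto
  obtain c1 h where c1: "c1 \<in> Confl C" "sub c1 = mid k" "quo c1 = quo c"
    "cmor C c c1 (fst k) h (Ident C (quo c))"
    by (rule push_confl[OF c, of "fst k" "mid k"]) (use k in \<open>auto intro!: HomI\<close>)
  have c1d: "sub c1 \<in> U" "quo c1 \<in> cores C U (Suc n)" using c1 k Suc.prems by simp_all
  obtain r where r: "r \<in> Hom C (mid c1) (sub c1)" "r \<cdot> fst c1 = Ident C (sub c1)"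
    using cores_split[OF c1(1) c1d Suc.prems(1)] .
  obtain s where s: "dsum C (mid c1) (sub c1) (quo c1) (fst c1) s r (snd c1)"
    using split_dsum_retract[OF c1(1) r] .
  have sr: "(s, r) \<in> Confl C" by (rule dsum_confl[OF dsum_commute[OF s]])
  note S = dsumD[OF s]
  \<comment> \<open>Pushing out along the split inclusion \<open>s\<close> makes the new middle an
    extension of \<open>mid k\<close> by \<open>mid l\<close>. Both lie in \<open>U\<close>, so it
    splits and stays in \<open>U\<close>.\<close>
  obtain l1 g where l1: "l1 \<in> Confl C" "sub l1 = mid c1" "quo l1 = quo l"
    "cmor C l l1 s g (Ident C (quo l))"
    by (rule push_confl[OF l(1), of s "mid c1"]) (use S l c1 in \<open>auto intro!: HomI\<close>)
  obtain e where e: "(g, e) \<in> Confl C" "Cod C e = Cod C r"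
    using pushout_inflation[OF l(1) l1(1) sr l1(4)] .
  note G = cmorD[OF l1(4) l(1) l1(1)]
  have "Cod C (snd (g, e)) \<in> cores C U (Suc 0)"
    by (rule U_cores) (use S(9) c1(2) k(3) e(2) in simp)
  moreover have "Dom C (fst (g, e)) \<in> U" using G(5) l(3) by simp
  ultimately obtain r' where r': "r' \<in> Hom C (Cod C g) (Dom C g)" "r' \<cdot> g = Ident C (Dom C g)"
    using cores_split[OF e(1) _ _ d1(1)] by (metis fst_conv)
  obtain s' where "dsum C (Cod C g) (Dom C g) (Cod C e) g s' r' e"
    using split_dsum_retract[OF e(1)] r' by auto
  then have "is_direct_sum C (Cod C g) (Dom C g) (Cod C e)" unfolding is_direct_sum_iff by blast
  then have "Cod C g \<in> U" by (rule dsum_U) (use G(5) l(3) e(2) S(9) c1(2) k(3) in simp_all)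
  then have "mid c1 \<in> cores C U (Suc n)"
    by (intro cores_SucI[OF l1(1)]) (use l1(2,3) l(4) G(6) in simp_all)
  then show ?case
    by (intro cores_extension_step[OF c k(1,3,4) c1(1,4)] Suc.IH[OF d1(2)])
qed

text \<open>Replacing \<open>mid c\<close> by \<open>mid k\<close> enlarges the next middle term to
  an extension of \<open>quo k\<close> by \<open>mid e\<close>. This new defect sits at a level
  below \<open>d\<close>, where closure is already known, so a level as high as \<open>d\<close> can
  occur only at the very first term.\<close>

lemma mor1_to_mids:
  assumes "is_ext C (c # \<rho>) Y X" "mids_in C U \<rho>" "mid c \<in> cores C U (Suc (length \<rho>))" "length \<rho> < d"
  shows "\<exists>\<tau>. mor1 C Y X (c # \<rho>) \<tau> \<and> mids_in C U \<tau>"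
  using assms
proof (induction \<rho> arbitrary: c Y)
  case Nil
  have "mid c \<in> U" using Nil(3) by (intro cores_one) simp
  then show ?case using mor1_refl[OF Nil(1)] by (intro exI[of _ "[c]"]) simp
next
  case (Cons e \<rho>)
  let ?m = "length \<rho>"
  have c: "c \<in> Confl C" "sub c = Y" and e: "e \<in> Confl C" "sub e = quo c" "mid e \<in> U"
    and \<rho>: "is_ext C \<rho> (quo e) X"
    using Cons.prems by auto
  have c': "(fst c, snd c) \<in> Confl C" using c by simp
  obtain k where k: "k \<in> Confl C" "sub k = mid c" "mid k \<in> U" "quo k \<in> cores C U (Suc ?m)"
    using Cons.prems(3) by (auto simp del: cores.simps simp: cores.simps(2)[of C U "Suc ?m"])
  obtain q h where q: "q \<in> Confl C" "sub q = quo c" "quo q = quo k"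
    "(fst k \<cdot> fst c, h) \<in> Confl C" "Cod C h = mid q" "cmor C k q (snd c) h (Ident C (quo k))"
    by (rule noether[OF c' k(1,2)])
  note Q = cmorD[OF q(6) k(1) q(1)]
  let ?q = "(fst k \<cdot> fst c, h)"
  have Y: "Y \<in> Obj C" using c by auto
  have cq: "cmor C c ?q (Ident C Y) (fst k) (fst q)"
    unfolding cmor_def using c k(1,2) q(1,2,5) Q(10) Y by (auto intro!: HomI)
  obtain e1 g where e1: "e1 \<in> Confl C" "sub e1 = mid q" "quo e1 = quo e"
    "cmor C e e1 (fst q) g (Ident C (quo e))"
    by (rule push_confl[OF e(1), of "fst q" "mid q"]) (use q e in \<open>auto intro!: HomI\<close>)
  have q': "(fst q, snd q) \<in> Confl C" using q by simp
  obtain e' where e': "(g, e') \<in> Confl C" "Cod C e' = quo q"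
    using pushout_inflation[OF e(1) e1(1) q' e1(4)] .
  note G = cmorD[OF e1(4) e(1) e1(1)]
  have lt: "Suc ?m < d" using Cons.prems(4) by simp
  have "Cod C (fst (g, e')) \<in> cores C U (Suc ?m)"
    by (rule cores_extension_closed[OF lt e'(1)]) (use G(5) e(3) e'(2) q(3) k(4) U_cores in \<open>simp_all del: cores.simps\<close>)
  then have "mid e1 \<in> cores C U (Suc ?m)" using G(6) by (simp del: cores.simps)
  moreover have ee: "is_ext C (e1 # \<rho>) (mid q) X" using e1 \<rho> by simp
  ultimately obtain \<tau> where t: "mor1 C (mid q) X (e1 # \<rho>) \<tau>" "mids_in C U \<tau>"
    using Cons.IH[of e1 "mid q"] Cons.prems lt by (auto simp del: cores.simps is_ext.simps)
  have te: "is_ext C \<tau> (mid q) X" using t(1) by (simp add: mor1_def)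
  have "mor C (e # \<rho>) (e1 # \<rho>) (fst q) (Ident C X)" using e1(4) mor_id[OF \<rho>] by auto
  then have "mor C (e # \<rho>) \<tau> (fst q) (Ident C X)"
    by (rule mor_mor1[OF _ t(1)]) (use e \<rho> q in \<open>auto intro!: HomI\<close>)
  then have "mor1 C Y X (c # e # \<rho>) (?q # \<tau>)"
    unfolding mor1_def using Cons.prems(1) q te cq c k by auto
  then show ?case using t(2) k by (intro exI[of _ "?q # \<tau>"]) (use c in auto)
qed

text \<open>As with injective resolutions, \<open>u\<close> extends over each next middle term: the
  obstruction lies in \<open>Ext^1(U^j, U)\<close> with \<open>j < d\<close>. The right end map is
  whatever results.\<close>

lemma lift_mor:
  assumes "is_ext C \<rho> A X" "is_ext C \<sigma> B X'" "length \<rho> = length \<sigma>" "u \<in> Hom C A B"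
    "mids_in C U \<rho>" "mids_in C U \<sigma>" "X \<in> U" "length \<rho> < d"
  shows "\<exists>\<phi>. mor C \<rho> \<sigma> u \<phi>"
  using assms
proof (induction \<rho> arbitrary: A B \<sigma> u)
  case Nil
  then show ?case by (auto simp: Hom_def)
next
  case (Cons e \<rho>)
  obtain e' \<sigma>' where s: "\<sigma> = e' # \<sigma>'" using Cons.prems(3) by (cases \<sigma>) auto
  have e: "e \<in> Confl C" "sub e = A" "is_ext C \<rho> (quo e) X" "mids_in C U \<rho>"
    and e': "e' \<in> Confl C" "sub e' = B" "is_ext C \<sigma>' (quo e') X'" "mids_in C U \<sigma>'" "mid e' \<in> U"
    using Cons.prems s by auto
  note [simp] = HomE[OF Cons.prems(4)] e(1,2) e'(1,2)
  let ?y = "fst e' \<cdot> u"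
  obtain e1 h where e1: "e1 \<in> Confl C" "sub e1 = mid e'" "quo e1 = quo e"
    "cmor C e e1 ?y h (Ident C (quo e))"
    by (rule push_confl[OF e(1), of ?y "mid e'"]) (auto intro!: HomI)
  note M = cmorD[OF e1(4) e(1) e1(1)]
  have "quo e1 \<in> cores C U (Suc (length \<rho>))"
    using ext_cores[OF e(3,4) Cons.prems(7)] e1 by (simp del: cores.simps)
  moreover have "sub e1 \<in> U" using e1 e' by simp
  ultimately obtain r where r: "r \<in> Hom C (mid e1) (sub e1)" "r \<cdot> fst e1 = Ident C (sub e1)"
    using cores_split[OF e1(1)] Cons.prems(8) by (metis length_Cons)
  note [simp] = HomE[OF r(1)] M(1-6) e1(1-3)
  have "(r \<cdot> h) \<cdot> fst e = fst e' \<cdot> u"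
    using M(10) comp_eq1[OF r(2), of ?y] by simp
  moreover have "r \<cdot> h \<in> Hom C (mid e) (mid e')" by (auto intro!: HomI)
  moreover have "u \<in> Hom C (sub e) (sub e')" by (auto intro!: HomI)
  ultimately obtain z where z: "cmor C e e' u (r \<cdot> h) z"
    using cmor_extend_right[OF e(1) e'(1)] by blast
  have "\<exists>\<phi>. mor C \<rho> \<sigma>' z \<phi>"
    by (rule Cons.IH[OF e(3) e'(3)]) (use Cons.prems s z e e' in \<open>auto simp: cmor_def\<close>)
  then show ?case using z s by auto
qed

end

context exact_category
begin

section \<open>The mapping cone\<close>

lemma obtain_neg:
  assumes "f \<in> Hom C X Y"
  obtains g where "g \<in> Hom C X Y" "f \<boxplus> g = ZeroArr C X Y"
proof -
  have o: "X \<in> Obj C" "Y \<in> Obj C" using HomE[OF assms] by auto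
  obtain g where "g \<in> Hom C X Y" "ZeroArr C X Y = f \<boxplus> g"
    using obtain_diff[OF zero_Hom[OF o] assms] .
  then show ?thesis using that by simp
qed

text \<open>The deflation is \<open>(e\<^sub>1, -h)\<close>; only the object it maps to matters later.\<close>

lemma pushout_confl:
  assumes S: "dsum C S B W i1 i2 p1 p2" and c: "e \<in> Confl C" "e1 \<in> Confl C" "mid e = W" "sub e1 = B"
    and m: "cmor C e e1 u h (Ident C (quo e))"
  obtains x where "((i1 \<cdot> u) \<boxplus> (i2 \<cdot> fst e), x) \<in> Confl C" "Cod C x = mid e1"
proof -
  note D = dsumD[OF S]
  note M = cmorD[OF m c(1,2)]
  let ?A = "sub e" and ?P = "mid e1"
  note [simp] = D(1-15) c M(1-6)
  let ?\<psi> = "(i1 \<cdot> u) \<boxplus> (i2 \<cdot> fst e)"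
  have "u \<in> Hom C ?A B" by (auto intro!: HomI)
  then obtain q where q: "(?\<psi>, q) \<in> Confl C"
    using dsum_inflation[OF S c(1,3)] by blast
  have h: "h \<in> Hom C W ?P" by (auto intro!: HomI)
  obtain n where n: "n \<in> Hom C W ?P" "h \<boxplus> n = ZeroArr C W ?P" using obtain_neg[OF h] .
  note [simp] = HomE[OF n(1)]
  let ?x = "(fst e1 \<cdot> p1) \<boxplus> (n \<cdot> p2)"
  have xi1: "?x \<cdot> i1 = fst e1" and xi2: "?x \<cdot> i2 = n"
    using D(16-19) by simp_all
  have hn: "(h \<cdot> t) \<boxplus> (n \<cdot> t) = ZeroArr C (Dom C t) ?P" if "t \<in> Arr C" "Cod C t = W" for t
  proof -
    have "(h \<boxplus> n) \<cdot> t = ZeroArr C (Dom C t) ?P" unfolding n(2) using that by simp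
    then show ?thesis using that by simp
  qed
  have "?x \<cdot> ?\<psi> = (?x \<cdot> i1) \<cdot> u \<boxplus> (?x \<cdot> i2) \<cdot> fst e" by simp
  also have "\<dots> = (h \<cdot> fst e) \<boxplus> (n \<cdot> fst e)" unfolding xi1 xi2 M(10) ..
  also have "\<dots> = ZeroArr C ?A ?P" by (rule hn) simp_all
  finally have x\<psi>: "?x \<cdot> ?\<psi> = ZeroArr C ?A ?P" .
  have "is_cokernel C ?x ?\<psi>"
    unfolding is_cokernel_def
  proof (intro conjI allI ballI impI)
    fix T t assume t: "t \<in> Hom C (Cod C ?\<psi>) T" "t \<cdot> ?\<psi> = ZeroArr C (Dom C ?\<psi>) T"
    have t': "t \<in> Hom C S T" using t(1) by simp
    note [simp] = HomE[OF t']
    have t0: "(t \<cdot> (i2 \<cdot> fst e)) \<boxplus> (t \<cdot> (i1 \<cdot> u)) = ZeroArr C ?A T"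
    proof -
      have "(t \<cdot> (i1 \<cdot> u)) \<boxplus> (t \<cdot> (i2 \<cdot> fst e)) = ZeroArr C ?A T" using t(2) by simp
      then show ?thesis using add_comm[of "t \<cdot> (i2 \<cdot> fst e)" ?A T "t \<cdot> (i1 \<cdot> u)"] by (auto simp: Hom_def)
    qed
    have ti2: "t \<cdot> i2 \<in> Hom C W T" by (auto intro!: HomI)
    \<comment> \<open>\<open>t2\<close> is the negative of \<open>t \<cdot> i2\<close>. The pushout
      is tested with \<open>h\<close> while \<open>?x\<close> carries its negative \<open>n\<close>,
      so the sign is moved to the test arrow.\<close>
    obtain t2 where t2: "t2 \<in> Hom C W T" "(t \<cdot> i2) \<boxplus> t2 = ZeroArr C W T" using obtain_neg[OF ti2] .
    note [simp] = HomE[OF t2(1)]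
    have "((t \<cdot> i2) \<boxplus> t2) \<cdot> fst e = ZeroArr C ?A T" unfolding t2(2) by simp
    then have "(t \<cdot> (i2 \<cdot> fst e)) \<boxplus> (t2 \<cdot> fst e) = (t \<cdot> (i2 \<cdot> fst e)) \<boxplus> (t \<cdot> (i1 \<cdot> u))"
      using t0 by simp
    then have "t2 \<cdot> fst e = t \<cdot> (i1 \<cdot> u)" by (rule add_cancel[rotated 3]) (auto intro!: HomI)
    then have e2: "t2 \<cdot> fst e = (t \<cdot> i1) \<cdot> u" by simp
    have "t2 \<in> Hom C (mid e) T" "t \<cdot> i1 \<in> Hom C (sub e1) T" by (auto intro!: HomI)
    then obtain w where w: "w \<in> Hom C ?P T" "w \<cdot> h = t2" "w \<cdot> fst e1 = t \<cdot> i1"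
      using pushout_univ[OF c(1,2) m _ _ e2] by blast
    note [simp] = HomE[OF w(1)]
    have neg: "v \<cdot> n = t \<cdot> i2 \<longleftrightarrow> v \<cdot> h = t2" if v: "v \<in> Hom C ?P T" for v
    proof -
      note [simp] = HomE[OF v]
      have 1: "(v \<cdot> h) \<boxplus> (v \<cdot> n) = ZeroArr C W T"
      proof -
        have "v \<cdot> (h \<boxplus> n) = ZeroArr C W T" unfolding n(2) by simp
        then show ?thesis by simp
      qed
      have 2: "t2 \<boxplus> (t \<cdot> i2) = ZeroArr C W T" using add_comm[OF t2(1) ti2] t2(2) by simp
      have H: "v \<cdot> h \<in> Hom C W T" "v \<cdot> n \<in> Hom C W T" by (auto intro!: HomI)
      show ?thesis
      proof
        assume e: "v \<cdot> n = t \<cdot> i2"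
        have "(t \<cdot> i2) \<boxplus> (v \<cdot> h) = (t \<cdot> i2) \<boxplus> t2"
          using 1 t2(2) add_comm[OF H] unfolding e by simp
        then show "v \<cdot> h = t2" by (rule add_cancel[OF ti2 H(1) t2(1)])
      next
        assume e: "v \<cdot> h = t2"
        have "t2 \<boxplus> (v \<cdot> n) = t2 \<boxplus> (t \<cdot> i2)" using 1 2 unfolding e by simp
        then show "v \<cdot> n = t \<cdot> i2" by (rule add_cancel[OF t2(1) H(2) ti2])
      qed
    qed
    have wn: "w \<cdot> n = t \<cdot> i2" using neg[OF w(1)] w(2) by simp
    have "w \<cdot> ?x = (w \<cdot> fst e1) \<cdot> p1 \<boxplus> (w \<cdot> n) \<cdot> p2" by simp
    also have "\<dots> = t \<cdot> ((i1 \<cdot> p1) \<boxplus> (i2 \<cdot> p2))" unfolding w(3) wn by simp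
    finally have wx: "w \<cdot> ?x = t" unfolding D(20) by simp
    have un: "w' = w" if w': "w' \<in> Hom C ?P T" "w' \<cdot> ?x = t" for w'
    proof (rule pushout_joint[OF c(1,2) m w'(1) w(1)])
      note [simp] = HomE[OF w'(1)]
      have "w' \<cdot> (?x \<cdot> i1) = t \<cdot> i1" "w' \<cdot> (?x \<cdot> i2) = t \<cdot> i2"
        by (rule comp_eq1[OF w'(2)]; simp)+
      then have "w' \<cdot> fst e1 = t \<cdot> i1" "w' \<cdot> n = t \<cdot> i2" unfolding xi1 xi2 .
      then show "w' \<cdot> h = w \<cdot> h" "w' \<cdot> fst e1 = w \<cdot> fst e1" using neg[OF w'(1)] w(2,3) by simp_all
    qed
    show "\<exists>!s. s \<in> Hom C (Cod C ?x) T \<and> s \<cdot> ?x = t"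
    proof (rule ex1I[of _ w])
      show "w \<in> Hom C (Cod C ?x) T \<and> w \<cdot> ?x = t" using w(1) wx by simp
      show "w' = w" if "w' \<in> Hom C (Cod C ?x) T \<and> w' \<cdot> ?x = t" for w'
        by (rule un) (use that in simp_all)
    qed
  qed (use x\<psi> in simp_all)
  then have "(?\<psi>, ?x) \<in> Confl C" by (rule cokernel_confl[OF q])
  then show ?thesis by (rule that) simp
qed

end

context rigid_subcategory
begin

text \<open>This is the mapping cone: the fixed ends cancel, leaving \<open>mid c\<close>, then the
  sum of \<open>mid c'\<close> and \<open>mid e\<close>, and so on, with all terms after the first
  in \<open>U\<close>. Only its first conflation is built; the rest is the cone of the morphism from
  the tail pushed out along \<open>u\<close>, given by induction.\<close>

lemma mor1_cores:
  assumes "mor1 C Y X (c # \<rho>) (c' # \<sigma>)" "mids_in C U \<rho>" "mids_in C U (c' # \<sigma>)"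
  shows "mid c \<in> cores C U (Suc (length \<rho>))"
  using assms
proof (induction \<rho> arbitrary: c c' \<sigma> Y)
  case Nil
  have s: "\<sigma> = []" using Nil(1) by (auto simp: mor1_def)
  obtain h where h: "cmor C c c' (Ident C Y) h (Ident C X)" using Nil(1) by (auto simp: mor1_def)
  have c: "c \<in> Confl C" "c' \<in> Confl C" "sub c = Y" "quo c = X"
    using Nil(1) s by (auto simp: mor1_def)
  obtain h' where h': "h' \<cdot> h = Ident C (mid c)" "h \<cdot> h' = Ident C (mid c')"
    "cmor C c' c (Ident C (sub c)) h' (Ident C (quo c))"
    using cmor_id_invert[OF c(1,2)] h c by metis
  have "is_iso C h'" by (rule isoI[OF _ _ h'(2,1)]) (use h h' in \<open>auto simp: cmor_def\<close>)
  then have "Cod C h' \<in> U" by (rule iso_U) (use h' Nil(3) in \<open>auto simp: cmor_def Hom_def\<close>)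
  moreover have "Cod C h' = mid c" using h'(3) by (auto simp: cmor_def Hom_def)
  ultimately show ?case using U_cores[of "mid c" 0] by simp
next
  case (Cons e \<rho>)
  have ext: "is_ext C (c # e # \<rho>) Y X" "is_ext C (c' # \<sigma>) Y X"
    and mm: "mor C (c # e # \<rho>) (c' # \<sigma>) (Ident C Y) (Ident C X)"
    using Cons.prems(1) by (simp_all add: mor1_def)
  obtain f u where 1: "cmor C c c' (Ident C Y) f u" "mor C (e # \<rho>) \<sigma> u (Ident C X)" using mm by auto
  obtain e' \<sigma>' g w where 2: "\<sigma> = e' # \<sigma>'" "cmor C e e' u g w" "mor C \<rho> \<sigma>' w (Ident C X)"
    using mor_Cons[OF 1(2)] .
  have c: "c \<in> Confl C" "c' \<in> Confl C" "sub c = Y" "sub c' = Y"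
    and e: "e \<in> Confl C" "sub e = quo c" "e' \<in> Confl C" "sub e' = quo c'"
    and r: "is_ext C \<rho> (quo e) X" "is_ext C \<sigma>' (quo e') X"
    using ext 2(1) by auto
  have mids: "mids_in C U \<rho>" "mid e \<in> U" "mids_in C U (e' # \<sigma>')" "mid c' \<in> U"
    using Cons.prems 2(1) by auto
  have Y: "Y \<in> Obj C" using c by auto
  note M = cmorD[OF 1(1) c(1,2)] and N = cmorD[OF 2(2) e(1,3)]
  note [simp] = c e M(4-9) Y
  let ?A = "quo c" and ?B = "quo c'" and ?W = "mid e"
  have u: "u \<in> Hom C (sub e) ?B" by (auto intro!: HomI)
  obtain e1 h where e1: "e1 \<in> Confl C" "sub e1 = ?B" "quo e1 = quo e"
    "cmor C e e1 u h (Ident C (quo e))"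
    using push_confl[OF e(1) u] .
  have ee: "is_ext C (e1 # \<rho>) ?B X" using e1 r by simp
  have es: "is_ext C \<sigma> ?B X" using 2(1) e r by simp
  have "mor C (e # \<rho>) \<sigma> (Ident C ?B \<cdot> u) (Ident C X)" using 1(2) by simp
  then have "mor C (e1 # \<rho>) \<sigma> (Ident C ?B) (Ident C X)"
    by (rule mor_cocart[OF e(1) e1(1,4) _ es]) (use e1 in \<open>auto intro!: HomI\<close>)
  then have "mor1 C ?B X (e1 # \<rho>) (e' # \<sigma>')" using ee es 2(1) by (simp add: mor1_def)
  then have C2: "mid e1 \<in> cores C U (Suc (length \<rho>))"
    by (rule Cons.IH[OF _ mids(1,3)])
  obtain S i1 i2 p1 p2 where S: "dsum C S ?B ?W i1 i2 p1 p2"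
    using ex_direct_sum[of ?B ?W] unfolding is_direct_sum_iff by auto
  note D = dsumD[OF S]
  note [simp] = D(1-15)
  \<comment> \<open>The cokernel of this map of cycles is the pushout \<open>mid e1\<close>, to
    which the induction hypothesis was just applied. Pulling \<open>c'\<close> back to the sum
    \<open>S\<close> then embeds \<open>mid c\<close> into the sum of \<open>mid c'\<close> and
    \<open>?W\<close> with the same cokernel.\<close>
  let ?\<psi> = "(i1 \<cdot> u) \<boxplus> (i2 \<cdot> fst e)"
  obtain x where x: "(?\<psi>, x) \<in> Confl C" "Cod C x = mid e1"
    using pushout_confl[OF S e(1) e1(1) refl e1(2,4)] .
  obtain P a where P: "P \<in> Confl C" "sub P = sub c'" "quo P = S"
    "cmor C P c' (Ident C (sub c')) a p1" "is_direct_sum C (mid P) (mid c') ?W"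
    using pull_dsum[OF S c(2) refl] .
  have PU: "mid P \<in> U" by (rule dsum_U[OF P(5) mids(4,2)])
  have "p1 \<cdot> ?\<psi> = u"
    using comp_eq1[OF D(16), of u] comp_eq1[OF D(19), of "fst e"] by simp
  then have q1: "cmor C c c' (Ident C Y) f (p1 \<cdot> ?\<psi>)" using 1(1) by simp
  have q2: "?\<psi> \<in> Hom C (quo c) (quo P)" using P(3) by (auto intro!: HomI)
  obtain g1 where g1: "cmor C c P (Ident C Y) g1 ?\<psi>"
    using cart[OF c(2) P(1) c(1) P(4) q1 q2] by blast
  have "cmor C c P (Ident C (sub P)) g1 ?\<psi>" using g1 P(2) by simp
  then have k: "(g1, x \<cdot> snd P) \<in> Confl C" by (rule pullback_inflation[OF P(1) c(1) _ x(1)])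
  have G: "Dom C g1 = mid c" "Cod C g1 = mid P" using g1 by (auto simp: cmor_def Hom_def)
  have xx: "x \<in> Arr C" "Dom C x = S" using confl_simps[OF x(1)] by simp_all
  have "Cod C (x \<cdot> snd P) = mid e1" using xx x(2) P(1,3) by simp
  then show ?case
    using cores_SucI[OF k, of "mid c" "Suc (length \<rho>)"] G PU C2 by (simp del: cores.simps)
qed

section \<open>From an equivalence to a morphism\<close>

lemma mor1_length: "mor1 C Y X \<xi> \<eta> \<Longrightarrow> length \<xi> = length \<eta>"
  unfolding mor1_def by (auto dest: mor_length)

lemma mor1_yeq: "mor1 C Y X \<xi> \<eta> \<Longrightarrow> yeq C Y X \<xi> \<eta>" "mor1 C Y X \<xi> \<eta> \<Longrightarrow> yeq C Y X \<eta> \<xi>"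
  unfolding yeq_def by (auto intro: r_into_equivclp converse_r_into_equivclp)

lemma yeq_trans: "yeq C Y X \<xi> \<eta> \<Longrightarrow> yeq C Y X \<eta> \<zeta> \<Longrightarrow> yeq C Y X \<xi> \<zeta>"
  unfolding yeq_def by (rule equivclp_trans)

text \<open>Being equivalent to \<open>\<tau>\<close>, the extension \<open>c # \<rho>\<close> dies when pushed out along the first
  inflation \<open>Y \<rightarrow> T\<close> of \<open>\<tau>\<close>.\<close>

lemma yeq_first_lift:
  assumes "is_ext C (c # \<rho>) Y X" "yeq C Y X (c # \<rho>) (k # \<sigma>)" "is_ext C (k # \<sigma>) Y X"
    and "mids_in C U \<rho>" "mid k \<in> U" "length \<rho> < d"
  obtains f u where "cmor C c k (Ident C Y) f u"
proof -
  have c: "c \<in> Confl C" "sub c = Y" and k: "k \<in> Confl C" "sub k = Y"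
    and r: "is_ext C \<rho> (quo c) X" "is_ext C \<sigma> (quo k) X" using assms(1,3) by auto
  have Y: "Y \<in> Obj C" using c by auto
  have X: "X \<in> Obj C" using is_ext_obj[OF assms(1)] by simp
  let ?T = "mid k" and ?y = "fst k"
  note [simp] = c k Y X
  have y: "?y \<in> Hom C Y ?T" by (auto intro!: HomI)
  have T: "Ident C ?T \<in> Hom C ?T ?T" by (auto intro!: HomI)
  obtain \<omega> where w: "mor1 C Y X (c # \<rho>) \<omega>" "mor1 C Y X (k # \<sigma>) \<omega>"
    using yeq_common[OF assms(2,1)] .
  have we: "is_ext C \<omega> Y X" using w(1) by (simp add: mor1_def)
  obtain v \<omega>' where v: "\<omega> = v # \<omega>'" using w(1) by (cases \<omega>) (auto simp: mor1_def)
  have vc: "v \<in> Confl C" "sub v = Y" "is_ext C \<omega>' (quo v) X" using we v by auto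
  note [simp] = vc(1,2)
  have y': "?y \<in> Hom C (sub c) ?T" "?y \<in> Hom C (sub v) ?T" "?y \<in> Hom C (sub k) ?T"
    using y by simp_all
  obtain c1 h where c1: "c1 \<in> Confl C" "sub c1 = ?T" "quo c1 = quo c"
    "cmor C c c1 ?y h (Ident C (quo c))"
    using push_confl[OF c(1) y'(1)] .
  obtain v1 h1 where v1: "v1 \<in> Confl C" "sub v1 = ?T" "quo v1 = quo v"
    "cmor C v v1 ?y h1 (Ident C (quo v))"
    using push_confl[OF vc(1) y'(2)] .
  obtain k1 h2 where k1: "k1 \<in> Confl C" "sub k1 = ?T" "quo k1 = quo k"
    "cmor C k k1 ?y h2 (Ident C (quo k))"
    using push_confl[OF k(1) y'(3)] .
  note [simp] = c1(1,2) v1(1,2) k1(1,2)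
  have ce: "is_ext C (c1 # \<rho>) ?T X" and ve: "is_ext C (v1 # \<omega>') ?T X" and ke: "is_ext C (k1 # \<sigma>) ?T X"
    using c1 v1 k1 r vc by auto
  have mv: "mor C \<omega> (v1 # \<omega>') ?y (Ident C X)" using v1(4) mor_id[OF vc(3)] v by auto
  have "mor C (c # \<rho>) (v1 # \<omega>') (Ident C ?T \<cdot> ?y) (Ident C X)"
    using mor1_mor[OF w(1) mv ve y] by simp
  then have "mor C (c1 # \<rho>) (v1 # \<omega>') (Ident C ?T) (Ident C X)"
    by (rule mor_cocart[OF c(1) c1(1,4) _ ve]) (use T in simp)
  then have m1: "mor1 C ?T X (c1 # \<rho>) (v1 # \<omega>')" using ce ve by (simp add: mor1_def)
  have "mor C (k # \<sigma>) (v1 # \<omega>') (Ident C ?T \<cdot> ?y) (Ident C X)"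
    using mor1_mor[OF w(2) mv ve y] by simp
  then have "mor C (k1 # \<sigma>) (v1 # \<omega>') (Ident C ?T) (Ident C X)"
    by (rule mor_cocart[OF k(1) k1(1,4) _ ve]) (use T in simp)
  then have m2: "mor1 C ?T X (k1 # \<sigma>) (v1 # \<omega>')" using ke ve by (simp add: mor1_def)
  \<comment> \<open>\<open>fst k\<close> extends over \<open>mid k\<close> by the identity, so the
    first inflation of the pushed-out extension has a retraction.\<close>
  have "Ident C ?T \<in> Hom C (sub k1) ?T" using T by simp
  then obtain r0 where r0: "r0 \<in> Hom C (mid k1) ?T" "r0 \<cdot> h2 = Ident C ?T" "r0 \<cdot> fst k1 = Ident C ?T"
    using pushout_univ[OF k(1) k1(1,4) T _ refl] by metis
  then have "splitfirst C (k1 # \<sigma>)" unfolding splitfirst_def using k1(2) by auto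
  then obtain \<theta> where th: "splitlast C \<theta>" "mor1 C ?T X (k1 # \<sigma>) \<theta>"
    using splitfirst_effaced[OF ke] unfolding effaced_def by blast
  have "yeq C ?T X (c1 # \<rho>) \<theta>"
    using yeq_trans[OF yeq_trans[OF mor1_yeq(1)[OF m1] mor1_yeq(2)[OF m2]] mor1_yeq(1)[OF th(2)]] .
  then obtain q where q: "q \<in> Hom C (mid c1) ?T" "q \<cdot> fst c1 = Ident C ?T"
  proof (rule yeq_splitlast_retraction[OF ce _ th(1)])
    show "ext_vanishes n (mid e) ?T" if "e \<in> set \<rho>" "0 < n" "n \<le> length \<rho>" for e n
      by (rule vanishes) (use that assms(4-6) in auto)
  qed
  note M = cmorD[OF c1(4) c(1) c1(1)]
  note [simp] = HomE[OF q(1)] M(4-6)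
  have "(q \<cdot> h) \<cdot> fst c = fst k \<cdot> Ident C Y" using M(10) comp_eq1[OF q(2), of ?y] by simp
  moreover have "q \<cdot> h \<in> Hom C (mid c) (mid k)" by (auto intro!: HomI)
  moreover have "Ident C Y \<in> Hom C (sub c) (sub k)" by (auto intro!: HomI)
  ultimately show ?thesis using cmor_extend_right[OF c(1) k(1)] that by metis
qed

text \<open>Two morphisms over \<open>\<phi>\<close> and over the identity into a common extension are subtracted: this
  shows that the pullback of \<open>\<tau>\<close> along \<open>1 - \<phi>\<close> is trivial, so that \<open>1 - \<phi>\<close> factors through the last
  deflation of \<open>\<tau>\<close> and \<open>\<phi>\<close> can be corrected to the identity.\<close>

lemma yeq_mor1:
  assumes "is_ext C (c # \<rho>) Y X" "yeq C Y X (c # \<rho>) \<tau>" "is_ext C \<tau> Y X"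
    and "mids_in C U \<rho>" "mids_in C U \<tau>" "X \<in> U" "length \<rho> < d"
  shows "mor1 C Y X (c # \<rho>) \<tau>"
proof -
  obtain \<omega> where w: "mor1 C Y X (c # \<rho>) \<omega>" "mor1 C Y X \<tau> \<omega>"
    using yeq_common[OF assms(2,1)] .
  have len: "length \<tau> = Suc (length \<rho>)" using mor1_length[OF w(1)] mor1_length[OF w(2)] by simp
  then obtain k \<sigma> where t: "\<tau> = k # \<sigma>" by (cases \<tau>) auto
  obtain f u where fu: "cmor C c k (Ident C Y) f u"
    using yeq_first_lift[OF assms(1,2)[unfolded t] assms(3)[unfolded t] assms(4) _ assms(7)] assms(5) t by auto
  have Y: "Y \<in> Obj C" and X: "X \<in> Obj C" using is_ext_obj[OF assms(1)] by auto
  have IY: "Ident C Y \<in> Hom C Y Y" and IX: "Ident C X \<in> Hom C X X" using Y X ident_in by auto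
  have k: "k \<in> Confl C" "sub k = Y" "is_ext C \<sigma> (quo k) X" using assms(3) t by auto
  have r: "is_ext C \<rho> (quo c) X" using assms(1) by simp
  \<comment> \<open>Rigidity governs the middle terms but not the right end, where some endomorphism
    \<open>\<phi>\<close> of \<open>X\<close> appears.\<close>
  have "\<exists>\<phi>. mor C \<rho> \<sigma> u \<phi>"
    by (rule lift_mor[OF r k(3)]) (use assms len t fu in \<open>auto simp: cmor_def\<close>)
  then obtain \<phi> where \<phi>: "mor C (c # \<rho>) \<tau> (Ident C Y) \<phi>" using fu t by auto
  have \<phi>H: "\<phi> \<in> Hom C X X" by (rule mor_Hom[OF \<phi> assms(1,3) IY])
  \<comment> \<open>After this, \<open>\<tau>\<close> has two morphisms into
    \<open>\<omega>2\<close>, both the identity on \<open>Y\<close>, over the identity and over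
    \<open>\<phi>\<close>. Their difference is zero on \<open>Y\<close> and \<open>z\<close> on
    \<open>X\<close>.\<close>
  obtain \<omega>2 where w2: "mor1 C Y X \<tau> \<omega>2" "mor C \<omega> \<omega>2 (Ident C Y) \<phi>"
    using ore[OF assms(1,3) \<phi> w(1)] .
  have w2e: "is_ext C \<omega>2 Y X" and m1: "mor C \<tau> \<omega>2 (Ident C Y) (Ident C X)" using w2(1) by (simp_all add: mor1_def)
  have m2: "mor C \<tau> \<omega>2 (Ident C Y) \<phi>" by (rule mor1_mor[OF w(2) w2(2) w2e IY])
  obtain z where z: "z \<in> Hom C X X" "Ident C X = \<phi> \<boxplus> z" using obtain_diff[OF IX \<phi>H] .
  have "mor C \<tau> \<omega>2 (Ident C Y \<boxplus> ZeroArr C Y Y) (\<phi> \<boxplus> z)" using m1 z(2) add_zero[OF IY] by simp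
  then have m0: "mor C \<tau> \<omega>2 (ZeroArr C Y Y) z"
    by (rule mor_diff[OF _ m2 assms(3) w2e IY zero_Hom[OF Y Y] z(1)])
  obtain \<tau>0 l where l: "\<tau> = \<tau>0 @ [l]" using len by (cases \<tau> rule: rev_cases) auto
  obtain \<upsilon> m where m: "\<omega>2 = \<upsilon> @ [m]" using mor_snoc m0 l by metis
  have lc: "l \<in> Confl C" "quo l = X" "is_ext C \<tau>0 Y (sub l)"
    using assms(3) l by (auto simp: is_ext_snoc)
  have mc: "m \<in> Confl C" "quo m = X" "is_ext C \<upsilon> Y (sub m)"
    using w2e m by (auto simp: is_ext_snoc)
  have zl: "z \<in> Hom C X (quo l)" "z \<in> Hom C X (quo m)" using z(1) lc mc by simp_all
  obtain l' fl where l': "l' \<in> Confl C" "quo l' = X" "sub l' = sub l"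
    "cmor C l' l (Ident C (sub l)) fl z"
    using pull_confl[OF lc(1) zl(1)] .
  obtain m' fm where m': "m' \<in> Confl C" "quo m' = X" "sub m' = sub m"
    "cmor C m' m (Ident C (sub m)) fm z"
    using pull_confl[OF mc(1) zl(2)] .
  have le: "is_ext C (\<tau>0 @ [l']) Y X" and me: "is_ext C (\<upsilon> @ [m']) Y X"
    using l' m' lc mc by (simp_all add: is_ext_snoc)
  have "mor C (\<tau>0 @ [l']) \<tau> (Ident C Y) z"
    unfolding l by (rule mor_snocI[OF mor_id[OF lc(3)] l'(4)])
  then have "mor C (\<tau>0 @ [l']) \<omega>2 (Ident C Y) z" by (rule mor_mor1[OF _ w2(1) le IY])
  then have "mor C (\<tau>0 @ [l']) (\<upsilon> @ [m]) (Ident C Y) (z \<cdot> Ident C X)" using m HomE[OF z(1)] by simp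
  then have "mor C (\<tau>0 @ [l']) (\<upsilon> @ [m']) (Ident C Y) (Ident C X)"
    by (rule mor_cart[OF w2e[unfolded m] m'(1,4) _ le]) (use IX m' in simp)
  then have n1: "mor1 C Y X (\<tau>0 @ [l']) (\<upsilon> @ [m'])" using le me by (simp add: mor1_def)
  have "mor C \<tau> (\<upsilon> @ [m]) (ZeroArr C Y Y) (z \<cdot> Ident C X)" using m0 m HomE[OF z(1)] by simp
  then have "mor C \<tau> (\<upsilon> @ [m']) (ZeroArr C Y Y) (Ident C X)"
    by (rule mor_cart[OF w2e[unfolded m] m'(1,4) _ assms(3)]) (use IX m' in simp)
  then have "mor C (k # \<sigma>) (\<upsilon> @ [m']) (Ident C Y \<cdot> ZeroArr C Y Y) (Ident C X)" using t Y by simp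
  \<comment> \<open>A morphism that is zero on \<open>Y\<close> factors through the pushout along
    zero, whose first inflation splits. This makes the pullback along \<open>z\<close>
    trivial.\<close>
  moreover have zk: "ZeroArr C Y Y \<in> Hom C (sub k) Y" using zero_Hom Y k by simp
  obtain k0 h0 where k0: "k0 \<in> Confl C" "sub k0 = Y" "quo k0 = quo k"
    "cmor C k k0 (ZeroArr C Y Y) h0 (Ident C (quo k))"
    using push_confl[OF k(1) zk] .
  ultimately have "mor C (k0 # \<sigma>) (\<upsilon> @ [m']) (Ident C Y) (Ident C X)"
    using mor_cocart[OF k(1) k0(1,4) _ me] IY by simp
  moreover have ke: "is_ext C (k0 # \<sigma>) Y X" using k k0 by simp
  ultimately have n2: "mor1 C Y X (k0 # \<sigma>) (\<upsilon> @ [m'])" using me by (simp add: mor1_def)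
  have "ZeroArr C (mid k) Y \<in> Hom C (mid k) Y" using k(1) Y zero_Hom by simp
  moreover have "Ident C Y \<in> Hom C (sub k0) Y" using IY k0 by simp
  moreover have "ZeroArr C (mid k) Y \<cdot> fst k = Ident C Y \<cdot> ZeroArr C Y Y" using k Y by simp
  ultimately obtain q where "q \<in> Hom C (mid k0) Y" "q \<cdot> fst k0 = Ident C Y"
    using pushout_univ[OF k(1) k0(1,4)] by metis
  then have sf: "splitfirst C (k0 # \<sigma>)" unfolding splitfirst_def using k0(2) by auto
  have "yeq C Y X (\<tau>0 @ [l']) (k0 # \<sigma>)"
    by (rule yeq_trans[OF mor1_yeq(1)[OF n1] mor1_yeq(2)[OF n2]])
  then obtain s where s: "s \<in> Hom C X (mid l')" "snd l' \<cdot> s = Ident C X"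
  proof (rule yeq_splitfirst_section[OF le _ sf ke])
    show "ext_vanishes n X (mid e)" if "e \<in> set \<tau>0" "0 < n" "n \<le> length \<tau>0" for e n
      by (rule vanishes) (use that assms(5-7) l len in auto)
  qed
  note L = cmorD[OF l'(4,1) lc(1)]
  note [simp] = HomE[OF s(1)] L(4-6) lc(1,2) l'(1,2) X
  have st: "snd l \<cdot> (fl \<cdot> s) = z" using L(13)[of s] s(2) HomE[OF z(1)] by simp
  have sH: "fl \<cdot> s \<in> Hom C X (mid l)" by (auto intro!: HomI)
  obtain \<xi>0 c0 where c0: "c # \<rho> = \<xi>0 @ [c0]" by (metis rev_exhaust list.distinct(1))
  have c0c: "c0 \<in> Confl C" "quo c0 = X" using assms(1) unfolding c0 by (auto simp: is_ext_snoc)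
  have "mor C (\<xi>0 @ [c0]) (\<tau>0 @ [l]) (Ident C Y) (\<phi> \<boxplus> (snd l \<cdot> (fl \<cdot> s)))"
    by (rule mor_homotopy_right[OF _ c0c(1) lc(1)]) (use \<phi> c0 l c0c sH in simp_all)
  then have "mor C (c # \<rho>) \<tau> (Ident C Y) (Ident C X)" unfolding st z(2) using c0 l by simp
  then show ?thesis using assms(1,3) by (simp add: mor1_def)
qed

section \<open>Both implications for lists of conflations\<close>

lemma cores_extension_closedI:
  assumes "0 < d" "c \<in> Confl C" "sub c \<in> cores C U d" "quo c \<in> cores C U d"
    and H: "\<And>X Y c \<rho>. X \<in> U \<Longrightarrow> Y \<in> U \<Longrightarrow> is_ext C (c # \<rho>) Y X \<Longrightarrow> length (c # \<rho>) = d \<Longrightarrow> mids_in C U \<rho> \<Longrightarrow>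
      \<exists>\<tau>. is_ext C \<tau> Y X \<and> yeq C Y X (c # \<rho>) \<tau> \<and> mids_in C U \<tau>"
  shows "mid c \<in> cores C U d"
proof -
  obtain n where n: "d = Suc n" using assms(1) by (cases d) auto
  obtain k where k: "k \<in> Confl C" "sub k = sub c" "mid k \<in> U" "quo k \<in> cores C U n"
    using assms(3) n by auto
  obtain c1 h where c1: "c1 \<in> Confl C" "sub c1 = mid k" "quo c1 = quo c"
    "cmor C c c1 (fst k) h (Ident C (quo c))"
    by (rule push_confl[OF assms(2), of "fst k" "mid k"]) (use k in \<open>auto intro!: HomI\<close>)
  obtain \<rho> X where r: "is_ext C \<rho> (quo c) X" "mids_in C U \<rho>" "X \<in> U" "length \<rho> = n"
    using cores_ext[of "quo c" n] assms(4) n by auto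
  have e: "is_ext C (c1 # \<rho>) (mid k) X" using c1 r by simp
  obtain \<tau> where t: "is_ext C \<tau> (mid k) X" "yeq C (mid k) X (c1 # \<rho>) \<tau>" "mids_in C U \<tau>"
    using H[OF r(3) k(3) e _ r(2)] r(4) n by auto
  have m: "mor1 C (mid k) X (c1 # \<rho>) \<tau>"
    by (rule yeq_mor1[OF e t(2,1) r(2) t(3) r(3)]) (use r n in simp)
  obtain k' \<sigma> where k': "\<tau> = k' # \<sigma>" using m mor_length unfolding mor1_def by (cases \<tau>) auto
  have M: "mid c1 \<in> cores C U (Suc n)"
    using mor1_cores[OF m[unfolded k'] r(2)] t(3) k' r(4) by (simp del: cores.simps)
  show ?thesis
    unfolding n
  proof (rule cores_extension_step[OF assms(2) k(1,3,4) c1(1,4) M])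
    show "mid e \<in> cores C U n"
      if "e \<in> Confl C" "sub e \<in> cores C U n" "quo e \<in> cores C U n" for e
      by (rule cores_extension_closed) (use that n in simp_all)
  qed
qed

lemma cores_extension_closedD:
  assumes "\<And>c. c \<in> Confl C \<Longrightarrow> sub c \<in> cores C U d \<Longrightarrow> quo c \<in> cores C U d \<Longrightarrow> mid c \<in> cores C U d"
    and "X \<in> U" "Y \<in> U" "is_ext C (c # \<rho>) Y X" "length (c # \<rho>) = d" "mids_in C U \<rho>"
  shows "\<exists>\<tau>. mor1 C Y X (c # \<rho>) \<tau> \<and> mids_in C U \<tau>"
proof (rule mor1_to_mids[OF assms(4,6)])
  have d: "d = Suc (length \<rho>)" using assms(5) by simp
  have c: "c \<in> Confl C" "sub c = Y" "is_ext C \<rho> (quo c) X" using assms(4) by auto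
  have "mid c \<in> cores C U d"
    by (rule assms(1)[OF c(1)]) (use c U_cores[OF assms(3)] ext_cores[OF c(3) assms(6,2)] d in \<open>simp_all del: cores.simps\<close>)
  then show "mid c \<in> cores C U (Suc (length \<rho>))" using d by simp
qed (use assms(5) in simp)

end

section \<open>Translation to sequences of arrows\<close>

text \<open>\<open>arrows C q \<xi>\<close> is the sequence of arrows spliced from \<open>\<xi>\<close>, its first arrow being precomposed
  with \<open>q\<close>; the extension \<open>\<xi>\<close> of \<open>X\<close> by \<open>Y\<close> corresponds to \<open>arrows C (Ident C Y) \<xi>\<close>.\<close>

fun arrows :: "('o, 'm, 'x) precat_scheme \<Rightarrow> 'm \<Rightarrow> ('m \<times> 'm) list \<Rightarrow> 'm list" where
  "arrows C q [] = [q]"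
| "arrows C q (c # \<xi>) = (fst c \<cdot>\<^bsub>C\<^esub> q) # arrows C (snd c) \<xi>"

lemma length_arrows [simp]: "length (arrows C q \<xi>) = Suc (length \<xi>)"
  by (induction \<xi> arbitrary: q) auto

context exact_category
begin

section \<open>Exact sequences versus lists of conflations\<close>

lemma terms_arrows:
  assumes "is_ext C \<xi> (Cod C q) X" "q \<in> Arr C"
  shows "terms C (arrows C q \<xi>) = Dom C q # map (\<lambda>c. mid c) \<xi> @ [X]"
proof -
  have "map (Cod C) (arrows C q \<xi>) = map (\<lambda>c. mid c) \<xi> @ [X]"
    using assms by (induction \<xi> arbitrary: q) auto
  moreover have "Dom C (hd (arrows C q \<xi>)) = Dom C q" using assms by (cases \<xi>) auto
  ultimately show ?thesis by (simp add: terms_def)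
qed

text \<open>\<open>e\<close> is the padding conflation at the right end. Its inflation is an
  identity, so the last arrow, a bare deflation, also has the shape of an inflation after a
  deflation.\<close>

lemma arrows_nth:
  assumes "is_ext C \<xi> (quo c) X" "c \<in> Confl C" "fst e = Ident C X" "k < Suc (length \<xi>)"
  shows "Cod C (snd ((c # \<xi> @ [e]) ! k)) = Dom C (fst ((c # \<xi> @ [e]) ! Suc k)) \<and>
    arrows C (snd c) \<xi> ! k = fst ((c # \<xi> @ [e]) ! Suc k) \<cdot> snd ((c # \<xi> @ [e]) ! k)"
  using assms
proof (induction \<xi> arbitrary: c k)
  case Nil
  then show ?case by auto
next
  case (Cons c' \<xi>)
  show ?case
  proof (cases k)
    case 0
    then show ?thesis using Cons.prems by simp
  next
    case (Suc j)
    then show ?thesis using Cons.IH[of c' j] Cons.prems by simp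
  qed
qed

lemma exact_seq_arrows:
  assumes "is_ext C \<xi> Y X"
  shows "exact_seq C (arrows C (Ident C Y) \<xi>)"
proof -
  have o: "Y \<in> Obj C" "X \<in> Obj C" using is_ext_obj[OF assms] by auto
  obtain i where i: "(i, Ident C Y) \<in> Confl C" "is_zero_obj C (Dom C i)" using zero_confl[OF o(1)] .
  obtain Q where Q: "is_zero_obj C Q" using ex_zero_obj by blast
  \<comment> \<open>Exactness asks for a conflation at every term, the two ends included;
    \<open>?c\<close> and \<open>?e\<close> pad the list there.\<close>
  let ?c = "(i, Ident C Y)" and ?e = "(Ident C X, ZeroArr C X Q)"
  let ?l = "?c # \<xi> @ [?e]" and ?fs = "arrows C (Ident C Y) \<xi>"
  have e: "?e \<in> Confl C" by (rule zero_confl_to[OF o(2) Q])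
  have q: "Q \<in> Obj C" using zero_objE[OF Q] by simp
  have ex: "is_ext C \<xi> (Cod C (snd ?c)) X" using assms o by simp
  have conf: "\<forall>c \<in> set ?l. c \<in> Confl C" using i(1) e is_ext_confl[OF assms] by auto
  have Ci: "Cod C i = Y" using confl_simps(3)[OF i(1)] o by simp
  have T: "terms C ?fs = map (\<lambda>c. mid c) ?l"
    using terms_arrows[of \<xi> "Ident C Y" X] assms o Ci by simp
  have 1: "(fst (?l ! k), snd (?l ! k)) \<in> Confl C \<and> Cod C (fst (?l ! k)) = terms C ?fs ! k"
    if "k \<le> length ?fs" for k
  proof -
    have k: "k < length ?l" using that by simp
    have "?l ! k \<in> Confl C" using conf nth_mem[OF k] by blast
    then show ?thesis by (simp only: T nth_map[OF k] prod.collapse simp_thms)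
  qed
  have 2: "Cod C (snd (?l ! k)) = Dom C (fst (?l ! Suc k)) \<and> ?fs ! k = fst (?l ! Suc k) \<cdot> snd (?l ! k)"
    if "k < length ?fs" for k
    using arrows_nth[OF ex i(1), of ?e k] that by simp
  have 3: "is_zero_obj C (Dom C (fst (?l ! 0)))" using i(2) by simp
  have 4: "is_zero_obj C (Cod C (snd (?l ! length ?fs)))" using Q o q by (simp add: nth_append)
  have 0: "?fs \<noteq> []" by (cases \<xi>) simp_all
  show ?thesis
    unfolding exact_seq_def
    by (intro conjI exI[of _ "\<lambda>k. fst (?l ! k)"] exI[of _ "\<lambda>k. snd (?l ! k)"] allI impI;
        (rule 0 3 4 | erule conjunct1[OF 1] conjunct2[OF 1] conjunct1[OF 2] conjunct2[OF 2]))
qed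

lemma arrows_extensions:
  assumes "is_ext C \<xi> Y X"
  shows "arrows C (Ident C Y) \<xi> \<in> extensions C (length \<xi>) X Y"
  using exact_seq_arrows[OF assms] terms_arrows[of \<xi> "Ident C Y" X] assms is_ext_obj[OF assms]
  by (auto simp: extensions_def)

lemma iso_deflation:
  assumes "(i, p) \<in> Confl C" "is_zero_obj C (Dom C i)"
  shows "is_iso C p"
proof -
  note I = confl_simps[OF assms(1), simplified]
  note z = zero_objE[OF assms(2)]
  note [simp] = I(1-3) z(1)
  let ?E = "Cod C i"
  have i0: "i = ZeroArr C (Dom C i) ?E" using zero_obj_Hom(2)[OF assms(2), of ?E i] by (auto simp: Hom_def)
  have "Ident C ?E \<cdot> i = ZeroArr C (Dom C i) ?E" using i0 by simp
  then obtain s where s: "s \<in> Arr C" "Dom C s = Cod C p" "Cod C s = ?E" "s \<cdot> p = Ident C ?E"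
    using confl_cofactor[OF assms(1), of "Ident C ?E"] by auto
  note [simp] = s(1-3)
  have "p \<cdot> s = Ident C (Cod C p)"
    by (rule confl_epi[OF assms(1)]) (use s in auto)
  then show ?thesis by (intro isoI[of p ?E "Cod C p" s]) (use s in \<open>auto intro!: HomI\<close>)
qed

lemma iso_inflation:
  assumes "(i, p) \<in> Confl C" "is_zero_obj C (Cod C p)"
  shows "is_iso C i"
proof -
  interpret D: exact_category "opc C" by (rule exact_category_opc)
  show ?thesis using D.iso_deflation[of p i] assms by simp
qed

lemma confl_iso_left:
  assumes "(i, p) \<in> Confl C" "is_iso C a" "Cod C a = Dom C i"
  shows "(i \<cdot> a, p) \<in> Confl C"
proof -
  note I = confl_simps[OF assms(1), simplified]
  obtain b where b: "is_iso C b" "b \<in> Hom C (Cod C a) (Dom C a)" "b \<cdot> a = Ident C (Dom C a)" "a \<cdot> b = Ident C (Cod C a)"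
    using is_iso_inverse[OF assms(2)] .
  have a: "a \<in> Arr C" using assms(2) by (simp add: is_iso_def)
  note [simp] = I(1-3) a HomE[OF b(2)] assms(3)
  show ?thesis
    by (rule confl_iso_closed[OF assms(1), of "i \<cdot> a" p b "Ident C (Cod C i)" "Ident C (Cod C p)"])
      (use b assms(3) in \<open>auto intro!: HomI ident_iso\<close>)
qed

lemma confl_iso_right:
  assumes "(i, p) \<in> Confl C" "is_iso C a" "Dom C a = Cod C p"
  shows "(i, a \<cdot> p) \<in> Confl C"
proof -
  interpret D: exact_category "opc C" by (rule exact_category_opc)
  show ?thesis using D.confl_iso_left[of p i a] assms by simp
qed

text \<open>An exact sequence carries one conflation too many on the right: the last has zero
  quotient, so its inflation is invertible and is absorbed into the preceding deflation. The base
  case does this; each further step prepends a conflation.\<close>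

lemma exact_tail:
  assumes "\<And>k. 1 \<le> k \<Longrightarrow> k \<le> Suc (Suc n) \<Longrightarrow> (i k, p k) \<in> Confl C"
    and "\<And>k. k < Suc (Suc n) \<Longrightarrow> Cod C (p k) = Dom C (i (Suc k)) \<and> fs ! k = i (Suc k) \<cdot> p k"
    and "is_zero_obj C (Cod C (p (Suc (Suc n))))" "length fs = Suc (Suc n)"
  shows "\<exists>\<xi>. length \<xi> = Suc n \<and> is_ext C \<xi> (Cod C (p 0)) (Cod C (i (Suc (Suc n)))) \<and> fs = arrows C (p 0) \<xi>"
  using assms
proof (induction n arbitrary: i p fs)
  case 0
  have c: "(i 1, p 1) \<in> Confl C" "(i 2, p 2) \<in> Confl C" using 0(1)[of 1] 0(1)[of 2] by simp_all
  have e: "Cod C (p 0) = Dom C (i 1)" "fs ! 0 = i 1 \<cdot> p 0" "Cod C (p 1) = Dom C (i 2)" "fs ! 1 = i 2 \<cdot> p 1"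
    using 0(2)[of 0] 0(2)[of 1] by (simp_all add: numeral_2_eq_2)
  have z: "is_zero_obj C (Cod C (p 2))" using 0(3) by (simp add: numeral_2_eq_2)
  have iso: "is_iso C (i 2)" by (rule iso_inflation[OF c(2) z])
  have k: "(i 1, i 2 \<cdot> p 1) \<in> Confl C" by (rule confl_iso_right[OF c(1) iso]) (use e in simp)
  have fs: "fs = [fs ! 0, fs ! 1]" using 0(4) by (intro nth_equalityI) (auto simp: less_Suc_eq)
  have "Cod C (i 2 \<cdot> p 1) = Cod C (i 2)" "Cod C (i 2) \<in> Obj C"
    using confl_simps(1)[OF c(2)] confl_simps(2)[OF c(1)] e by simp_all
  then show ?case
    using k e fs by (intro exI[of _ "[(i 1, i 2 \<cdot> p 1)]"]) (auto simp: numeral_2_eq_2)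
next
  case (Suc n)
  have "\<exists>\<xi>. length \<xi> = Suc n \<and> is_ext C \<xi> (Cod C (p (Suc 0))) (Cod C (i (Suc (Suc (Suc n))))) \<and> tl fs = arrows C (p (Suc 0)) \<xi>"
  proof (rule Suc.IH[of "\<lambda>k. i (Suc k)" "\<lambda>k. p (Suc k)" "tl fs"])
    show "Cod C (p (Suc k)) = Dom C (i (Suc (Suc k))) \<and> tl fs ! k = i (Suc (Suc k)) \<cdot> p (Suc k)"
      if "k < Suc (Suc n)" for k
      using Suc.prems(2)[of "Suc k"] that Suc.prems(4) by (simp add: nth_tl)
  qed (use Suc.prems in simp_all)
  then obtain \<xi> where x: "length \<xi> = Suc n" "is_ext C \<xi> (Cod C (p (Suc 0))) (Cod C (i (Suc (Suc (Suc n)))))"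
    "tl fs = arrows C (p (Suc 0)) \<xi>" by blast
  have c: "(i 1, p 1) \<in> Confl C" using Suc.prems(1)[of 1] by simp
  have e: "Cod C (p 0) = Dom C (i 1)" "fs ! 0 = i 1 \<cdot> p 0" using Suc.prems(2)[of 0] by simp_all
  have "fs = fs ! 0 # tl fs" using Suc.prems(4) by (cases fs) auto
  then show ?case
    using x c e by (intro exI[of _ "(i 1, p 1) # \<xi>"]) auto
qed

text \<open>The conflation at the first term has zero kernel, so \<open>p 0\<close> is invertible
  and moves into the first inflation; only then is the left end literally \<open>Y\<close>.\<close>

lemma extensionsE:
  assumes "fs \<in> extensions C (Suc n) X Y"
  obtains \<xi> where "is_ext C \<xi> Y X" "length \<xi> = Suc n" "fs = arrows C (Ident C Y) \<xi>"
proof -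
  have len: "length fs = Suc (Suc n)" and fs: "exact_seq C fs" and Y: "hd (terms C fs) = Y" and X: "last (terms C fs) = X"
    using assms by (auto simp: extensions_def)
  obtain i p where c: "\<And>k. k \<le> length fs \<Longrightarrow> (i k, p k) \<in> Confl C \<and> Cod C (i k) = terms C fs ! k"
    and e: "\<And>k. k < length fs \<Longrightarrow> Cod C (p k) = Dom C (i (Suc k)) \<and> fs ! k = i (Suc k) \<cdot> p k"
    and z: "is_zero_obj C (Dom C (i 0))" "is_zero_obj C (Cod C (p (length fs)))"
    using fs unfolding exact_seq_def by metis
  have lt: "length (terms C fs) = Suc (length fs)" by (simp add: terms_def)
  obtain \<xi> where x: "length \<xi> = Suc n" "is_ext C \<xi> (Cod C (p 0)) (Cod C (i (Suc (Suc n))))" "fs = arrows C (p 0) \<xi>"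
    using exact_tail[of n i p fs] c e z len by auto
  have "terms C fs \<noteq> []" using lt by auto
  then have i: "Cod C (i 0) = Y" "Cod C (i (Suc (Suc n))) = X"
    using c[of 0] c[of "Suc (Suc n)"] Y X len lt by (simp_all add: hd_conv_nth last_conv_nth)
  have c0: "(i 0, p 0) \<in> Confl C" using c[of 0] by simp
  have iso: "is_iso C (p 0)" by (rule iso_deflation[OF c0 z(1)])
  note P = confl_simps[OF c0, simplified]
  obtain c1 \<rho> where c1: "\<xi> = c1 # \<rho>" using x(1) by (cases \<xi>) auto
  have cc: "c1 \<in> Confl C" "sub c1 = Cod C (p 0)" "is_ext C \<rho> (quo c1) X"
    using x(2) c1 i by auto
  let ?c = "(fst c1 \<cdot> p 0, snd c1)"
  have "?c \<in> Confl C" by (rule confl_iso_left[OF _ iso]) (use cc in simp_all)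
  moreover have "Dom C (fst c1 \<cdot> p 0) = Y" "(fst c1 \<cdot> p 0) \<cdot> Ident C Y = fst c1 \<cdot> p 0" using cc P i by auto
  ultimately have "is_ext C (?c # \<rho>) Y X" "fs = arrows C (Ident C Y) (?c # \<rho>)" using cc x(3) c1 by auto
  then show ?thesis using that[of "?c # \<rho>"] x(1) c1 by simp
qed

text \<open>A ladder has maps on the terms only. Those on cycles are induced on cokernels, from left
  to right; \<open>c\<close> and \<open>c'\<close> stand for the conflations just passed.\<close>

lemma mor_of_ladder:
  assumes "c \<in> Confl C" "c' \<in> Confl C" "is_ext C \<xi> (quo c) X" "is_ext C \<zeta> (quo c') X'" "length \<xi> = length \<zeta>"
    and "\<And>k. k \<le> Suc (length \<xi>) \<Longrightarrow> h k \<in> Hom C (terms C (arrows C (snd c) \<xi>) ! k) (terms C (arrows C (snd c') \<zeta>) ! k)"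
    and "\<And>k. k \<le> length \<xi> \<Longrightarrow> arrows C (snd c') \<zeta> ! k \<cdot> h k = h (Suc k) \<cdot> arrows C (snd c) \<xi> ! k"
    and "z \<in> Hom C (quo c) (quo c')" "z \<cdot> snd c = snd c' \<cdot> h 0"
  shows "mor C \<xi> \<zeta> z (h (Suc (length \<xi>)))"
  using assms
proof (induction \<xi> arbitrary: c c' \<zeta> h z)
  case Nil
  have [simp]: "\<zeta> = []" using Nil by simp
  have h1: "h 1 \<in> Hom C (quo c) (quo c')" using Nil(6)[of 1] by (simp add: terms_def)
  have "z = h 1"
    by (rule confl_epi[OF Nil(1)]) (use Nil(7)[of 0] Nil(8,9) HomE[OF h1] HomE[OF Nil(8)] in simp_all)
  then show ?case using HomE[OF Nil(8)] by simp
next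
  case (Cons e \<xi>)
  obtain e' \<zeta>' where e': "\<zeta> = e' # \<zeta>'" using Cons.prems(5) by (cases \<zeta>) auto
  note c = Cons.prems(1,2)
  have ec: "e \<in> Confl C" "sub e = quo c" "e' \<in> Confl C" "sub e' = quo c'"
    "is_ext C \<xi> (quo e) X" "is_ext C \<zeta>' (quo e') X'"
    using Cons.prems(3,4) e' by auto
  have t1: "terms C (arrows C (snd c) (e # \<xi>)) ! Suc k = terms C (arrows C (snd e) \<xi>) ! k" for k
    using terms_arrows[OF Cons.prems(3)] terms_arrows[OF ec(5)] c ec by simp
  have t2: "terms C (arrows C (snd c') \<zeta>) ! Suc k = terms C (arrows C (snd e') \<zeta>') ! k" for k
    using terms_arrows[OF Cons.prems(4)] terms_arrows[OF ec(6)] c ec e' by simp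
  have h0: "h 0 \<in> Hom C (mid c) (mid c')"
    using Cons.prems(6)[of 0] terms_arrows[OF Cons.prems(3)] terms_arrows[OF Cons.prems(4)] c by simp
  have h1: "h (Suc 0) \<in> Hom C (mid e) (mid e')"
    using Cons.prems(6)[of "Suc 0"] terms_arrows[OF Cons.prems(3)] terms_arrows[OF Cons.prems(4)] c e' by simp
  note [simp] = c ec(1-4) HomE[OF h0] HomE[OF h1] HomE[OF Cons.prems(8)]
  have "(fst e' \<cdot> snd c') \<cdot> h 0 = h (Suc 0) \<cdot> (fst e \<cdot> snd c)" using Cons.prems(7)[of 0] e' by simp
  then have "(h (Suc 0) \<cdot> fst e) \<cdot> snd c = (fst e' \<cdot> z) \<cdot> snd c" using Cons.prems(9) by simp
  then have "h (Suc 0) \<cdot> fst e = fst e' \<cdot> z" by (rule confl_epi[OF c(1), rotated 5]) simp_all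
  moreover have "z \<in> Hom C (sub e) (sub e')" using Cons.prems(8) by simp
  ultimately obtain w where w: "cmor C e e' z (h (Suc 0)) w"
    using cmor_extend_right[OF ec(1,3) _ h1] by blast
  have "mor C \<xi> \<zeta>' w (h (Suc (Suc (length \<xi>))))"
  proof (rule Cons.IH[OF ec(1,3,5,6), of "\<lambda>k. h (Suc k)"])
    show "length \<xi> = length \<zeta>'" using Cons.prems(5) e' by simp
    show "h (Suc k) \<in> Hom C (terms C (arrows C (snd e) \<xi>) ! k) (terms C (arrows C (snd e') \<zeta>') ! k)"
      if "k \<le> Suc (length \<xi>)" for k
      using Cons.prems(6)[of "Suc k"] that unfolding t1 t2 by simp
    show "arrows C (snd e') \<zeta>' ! k \<cdot> h (Suc k) = h (Suc (Suc k)) \<cdot> arrows C (snd e) \<xi> ! k" if "k \<le> length \<xi>" for k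
      using Cons.prems(7)[of "Suc k"] that e' by simp
  qed (use w in \<open>simp_all add: cmor_def\<close>)
  then show ?case using w e' by auto
qed

lemma ladder_of_mor:
  assumes "mor C \<xi> \<zeta> z b" "is_ext C \<xi> (Cod C q) X" "is_ext C \<zeta> (Cod C q') X'" "q \<in> Arr C" "q' \<in> Arr C"
    "h0 \<in> Hom C (Dom C q) (Dom C q')" "z \<in> Hom C (Cod C q) (Cod C q')" "z \<cdot> q = q' \<cdot> h0"
  shows "\<exists>h. h 0 = h0 \<and> h (Suc (length \<xi>)) = b \<and>
    (\<forall>k \<le> Suc (length \<xi>). h k \<in> Hom C (terms C (arrows C q \<xi>) ! k) (terms C (arrows C q' \<zeta>) ! k)) \<and>
    (\<forall>k \<le> length \<xi>. arrows C q' \<zeta> ! k \<cdot> h k = h (Suc k) \<cdot> arrows C q \<xi> ! k)"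
  using assms
proof (induction \<xi> arbitrary: q q' \<zeta> h0 z)
  case Nil
  then show ?case
    by (intro exI[of _ "\<lambda>k. if k = 0 then h0 else z"]) (auto simp: terms_def le_Suc_eq)
next
  case (Cons e \<xi>)
  obtain e' \<zeta>' g w where e': "\<zeta> = e' # \<zeta>'" "cmor C e e' z g w" "mor C \<xi> \<zeta>' w b"
    using mor_Cons[OF Cons.prems(1)] .
  have ec: "e \<in> Confl C" "sub e = Cod C q" "e' \<in> Confl C" "sub e' = Cod C q'"
    "is_ext C \<xi> (quo e) X" "is_ext C \<zeta>' (quo e') X'"
    using Cons.prems(2,3) e' by auto
  note M = cmorD[OF e'(2) ec(1,3)]
  have t1: "terms C (arrows C q (e # \<xi>)) = Dom C q # terms C (arrows C (snd e) \<xi>)"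
    using terms_arrows[OF Cons.prems(2,4)] terms_arrows[OF ec(5)] ec by simp
  have t2: "terms C (arrows C q' \<zeta>) = Dom C q' # terms C (arrows C (snd e') \<zeta>')"
    using terms_arrows[OF Cons.prems(3,5)] terms_arrows[OF ec(6)] ec e'(1) by simp
  have gH: "g \<in> Hom C (Dom C (snd e)) (Dom C (snd e'))" "w \<in> Hom C (quo e) (quo e')"
    using e'(2) ec by (simp_all add: cmor_def)
  obtain h where h: "h 0 = g" "h (Suc (length \<xi>)) = b"
    "\<And>k. k \<le> Suc (length \<xi>) \<Longrightarrow> h k \<in> Hom C (terms C (arrows C (snd e) \<xi>) ! k) (terms C (arrows C (snd e') \<zeta>') ! k)"
    "\<And>k. k \<le> length \<xi> \<Longrightarrow> arrows C (snd e') \<zeta>' ! k \<cdot> h k = h (Suc k) \<cdot> arrows C (snd e) \<xi> ! k"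
    using Cons.IH[OF e'(3) ec(5,6) _ _ gH M(11)] ec by auto
  note [simp] = HomE[OF Cons.prems(6)] HomE[OF Cons.prems(7)] M(4-6) Cons.prems(4,5) ec(1-4)
  have "(fst e' \<cdot> q') \<cdot> h0 = g \<cdot> (fst e \<cdot> q)"
    using M(12)[of q] Cons.prems(8) by simp
  then have s: "arrows C q' \<zeta> ! 0 \<cdot> h0 = h 0 \<cdot> arrows C q (e # \<xi>) ! 0" using e'(1) h(1) by simp
  let ?h = "case_nat h0 h"
  have "?h k \<in> Hom C (terms C (arrows C q (e # \<xi>)) ! k) (terms C (arrows C q' \<zeta>) ! k)"
    if "k \<le> Suc (length (e # \<xi>))" for k
    using that h(3) Cons.prems(6) unfolding t1 t2 by (cases k) simp_all
  moreover have "arrows C q' \<zeta> ! k \<cdot> ?h k = ?h (Suc k) \<cdot> arrows C q (e # \<xi>) ! k" if "k \<le> length (e # \<xi>)" for k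
    using that h(4) s e'(1) by (cases k) simp_all
  ultimately show ?case using h(2) by (intro exI[of _ ?h]) simp
qed

lemma yoneda_step_iff:
  assumes "is_ext C \<xi> Y X" "is_ext C \<zeta> Y X" "length \<xi> = n" "length \<zeta> = n"
  shows "yoneda_step C n X Y (arrows C (Ident C Y) \<xi>) (arrows C (Ident C Y) \<zeta>) \<longleftrightarrow> mor1 C Y X \<xi> \<zeta>"
proof -
  have Y: "Y \<in> Obj C" using is_ext_obj[OF assms(1)] by simp
  \<comment> \<open>With \<open>Ident C Y\<close> as its deflation, this conflation serves as the
    one in front, so that the ladder begins at \<open>Y\<close>.\<close>
  obtain i where i: "(i, Ident C Y) \<in> Confl C" using zero_confl[OF Y] by blast
  have I: "Ident C Y \<in> Hom C Y Y" by (rule ident_in[OF Y])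
  show ?thesis
  proof
    assume "yoneda_step C n X Y (arrows C (Ident C Y) \<xi>) (arrows C (Ident C Y) \<zeta>)"
    then obtain h where h: "h 0 = Ident C Y" "h (n + 1) = Ident C X"
      "\<And>k. k \<le> n + 1 \<Longrightarrow> h k \<in> Hom C (terms C (arrows C (Ident C Y) \<xi>) ! k) (terms C (arrows C (Ident C Y) \<zeta>) ! k)"
      "\<And>k. k \<le> n \<Longrightarrow> arrows C (Ident C Y) \<zeta> ! k \<cdot> h k = h (Suc k) \<cdot> arrows C (Ident C Y) \<xi> ! k"
      unfolding yoneda_step_def by blast
    have "mor C \<xi> \<zeta> (Ident C Y) (h (Suc (length \<xi>)))"
      by (rule mor_of_ladder[OF i i]) (use assms h Y I in simp_all)
    then show "mor1 C Y X \<xi> \<zeta>" using h(2) assms by (simp add: mor1_def)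
  next
    assume m: "mor1 C Y X \<xi> \<zeta>"
    have "\<exists>h. h 0 = Ident C Y \<and> h (Suc (length \<xi>)) = Ident C X \<and>
      (\<forall>k \<le> Suc (length \<xi>). h k \<in> Hom C (terms C (arrows C (Ident C Y) \<xi>) ! k) (terms C (arrows C (Ident C Y) \<zeta>) ! k)) \<and>
      (\<forall>k \<le> length \<xi>. arrows C (Ident C Y) \<zeta> ! k \<cdot> h k = h (Suc k) \<cdot> arrows C (Ident C Y) \<xi> ! k)"
    proof (rule ladder_of_mor[where X = X and X' = X and z = "Ident C Y"])
      show "mor C \<xi> \<zeta> (Ident C Y) (Ident C X)" using m by (simp add: mor1_def)
    qed (use assms Y I in simp_all)
    then obtain h where h: "h 0 = Ident C Y" "h (Suc (length \<xi>)) = Ident C X"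
      "\<forall>k \<le> Suc (length \<xi>). h k \<in> Hom C (terms C (arrows C (Ident C Y) \<xi>) ! k) (terms C (arrows C (Ident C Y) \<zeta>) ! k)"
      "\<forall>k \<le> length \<xi>. arrows C (Ident C Y) \<zeta> ! k \<cdot> h k = h (Suc k) \<cdot> arrows C (Ident C Y) \<xi> ! k"
      by blast
    then show "yoneda_step C n X Y (arrows C (Ident C Y) \<xi>) (arrows C (Ident C Y) \<zeta>)"
      unfolding yoneda_step_def using arrows_extensions[OF assms(1)] arrows_extensions[OF assms(2)] assms(3,4)
      by (intro conjI exI[of _ h]) simp_all
  qed
qed

text \<open>Different lists can have the same arrows, because the factorisation through cycles is
  not part of the sequence. Hence the induction ranges over all \<open>\<zeta>\<close> with the
  given arrows; two such lists are linked by a reflexive Yoneda step.\<close>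

lemma yoneda_equiv_yeq:
  assumes "(arrows C (Ident C Y) \<xi>, gs) \<in> yoneda_equiv C (Suc n) X Y"
    and "is_ext C \<xi> Y X" "length \<xi> = Suc n"
    and "gs = arrows C (Ident C Y) \<zeta>" "is_ext C \<zeta> Y X" "length \<zeta> = Suc n"
  shows "yeq C Y X \<xi> \<zeta>"
proof -
  have "equivclp (yoneda_step C (Suc n) X Y) (arrows C (Ident C Y) \<xi>) gs"
    using assms(1) by (simp add: yoneda_equiv_def)
  then have "\<forall>\<zeta>. gs = arrows C (Ident C Y) \<zeta> \<and> is_ext C \<zeta> Y X \<and> length \<zeta> = Suc n \<longrightarrow> yeq C Y X \<xi> \<zeta>"
  proof (induction rule: equivclp_induct)
    case base
    show ?case
    proof (intro allI impI, elim conjE)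
      fix \<zeta> assume z: "arrows C (Ident C Y) \<xi> = arrows C (Ident C Y) \<zeta>" "is_ext C \<zeta> Y X" "length \<zeta> = Suc n"
      have "yoneda_step C (Suc n) X Y (arrows C (Ident C Y) \<xi>) (arrows C (Ident C Y) \<xi>)"
        using yoneda_step_iff[OF assms(2,2,3,3)] mor1_refl[OF assms(2)] by simp
      then have "mor1 C Y X \<xi> \<zeta>" using yoneda_step_iff[OF assms(2) z(2) assms(3) z(3)] z(1) by simp
      then show "yeq C Y X \<xi> \<zeta>" unfolding yeq_def by (rule r_into_equivclp)
    qed
  next
    case (step gs hs)
    show ?case
    proof (intro allI impI, elim conjE)
      fix \<zeta> assume z: "hs = arrows C (Ident C Y) \<zeta>" "is_ext C \<zeta> Y X" "length \<zeta> = Suc n"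
      have "gs \<in> extensions C (Suc n) X Y" using step(2) by (auto simp: yoneda_step_def)
      then obtain \<eta> where e: "is_ext C \<eta> Y X" "length \<eta> = Suc n" "gs = arrows C (Ident C Y) \<eta>"
        by (rule extensionsE)
      have "mor1 C Y X \<eta> \<zeta> \<or> mor1 C Y X \<zeta> \<eta>"
        using step(2) yoneda_step_iff[OF e(1) z(2) e(2) z(3)] yoneda_step_iff[OF z(2) e(1) z(3) e(2)] e(3) z(1) by auto
      then have "yeq C Y X \<eta> \<zeta>"
        unfolding yeq_def by (auto intro: r_into_equivclp converse_r_into_equivclp)
      moreover have "yeq C Y X \<xi> \<eta>" using step(3) e by blast
      ultimately show "yeq C Y X \<xi> \<zeta>" unfolding yeq_def by (metis equivclp_trans)
    qed
  qed
  then show ?thesis using assms by blast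
qed

lemma mor1_yoneda_equiv:
  assumes "mor1 C Y X \<xi> \<zeta>"
  shows "(arrows C (Ident C Y) \<xi>, arrows C (Ident C Y) \<zeta>) \<in> yoneda_equiv C (length \<xi>) X Y"
proof -
  have e: "is_ext C \<xi> Y X" "is_ext C \<zeta> Y X" "length \<zeta> = length \<xi>"
    using assms unfolding mor1_def by (auto dest: mor_length)
  have "yoneda_step C (length \<xi>) X Y (arrows C (Ident C Y) \<xi>) (arrows C (Ident C Y) \<zeta>)"
    using yoneda_step_iff[OF e(1,2) refl e(3)] assms by simp
  then have "equivclp (yoneda_step C (length \<xi>) X Y) (arrows C (Ident C Y) \<xi>) (arrows C (Ident C Y) \<zeta>)"
    by (rule r_into_equivclp)
  then show ?thesis
    unfolding yoneda_equiv_def using arrows_extensions[OF e(1)] arrows_extensions[OF e(2)] e(3) by simp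
qed

lemma rigid_ext_vanishes:
  assumes "rigid C d U" "X \<in> U" "Y \<in> U" "0 < n" "n < d"
  shows "ext_vanishes n X Y"
  unfolding ext_vanishes_def
proof (intro allI impI, elim conjE)
  fix \<xi> \<zeta> assume x: "is_ext C \<xi> Y X" "is_ext C \<zeta> Y X" "length \<xi> = n" "length \<zeta> = n"
  obtain m where m: "n = Suc m" using assms(4) by (cases n) auto
  let ?f = "arrows C (Ident C Y) \<xi>" and ?g = "arrows C (Ident C Y) \<zeta>" and ?R = "yoneda_equiv C n X Y"
  have e: "?f \<in> extensions C n X Y" "?g \<in> extensions C n X Y" using arrows_extensions[OF x(1)] arrows_extensions[OF x(2)] x(3,4) by simp_all
  have "is_singleton (Ext C n X Y)" using assms unfolding rigid_def by blast
  moreover have "?R `` {?f} \<in> Ext C n X Y" "?R `` {?g} \<in> Ext C n X Y"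
    using e unfolding Ext_def by (auto intro: quotientI)
  ultimately have "?R `` {?f} = ?R `` {?g}" by (auto simp: is_singleton_def)
  moreover have "(?g, ?g) \<in> ?R" using e(2) by (simp add: yoneda_equiv_def)
  ultimately have "(?f, ?g) \<in> ?R" by blast
  then show "yeq C Y X \<xi> \<zeta>" using yoneda_equiv_yeq[of Y \<xi> ?g m X \<zeta>] x m by simp
qed

end

context rigid_subcategory
begin

lemma coresolved_eq_cores:
  assumes "0 < d"
  shows "coresolved C d U = cores C U d"
proof (intro equalityI subsetI)
  obtain n where n: "d = Suc n" using assms by (cases d) auto
  fix E assume "E \<in> coresolved C d U"
  then obtain fs where E: "E \<in> Obj C" "length fs = d" "exact_seq C fs" "terms C fs ! 0 = E"
    and U: "\<And>k. 1 \<le> k \<Longrightarrow> k \<le> d \<Longrightarrow> terms C fs ! k \<in> U" unfolding coresolved_def by blast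
  obtain i p where c: "\<And>k. k \<le> d \<Longrightarrow> (i k, p k) \<in> Confl C \<and> Cod C (i k) = terms C fs ! k"
    and e: "\<And>k. k < d \<Longrightarrow> Cod C (p k) = Dom C (i (Suc k)) \<and> fs ! k = i (Suc k) \<cdot> p k"
    and z: "is_zero_obj C (Dom C (i 0))" "is_zero_obj C (Cod C (p d))"
    using E(2,3) unfolding exact_seq_def by metis
  \<comment> \<open>The cycle after position \<open>k\<close> still has \<open>d - k\<close> terms
    to its right, so the recursion starts from the zero object at the right end.\<close>
  have Z: "Cod C (p k) \<in> cores C U (d - k)" if "k \<le> d" for k
    using that
  proof (induction "d - k" arbitrary: k)
    case 0
    then show ?case using z(2) by simp
  next
    case (Suc m)
    then have k: "k < d" "m = d - Suc k" by auto
    have s: "d - k = Suc (d - Suc k)" using k by simp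
    have "Cod C (p (Suc k)) \<in> cores C U (d - Suc k)" using Suc.hyps(1)[OF k(2)] k(1) by simp
    then show ?case
      unfolding s using c[of "Suc k"] e[of k] U[of "Suc k"] k(1)
      by (intro cores_SucI[of "(i (Suc k), p (Suc k))"]) auto
  qed
  have c0: "(i 0, p 0) \<in> Confl C" and c1: "(i 1, p 1) \<in> Confl C" using c[of 0] c[of 1] assms by auto
  have iso: "is_iso C (p 0)" by (rule iso_deflation[OF c0 z(1)])
  have e0: "Cod C (p 0) = Dom C (i 1)" using e[of 0] assms by simp
  have k: "(i 1 \<cdot> p 0, p 1) \<in> Confl C" by (rule confl_iso_left[OF c1 iso e0])
  have "Dom C (i 1 \<cdot> p 0) = E" "Cod C (i 1 \<cdot> p 0) \<in> U"
    using confl_simps[OF c0] confl_simps[OF c1] e0 c[of 0] c[of 1] E(4) U[of 1] assms by simp_all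
  then show "E \<in> cores C U d"
    using Z[of 1] n by (auto intro!: cores_SucI[OF k] simp del: cores.simps)
next
  obtain n where n: "d = Suc n" using assms by (cases d) auto
  fix E assume "E \<in> cores C U d"
  then obtain \<rho> X where r: "is_ext C \<rho> E X" "mids_in C U \<rho>" "X \<in> U" "length \<rho> = n"
    using cores_ext[of E n] n by auto
  have E: "E \<in> Obj C" using is_ext_obj[OF r(1)] by simp
  have t: "terms C (arrows C (Ident C E) \<rho>) = E # map (\<lambda>c. mid c) \<rho> @ [X]"
    using terms_arrows[of \<rho> "Ident C E" X] r(1) E by simp
  have "terms C (arrows C (Ident C E) \<rho>) ! k \<in> U" if kd: "1 \<le> k" "k \<le> d" for k
  proof -
    obtain j where j: "k = Suc j" using kd(1) by (cases k) auto
    have "(map (\<lambda>c. mid c) \<rho> @ [X]) ! j \<in> set (map (\<lambda>c. mid c) \<rho> @ [X])"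
      by (rule nth_mem) (use that j n r(4) in simp)
    then show ?thesis unfolding t j using r(2,3) by auto
  qed
  then show "E \<in> coresolved C d U"
    unfolding coresolved_def using E exact_seq_arrows[OF r(1)] r(4) n t
    by (intro CollectI conjI exI[of _ "arrows C (Ident C E) \<rho>"]) auto
qed

end

theorem theorem3p16:
  fixes \<E> :: "('o, 'm) preexact_cat" and \<U> :: "'o set" and d :: nat
  assumes "d \<ge> 1"
    and "exact_category \<E>"
    and "additive_subcategory \<E> \<U>"
    and "rigid \<E> d \<U>"
  shows "extension_closed \<E> (coresolved \<E> d \<U>) \<longleftrightarrow>
    (\<forall>U' \<in> \<U>. \<forall>U \<in> \<U>. \<forall>fs \<in> extensions \<E> d U' U.
       (\<forall>k. 2 \<le> k \<and> k \<le> d \<longrightarrow> terms \<E> fs ! k \<in> \<U>) \<longrightarrow>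
       (\<exists>gs. (fs, gs) \<in> yoneda_equiv \<E> d U' U \<and> set (terms \<E> gs) \<subseteq> \<U>))"
proof -
  interpret exact_category \<E> by fact
  interpret rigid_subcategory \<E> \<U> d
    by unfold_locales (use assms(3,4) rigid_ext_vanishes in auto)
  obtain n where n: "d = Suc n" using assms(1) by (cases d) auto
  have cr: "coresolved \<E> d \<U> = cores \<E> \<U> d" by (rule coresolved_eq_cores) (use n in simp)
  have T: "terms \<E> (arrows \<E> (Ident \<E> Y) \<xi>) = Y # map (\<lambda>c. Cod \<E> (fst c)) \<xi> @ [X]" if "is_ext \<E> \<xi> Y X" for \<xi> Y X
    using terms_arrows[of \<xi> "Ident \<E> Y" X] that is_ext_obj[OF that] by simp
  \<comment> \<open>Positions \<open>0\<close> and \<open>d + 1\<close> are the ends and position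
    \<open>1\<close> is the unrestricted term, so the tail \<open>\<rho>\<close> occupies exactly
    positions \<open>2\<close> to \<open>d\<close>.\<close>
  have mids: "mids_in \<E> \<U> \<rho> \<longleftrightarrow> (\<forall>k. 2 \<le> k \<and> k \<le> d \<longrightarrow> terms \<E> (arrows \<E> (Ident \<E> Y) (c # \<rho>)) ! k \<in> \<U>)"
    if e: "is_ext \<E> (c # \<rho>) Y X" "length (c # \<rho>) = d" for c \<rho> Y X
  proof -
    have "terms \<E> (arrows \<E> (Ident \<E> Y) (c # \<rho>)) ! Suc (Suc j) = Cod \<E> (fst (\<rho> ! j))" if "j < length \<rho>" for j
      unfolding T[OF e(1)] using that by (simp add: nth_append)
    moreover have "2 \<le> k \<and> k \<le> d \<longleftrightarrow> (\<exists>j < length \<rho>. k = Suc (Suc j))" for k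
      using e(2) by (cases k; cases "k - 1") auto
    ultimately show ?thesis by (auto simp: all_set_conv_all_nth)
  qed
  show ?thesis
  proof
    assume "extension_closed \<E> (coresolved \<E> d \<U>)"
    then have H: "Cod \<E> (fst c) \<in> cores \<E> \<U> d"
      if "c \<in> Confl \<E>" "Dom \<E> (fst c) \<in> cores \<E> \<U> d" "Cod \<E> (snd c) \<in> cores \<E> \<U> d" for c
      using that unfolding extension_closed_def cr by (cases c) auto
    show "\<forall>U' \<in> \<U>. \<forall>U \<in> \<U>. \<forall>fs \<in> extensions \<E> d U' U.
       (\<forall>k. 2 \<le> k \<and> k \<le> d \<longrightarrow> terms \<E> fs ! k \<in> \<U>) \<longrightarrow>
       (\<exists>gs. (fs, gs) \<in> yoneda_equiv \<E> d U' U \<and> set (terms \<E> gs) \<subseteq> \<U>)"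
    proof (intro ballI impI)
      fix X Y fs assume XY: "X \<in> \<U>" "Y \<in> \<U>" and fs: "fs \<in> extensions \<E> d X Y"
        and t: "\<forall>k. 2 \<le> k \<and> k \<le> d \<longrightarrow> terms \<E> fs ! k \<in> \<U>"
      obtain \<xi> where x: "is_ext \<E> \<xi> Y X" "length \<xi> = Suc n" "fs = arrows \<E> (Ident \<E> Y) \<xi>"
        using extensionsE[OF fs[unfolded n]] .
      obtain c \<rho> where c: "\<xi> = c # \<rho>" using x(2) by (cases \<xi>) auto
      have l: "length (c # \<rho>) = d" using x(2) c n by simp
      have m: "mids_in \<E> \<U> \<rho>" using mids[OF x(1)[unfolded c] l] t x(3) c by simp
      obtain \<tau> where tau: "mor1 \<E> Y X \<xi> \<tau>" "mids_in \<E> \<U> \<tau>"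
        using cores_extension_closedD[OF H XY x(1)[unfolded c] l m] c by auto
      have "is_ext \<E> \<tau> Y X" using tau(1) by (simp add: mor1_def)
      then have "set (terms \<E> (arrows \<E> (Ident \<E> Y) \<tau>)) \<subseteq> \<U>" using T XY tau(2) by auto
      moreover have "(fs, arrows \<E> (Ident \<E> Y) \<tau>) \<in> yoneda_equiv \<E> d X Y"
        using mor1_yoneda_equiv[OF tau(1)] x n by simp
      ultimately show "\<exists>gs. (fs, gs) \<in> yoneda_equiv \<E> d X Y \<and> set (terms \<E> gs) \<subseteq> \<U>" by blast
    qed
  next
    assume R: "\<forall>U' \<in> \<U>. \<forall>U \<in> \<U>. \<forall>fs \<in> extensions \<E> d U' U.
       (\<forall>k. 2 \<le> k \<and> k \<le> d \<longrightarrow> terms \<E> fs ! k \<in> \<U>) \<longrightarrow>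
       (\<exists>gs. (fs, gs) \<in> yoneda_equiv \<E> d U' U \<and> set (terms \<E> gs) \<subseteq> \<U>)"
    have H: "\<exists>\<tau>. is_ext \<E> \<tau> Y X \<and> yeq \<E> Y X (c # \<rho>) \<tau> \<and> mids_in \<E> \<U> \<tau>"
      if XY: "X \<in> \<U>" "Y \<in> \<U>" and e: "is_ext \<E> (c # \<rho>) Y X" "length (c # \<rho>) = d" "mids_in \<E> \<U> \<rho>" for X Y c \<rho>
    proof -
      let ?fs = "arrows \<E> (Ident \<E> Y) (c # \<rho>)"
      have "?fs \<in> extensions \<E> d X Y" using arrows_extensions[OF e(1)] e(2) by simp
      then obtain gs where gs: "(?fs, gs) \<in> yoneda_equiv \<E> d X Y" "set (terms \<E> gs) \<subseteq> \<U>"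
        using R XY mids[OF e(1,2)] e(3) by blast
      have "gs \<in> extensions \<E> (Suc n) X Y" using gs(1) n by (simp add: yoneda_equiv_def)
      then obtain \<tau> where t: "is_ext \<E> \<tau> Y X" "length \<tau> = Suc n" "gs = arrows \<E> (Ident \<E> Y) \<tau>"
        by (rule extensionsE)
      have "yeq \<E> Y X (c # \<rho>) \<tau>"
        by (rule yoneda_equiv_yeq[OF gs(1)[unfolded n] e(1) _ t(3,1,2)]) (use e n in simp)
      moreover have "mids_in \<E> \<U> \<tau>" using gs(2) T[OF t(1)] t(3) by auto
      ultimately show ?thesis using t(1) by blast
    qed
    have "Cod \<E> (fst c) \<in> cores \<E> \<U> d"
      if "c \<in> Confl \<E>" "Dom \<E> (fst c) \<in> cores \<E> \<U> d" "Cod \<E> (snd c) \<in> cores \<E> \<U> d" for c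
      by (rule cores_extension_closedI[OF _ that H]) (use n in simp_all)
    then show "extension_closed \<E> (coresolved \<E> d \<U>)"
      unfolding extension_closed_def cr by force
  qed
qed

end
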